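(* Let $1/2<s<1$, let $\lambda,\gamma>0$, and let $u$ be a solution of $$(-\Delta)^s u=\lambda\,(u-\gamma)_+\ \text{ in }\Omega,\qquad u=0\ \text{ on }\partial\Omega .$$ Then there exists an open set $U\subset\Omega$ (in the topology of $\Omega$) containing $\{x\in\Omega:u(x)=\gamma\}$ such that $$\Delta u(x)>0\quad\text{for every }x\in U,$$ where $\Delta$ is the classical $n$-dimensional Laplacian on $\mathbb{R}^n$.
   Context: $\Omega\subset\mathbb{R}^n$ is a smooth bounded domain. $(-\Delta)^s$ is the spectral fractional Laplacian on $\Omega$: if $0<\lambda_1<\lambda_2\le\dots$ and $\{\phi_k\}$ are the Dirichlet eigenvalues and $L^2$-orthonormal eigenfunctions of $-\Delta$ on $\Omega$ and $f=\sum_k a_k\phi_k$, then $(-\Delta)^sf=\sum_k\lambda_k^sa_k\phi_k$. Solutions $u$ are taken in the energy space $\{\sum_k a_k\phi_k:\sum_k\lambda_k^sa_k^2<\infty\}$; they are identified with their continuous representative, and $u$ is of class $C^2$ in $\Omega$ when $s>1/2$. (In the paper $u$ is also identified with its extension to $\Omega\times(0,\infty)$, so $u(x)$ is written $u(x,0)$.) $t_+=\max(t,0)$. *)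

theory Defs
  imports "HOL-Analysis.Analysis"
begin

definition partial_deriv :: "'n::finite \<Rightarrow> (real ^ 'n \<Rightarrow> real) \<Rightarrow> real ^ 'n \<Rightarrow> real" where
  "partial_deriv i f x = frechet_derivative f (at x) (axis i 1)"

definition laplacian :: "(real ^ 'n::finite \<Rightarrow> real) \<Rightarrow> real ^ 'n \<Rightarrow> real" where
  "laplacian f x = (\<Sum>i\<in>UNIV. partial_deriv i (partial_deriv i f) x)"

(* Intended for open S only: derivatives are taken at points of S in the full space. *)
primrec Ck_on :: "nat \<Rightarrow> (real ^ 'n::finite \<Rightarrow> real) \<Rightarrow> (real ^ 'n) set \<Rightarrow> bool" where
  "Ck_on 0 f S \<longleftrightarrow> continuous_on S f"
| "Ck_on (Suc k) f S \<longleftrightarrow>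
     (\<forall>x\<in>S. f differentiable (at x)) \<and> (\<forall>i. Ck_on k (partial_deriv i f) S)"

(* Near each boundary point, \<Omega> is a strict sublevel set of a smooth function without
   critical points, i.e. \<Omega> lies locally on one side of a smooth hypersurface
   (for n = 1: of a point). *)
definition smooth_boundary :: "(real ^ 'n::finite) set \<Rightarrow> bool" where
  "smooth_boundary \<Omega> \<longleftrightarrow>
     (\<forall>p\<in>frontier \<Omega>. \<exists>V \<rho>. open V \<and> p \<in> V \<and> (\<forall>k. Ck_on k \<rho> V) \<and>
        (\<forall>x\<in>V. \<exists>i. partial_deriv i \<rho> x \<noteq> 0) \<and>
        \<Omega> \<inter> V = {x\<in>V. \<rho> x < 0})"

definition smooth_bounded_domain :: "(real ^ 'n::finite) set \<Rightarrow> bool" where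
  "smooth_bounded_domain \<Omega> \<longleftrightarrow>
     open \<Omega> \<and> connected \<Omega> \<and> \<Omega> \<noteq> {} \<and> bounded \<Omega> \<and> smooth_boundary \<Omega>"

(* Representatives: values outside \<Omega> are irrelevant, and no quotient by a.e. equality is taken. *)
definition L2_on :: "(real ^ 'n::finite) set \<Rightarrow> (real ^ 'n \<Rightarrow> real) set" where
  "L2_on \<Omega> = {f. f \<in> borel_measurable (lebesgue_on \<Omega>) \<and>
                  integrable (lebesgue_on \<Omega>) (\<lambda>x. (f x)\<^sup>2)}"

(* f = (\<Sum>k. a k * \<phi> k), with convergence of the partial sums in the L2 norm on \<Omega> *)
definition L2_expansion ::
  "(real ^ 'n::finite) set \<Rightarrow> (nat \<Rightarrow> real ^ 'n \<Rightarrow> real) \<Rightarrow> (nat \<Rightarrow> real) \<Rightarrow> (real ^ 'n \<Rightarrow> real) \<Rightarrow> bool"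
where
  "L2_expansion \<Omega> \<phi> a f \<longleftrightarrow>
     f \<in> L2_on \<Omega> \<and> (\<forall>k. \<phi> k \<in> L2_on \<Omega>) \<and>
     (\<lambda>N. \<integral>x. (f x - (\<Sum>k<N. a k * \<phi> k x))\<^sup>2 \<partial>(lebesgue_on \<Omega>)) \<longlonglongrightarrow> 0"

definition dirichlet_eigenfunction ::
  "(real ^ 'n::finite) set \<Rightarrow> real \<Rightarrow> (real ^ 'n \<Rightarrow> real) \<Rightarrow> bool" where
  "dirichlet_eigenfunction \<Omega> \<mu> \<psi> \<longleftrightarrow>
     Ck_on 2 \<psi> \<Omega> \<and> continuous_on (closure \<Omega>) \<psi> \<and>
     (\<forall>x\<in>\<Omega>. - laplacian \<psi> x = \<mu> * \<psi> x) \<and>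
     (\<forall>x\<in>frontier \<Omega>. \<psi> x = 0) \<and>
     (\<exists>x\<in>\<Omega>. \<psi> x \<noteq> 0)"

(* Indices start at 0: \<mu> k and \<phi> k are the (k+1)-st eigenvalue and eigenfunction. Eigenvalues are
   repeated according to multiplicity; the expansion property (completeness in L2) ensures that
   none is omitted. *)
definition dirichlet_eigensystem ::
  "(real ^ 'n::finite) set \<Rightarrow> (nat \<Rightarrow> real) \<Rightarrow> (nat \<Rightarrow> real ^ 'n \<Rightarrow> real) \<Rightarrow> bool" where
  "dirichlet_eigensystem \<Omega> \<mu> \<phi> \<longleftrightarrow>
     0 < \<mu> 0 \<and> \<mu> 0 < \<mu> 1 \<and> incseq \<mu> \<and>
     (\<forall>k. dirichlet_eigenfunction \<Omega> (\<mu> k) (\<phi> k)) \<and>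
     (\<forall>j k. (\<integral>x. \<phi> j x * \<phi> k x \<partial>(lebesgue_on \<Omega>)) = (if j = k then 1 else 0)) \<and>
     (\<forall>f\<in>L2_on \<Omega>. \<exists>a. L2_expansion \<Omega> \<phi> a f)"

definition energy_space ::
  "(real ^ 'n::finite) set \<Rightarrow> (nat \<Rightarrow> real) \<Rightarrow> (nat \<Rightarrow> real ^ 'n \<Rightarrow> real) \<Rightarrow> real \<Rightarrow>
     (real ^ 'n \<Rightarrow> real) set" where
  "energy_space \<Omega> \<mu> \<phi> s =
     {u. \<exists>a. L2_expansion \<Omega> \<phi> a u \<and> summable (\<lambda>k. \<mu> k powr s * (a k)\<^sup>2)}"

(* The spectral fractional Laplacian of order s sends u to g, for g in L2. A relation, because
   on the energy space the operator is only partially defined as a map into L2. *)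
definition has_spectral_frac_laplacian ::
  "(real ^ 'n::finite) set \<Rightarrow> (nat \<Rightarrow> real) \<Rightarrow> (nat \<Rightarrow> real ^ 'n \<Rightarrow> real) \<Rightarrow> real \<Rightarrow>
     (real ^ 'n \<Rightarrow> real) \<Rightarrow> (real ^ 'n \<Rightarrow> real) \<Rightarrow> bool" where
  "has_spectral_frac_laplacian \<Omega> \<mu> \<phi> s u g \<longleftrightarrow>
     (\<exists>a. L2_expansion \<Omega> \<phi> a u \<and> L2_expansion \<Omega> \<phi> (\<lambda>k. \<mu> k powr s * a k) g)"

end

theory Submission
  imports Defs
begin

text \<open>Let \<open>A = - \<Delta>\<close> with Dirichlet conditions, \<open>\<sigma> = 1 - s\<close> and \<open>f = lam (u - \<gamma>)\<^sub>+\<close>, so that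
  \<open>- \<Delta> u = A\<^sup>\<sigma> f\<close> and, up to a positive constant, \<open>A\<^sup>\<sigma> f = \<integral> \<tau>\<^sup>\<sigma>\<^sup>-\<^sup>1 A (A + \<tau>)\<^sup>-\<^sup>1 f d\<tau>\<close> with
  \<open>A (A + \<tau>)\<^sup>-\<^sup>1 f = f - \<tau> (A + \<tau>)\<^sup>-\<^sup>1 f\<close>. At a point \<open>z\<close> with \<open>u z = \<gamma>\<close> the function \<open>f \<ge> 0\<close>
  attains its minimum \<open>0\<close>, and \<open>(A + \<tau>)\<^sup>-\<^sup>1 f > 0\<close> there by the maximum principle, unless \<open>f = 0\<close>,
  which would give \<open>u = 0\<close>. Hence \<open>\<Delta> u z > 0\<close>.

  To avoid pointwise convergence, everything is paired with a bump \<open>\<psi>\<close> concentrated near \<open>z\<close>.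
  With \<open>\<epsilon> = \<integral> f \<psi> / \<integral> \<psi>\<close>, the integrand at \<open>\<tau>\<close> is at most \<open>\<epsilon> \<integral> \<psi>\<close>, at most \<open>(\<epsilon> - c \<tau>) \<integral> \<psi>\<close> for
  \<open>\<tau> \<le> 1\<close>, and at most \<open>B / \<tau> \<integral> \<psi>\<close> because \<open>A f \<le> B\<close> weakly, by convexity of the positive part.\<close>

subsection \<open>Integration by parts\<close>

text \<open>Only the eigenfunction coefficients of \<open>(A + \<tau>)^-1 f\<close> are at hand, not
  a C2 function continuous up to the boundary, so the classical maximum principle does not apply to
  it directly. It is applied to partial sums of the expansion: these are C2 and vanish on the
  boundary, but solve the equation only up to an L2-small error, which the comparison principle has
  to tolerate. Order is then expressed on coefficient sequences, which also covers iterated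
  resolvents.

  The bound with \<open>\<epsilon>\<close> alone would not suffice, since
  \<open>\<tau> powr (\<sigma> - 1)\<close> is not integrable at infinity; the bound
  \<open>B / \<tau>\<close> makes the tail finite. Neither \<open>B\<close> nor \<open>c\<close>
  depends on the bump. So the cut \<open>T\<close> is fixed before the bump, making the tail small
  against the gain from \<open>c\<close>; then the support of \<open>\<psi>\<close> is shrunk until
  \<open>\<epsilon> * T powr \<sigma>\<close> is small too.

  That \<open>c\<close> is uniform in \<open>\<tau> \<le> 1\<close> comes from replacing
  \<open>(A + \<tau>)^-1\<close> by a fixed power of \<open>(A + 2)^-1\<close>, one factor for each
  ball of a chain from a point with \<open>f > 0\<close> to \<open>z\<close>.\<close>

definition has_partial_deriv :: "'n::finite \<Rightarrow> (real ^ 'n \<Rightarrow> real) \<Rightarrow> real \<Rightarrow> real ^ 'n \<Rightarrow> bool" where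
  "has_partial_deriv i f D x \<longleftrightarrow> ((\<lambda>t. f (x + t *\<^sub>R axis i 1)) has_real_derivative D) (at 0)"

lemma has_partial_deriv_along:
  assumes "has_partial_deriv i f D (x + t *\<^sub>R axis i 1)"
  shows "((\<lambda>t. f (x + t *\<^sub>R axis i 1)) has_real_derivative D) (at t)"
proof -
  have "((\<lambda>s. f (x + (s + t) *\<^sub>R axis i 1)) has_real_derivative D) (at 0)"
    using assms by (simp add: has_partial_deriv_def algebra_simps scaleR_add_left)
  then show ?thesis
    using DERIV_shift[of "\<lambda>t. f (x + t *\<^sub>R axis i 1)" D 0 t] by simp
qed

lemma has_partial_deriv_cong:
  assumes "has_partial_deriv i f D x" "open S" "x \<in> S" "\<And>y. y \<in> S \<Longrightarrow> f y = g y"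
  shows "has_partial_deriv i g D x"
proof -
  have "((\<lambda>t. x + t *\<^sub>R axis i 1) \<longlongrightarrow> x + 0 *\<^sub>R axis i 1) (at (0::real))"
    by (intro tendsto_intros)
  then have "\<forall>\<^sub>F t in at (0::real). x + t *\<^sub>R axis i 1 \<in> S"
    using assms(2,3) by (simp add: topological_tendstoD)
  then have "\<forall>\<^sub>F t in nhds (0::real). x + t *\<^sub>R axis i 1 \<in> S"
    using assms(3) by (simp add: eventually_nhds_conv_at)
  then have "\<forall>\<^sub>F t in nhds (0::real). f (x + t *\<^sub>R axis i 1) = g (x + t *\<^sub>R axis i 1)"
    by eventually_elim (use assms(4) in auto)
  then show ?thesis
    using assms(1) by (simp add: has_partial_deriv_def cong: DERIV_cong_ev)
qed

lemma has_partial_deriv_unique: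
  "has_partial_deriv i f D x \<Longrightarrow> has_partial_deriv i f D' x \<Longrightarrow> D = D'"
  unfolding has_partial_deriv_def by (rule DERIV_unique)

lemma has_partial_deriv_const: "has_partial_deriv i (\<lambda>_. c) 0 x"
  unfolding has_partial_deriv_def by simp

lemma has_partial_deriv_add:
  "has_partial_deriv i f D x \<Longrightarrow> has_partial_deriv i g E x \<Longrightarrow>
   has_partial_deriv i (\<lambda>x. f x + g x) (D + E) x"
  unfolding has_partial_deriv_def by (rule DERIV_add)

lemma has_partial_deriv_diff:
  "has_partial_deriv i f D x \<Longrightarrow> has_partial_deriv i g E x \<Longrightarrow>
   has_partial_deriv i (\<lambda>x. f x - g x) (D - E) x"
  unfolding has_partial_deriv_def by (rule DERIV_diff)

lemma has_partial_deriv_mult: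
  "has_partial_deriv i f D x \<Longrightarrow> has_partial_deriv i g E x \<Longrightarrow>
   has_partial_deriv i (\<lambda>x. f x * g x) (D * g x + E * f x) x"
  unfolding has_partial_deriv_def by (drule (1) DERIV_mult) simp

lemma has_partial_deriv_cmult:
  "has_partial_deriv i f D x \<Longrightarrow> has_partial_deriv i (\<lambda>x. c * f x) (c * D) x"
  unfolding has_partial_deriv_def by (rule DERIV_cmult)

lemma has_partial_deriv_compose:
  assumes "(p has_real_derivative p') (at (f x))" "has_partial_deriv i f D x"
  shows "has_partial_deriv i (\<lambda>x. p (f x)) (p' * D) x"
  using assms DERIV_chain2[of p p' "\<lambda>t. f (x + t *\<^sub>R axis i 1)" 0 D UNIV]
  unfolding has_partial_deriv_def by simp

lemma has_partial_deriv_differentiable: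
  assumes "f differentiable (at x)"
  shows "has_partial_deriv i f (partial_deriv i f x) x"
proof -
  let ?F = "frechet_derivative f (at x)"
  have F: "(f has_derivative ?F) (at x)"
    using assms frechet_derivative_works by blast
  have "((\<lambda>t. x + t *\<^sub>R axis i 1) has_derivative (\<lambda>t. t *\<^sub>R axis i 1)) (at (0::real))"
    by (auto intro!: derivative_eq_intros)
  from has_derivative_compose[OF this, of f ?F] F
  have "((\<lambda>t. f (x + t *\<^sub>R axis i 1)) has_derivative (\<lambda>t. ?F (t *\<^sub>R axis i 1))) (at 0)"
    by simp
  moreover have "(\<lambda>t. ?F (t *\<^sub>R axis i 1)) = (*) (partial_deriv i f x)"
    using linear_cmul[OF has_derivative_linear[OF F]] by (auto simp: partial_deriv_def)
  ultimately show ?thesis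
    by (simp add: has_partial_deriv_def has_field_derivative_def)
qed

text \<open>By translation invariance all difference quotients of \<open>G\<close> have integral zero.\<close>

lemma integral_partial_deriv_lborel:
  fixes G G' :: "real ^ 'n::finite \<Rightarrow> real"
  assumes G: "continuous_on UNIV G" and G': "continuous_on UNIV G'"
    and K: "compact K" "\<And>x. x \<notin> K \<Longrightarrow> G x = 0" "\<And>x. x \<notin> K \<Longrightarrow> G' x = 0"
    and D: "\<And>x. has_partial_deriv i G (G' x) x"
  shows "(\<integral>x. G' x \<partial>lborel) = 0"
proof -
  have intg: "integrable lborel h" if "continuous_on UNIV h" "\<And>x. x \<notin> K \<Longrightarrow> h x = 0"
    for h :: "real ^ 'n \<Rightarrow> real"
  proof -
    have "integrable lborel (\<lambda>x. indicator K x *\<^sub>R h x)"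
      by (rule borel_integrable_compact) (use K that in \<open>auto intro: continuous_on_subset\<close>)
    moreover have "(\<lambda>x. indicator K x *\<^sub>R h x) = h"
      using that by (auto simp: fun_eq_iff indicator_def)
    ultimately show ?thesis by simp
  qed
  let ?e = "axis i 1 :: real ^ 'n"
  define h where "h n = inverse (real (Suc n))" for n
  have h: "0 < h n" "h n \<le> 1" for n
    by (auto simp: h_def field_simps)
  have h0: "h \<longlonglongrightarrow> 0"
    unfolding h_def by (rule LIMSEQ_inverse_real_of_nat)
  define S where "S n x = (G (x + h n *\<^sub>R ?e) - G x) / h n" for n x
  \<comment> \<open>The unit enlargement of \<open>K\<close> contains the supports of all quotients
    \<open>S n\<close>, because \<open>h n \<le> 1\<close>; its indicator yields the integrable
    majorant.\<close>
  define K' where "K' = {x + y | x y. x \<in> K \<and> y \<in> cball 0 1}"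
  have "compact K'"
    unfolding K'_def using K(1) by (intro compact_sums) auto
  have "bounded (G' ` K)"
    using K(1) G' by (intro compact_imp_bounded compact_continuous_image) (auto intro: continuous_on_subset)
  then obtain B where "B > 0" and B: "\<And>x. x \<in> K \<Longrightarrow> \<bar>G' x\<bar> \<le> B"
    unfolding bounded_pos by auto
  have B': "\<bar>G' x\<bar> \<le> B" for x
    using B[of x] K(3)[of x] \<open>B > 0\<close> by (cases "x \<in> K") auto
  have trans: "integrable lborel (\<lambda>x. G (x + c))" "(\<integral>x. G (x + c) \<partial>lborel) = (\<integral>x. G x \<partial>lborel)" for c
  proof -
    have [measurable]: "G \<in> borel_measurable borel"
      using G by (rule borel_measurable_continuous_onI)
    have "integrable (distr lborel borel ((+) c)) G"
      using intg[OF G K(2)] by (simp add: lborel_distr_plus)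
    then show "integrable lborel (\<lambda>x. G (x + c))"
      by (subst (asm) integrable_distr_eq) (auto simp: add.commute)
    have "(\<integral>x. G x \<partial>(distr lborel borel ((+) c))) = (\<integral>x. G (c + x) \<partial>lborel)"
      by (rule integral_distr) auto
    then show "(\<integral>x. G (x + c) \<partial>lborel) = (\<integral>x. G x \<partial>lborel)"
      by (simp add: lborel_distr_plus add.commute)
  qed
  have S0: "(\<integral>x. S n x \<partial>lborel) = 0" for n
    unfolding S_def using trans[of "h n *\<^sub>R ?e"] intg[OF G K(2)] by simp
  have lim: "(\<lambda>n. S n x) \<longlonglongrightarrow> G' x" for x
  proof -
    have "((\<lambda>t. (G (x + t *\<^sub>R ?e) - G x) / t) \<longlongrightarrow> G' x) (at 0)"
      using D[of x] unfolding has_partial_deriv_def DERIV_def by simp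
    moreover have "filterlim h (at 0) sequentially"
      using h0 h(1) by (simp add: filterlim_at) (metis (mono_tags) eventually_sequentiallyI less_irrefl)
    ultimately show ?thesis
      unfolding S_def by (rule filterlim_compose)
  qed
  have dom: "norm (S n x) \<le> B * indicator K' x" for n x
  proof -
    \<comment> \<open>By the mean value theorem the quotient is a value of \<open>G'\<close> at a
      nearby point, so it inherits the bound \<open>B\<close> and, up to the enlargement, the
      support.\<close>
    have "\<exists>z>0. z < h n \<and> G (x + h n *\<^sub>R ?e) - G (x + 0 *\<^sub>R ?e) = (h n - 0) * G' (x + z *\<^sub>R ?e)"
      by (rule MVT2, use h in simp) (rule has_partial_deriv_along[OF D])
    then obtain z where z: "0 < z" "z < h n" "G (x + h n *\<^sub>R ?e) - G x = h n * G' (x + z *\<^sub>R ?e)"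
      by auto
    then have S: "S n x = G' (x + z *\<^sub>R ?e)"
      using h[of n] by (simp add: S_def)
    show ?thesis
    proof (cases "x \<in> K'")
      case True
      then show ?thesis using B' S by simp
    next
      case False
      have "norm (- z *\<^sub>R ?e) \<le> 1"
        using z h[of n] by simp
      moreover have "x = (x + z *\<^sub>R ?e) + (- z *\<^sub>R ?e)"
        by simp
      ultimately have "x + z *\<^sub>R ?e \<notin> K"
        using False unfolding K'_def by (smt (verit, best) mem_Collect_eq mem_cball_0)
      then show ?thesis using S K(3) False by simp
    qed
  qed
  have [measurable]: "G \<in> borel_measurable borel" "G' \<in> borel_measurable borel"
    using G G' by (auto intro: borel_measurable_continuous_onI)
  have "(\<lambda>n. \<integral>x. S n x \<partial>lborel) \<longlonglongrightarrow> (\<integral>x. G' x \<partial>lborel)"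
  proof (rule integral_dominated_convergence[where w = "\<lambda>x. B * indicator K' x"])
    show "integrable lborel (\<lambda>x. B * indicator K' x)"
      using \<open>compact K'\<close> emeasure_compact_finite[of K']
      by (auto intro!: integrable_mult_right integrable_real_indicator simp: compact_imp_closed)
  qed (use lim dom in \<open>auto simp: S_def\<close>)
  then show ?thesis
    using S0 by (simp add: LIMSEQ_const_iff)
qed

text \<open>The open sets \<open>\<Omega>\<close> and \<open>- K\<close> cover the space, and on
  \<open>- K\<close> the extension is constantly zero.\<close>

lemma continuous_on_extend_zero:
  fixes F :: "'a::t2_space \<Rightarrow> real"
  assumes "open \<Omega>" "continuous_on \<Omega> F" "compact K" "K \<subseteq> \<Omega>" "\<And>x. x \<in> \<Omega> - K \<Longrightarrow> F x = 0"
  shows "continuous_on UNIV (\<lambda>x. if x \<in> \<Omega> then F x else 0)"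
proof -
  let ?G = "\<lambda>x. if x \<in> \<Omega> then F x else 0"
  have "continuous_on \<Omega> ?G"
    using assms(2) by (simp cong: continuous_on_cong)
  moreover have "continuous_on (- K) ?G"
    using assms(5) by (subst continuous_on_cong[where g = "\<lambda>_. 0"]) auto
  ultimately have "continuous_on (\<Omega> \<union> - K) ?G"
    using assms(1,3) by (intro continuous_on_open_Un) (auto simp: compact_imp_closed open_Compl)
  moreover have "\<Omega> \<union> - K = UNIV"
    using assms(4) by auto
  ultimately show ?thesis by simp
qed

text \<open>Transfers integrals from \<open>lebesgue_on \<Omega>\<close>, in which the eigensystem
  is stated, to \<open>lborel\<close>, where translation invariance is at hand.\<close>

lemma integrable_compact_support:
  fixes F :: "real ^ 'n::finite \<Rightarrow> real"
  assumes "open \<Omega>" "continuous_on \<Omega> F" "compact K" "K \<subseteq> \<Omega>" "\<And>x. x \<in> \<Omega> - K \<Longrightarrow> F x = 0"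
  shows "integrable (lebesgue_on \<Omega>) F"
    and "(\<integral>x. F x \<partial>lebesgue_on \<Omega>) = (\<integral>x. (if x \<in> \<Omega> then F x else 0) \<partial>lborel)"
proof -
  let ?G = "\<lambda>x. if x \<in> \<Omega> then F x else 0"
  have G: "continuous_on UNIV ?G"
    by (rule continuous_on_extend_zero) (use assms in auto)
  have "integrable lborel (\<lambda>x. indicator K x *\<^sub>R ?G x)"
    by (rule borel_integrable_compact) (use G assms in \<open>auto intro: continuous_on_subset\<close>)
  moreover have "(\<lambda>x. indicator K x *\<^sub>R ?G x) = ?G"
    using assms(4,5) by (auto simp: fun_eq_iff indicator_def)
  ultimately have i: "integrable lborel ?G" by simp
  then have l: "integrable lebesgue ?G" "integral\<^sup>L lebesgue ?G = integral\<^sup>L lborel ?G"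
    by (auto simp: integrable_completion integral_completion borel_measurable_integrable)
  have ms: "\<Omega> \<inter> space lebesgue \<in> sets lebesgue"
    using assms(1) by (simp add: borel_open)
  have eq: "(\<lambda>x. indicator \<Omega> x *\<^sub>R F x) = ?G"
    by (auto simp: fun_eq_iff indicator_def)
  show "integrable (lebesgue_on \<Omega>) F"
    using l by (subst integrable_restrict_space[OF ms]) (simp only: eq)
  show "(\<integral>x. F x \<partial>lebesgue_on \<Omega>) = (\<integral>x. ?G x \<partial>lborel)"
    using l by (subst integral_restrict_space[OF ms]) (simp only: eq)
qed

lemma has_partial_deriv_zero_outside:
  assumes "open \<Omega>" "compact K" "\<And>x. x \<in> \<Omega> - K \<Longrightarrow> F x = 0" "x \<in> \<Omega> - K"
    "has_partial_deriv i F D x"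
  shows "D = 0"
proof -
  have "open (\<Omega> - K)"
    using assms by (simp add: compact_imp_closed open_Diff)
  then have "has_partial_deriv i (\<lambda>_. 0) D x"
    using has_partial_deriv_cong[OF assms(5), of "\<Omega> - K"] assms(3,4) by auto
  then show ?thesis
    using has_partial_deriv_unique has_partial_deriv_const by blast
qed

lemma integral_partial_deriv:
  fixes F F' :: "real ^ 'n::finite \<Rightarrow> real"
  assumes "open \<Omega>" "continuous_on \<Omega> F" "continuous_on \<Omega> F'" "compact K" "K \<subseteq> \<Omega>"
    and F0: "\<And>x. x \<in> \<Omega> - K \<Longrightarrow> F x = 0"
    and D: "\<And>x. x \<in> \<Omega> \<Longrightarrow> has_partial_deriv i F (F' x) x"
  shows "integrable (lebesgue_on \<Omega>) F'" and "(\<integral>x. F' x \<partial>lebesgue_on \<Omega>) = 0"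
proof -
  have F'0: "F' x = 0" if "x \<in> \<Omega> - K" for x
    using has_partial_deriv_zero_outside[OF assms(1,4), of F x i "F' x"] F0 D that by blast
  let ?G = "\<lambda>x. if x \<in> \<Omega> then F x else 0" and ?G' = "\<lambda>x. if x \<in> \<Omega> then F' x else 0"
  show "integrable (lebesgue_on \<Omega>) F'"
    by (rule integrable_compact_support) (use assms F'0 in auto)
  have "(\<integral>x. F' x \<partial>lebesgue_on \<Omega>) = (\<integral>x. ?G' x \<partial>lborel)"
    by (rule integrable_compact_support) (use assms F'0 in auto)
  also have "\<dots> = 0"
  proof (rule integral_partial_deriv_lborel)
    show "continuous_on UNIV ?G"
      by (rule continuous_on_extend_zero[OF assms(1,2,4,5) F0])
    show "continuous_on UNIV ?G'"
      by (rule continuous_on_extend_zero[OF assms(1,3,4,5) F'0])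
    show "has_partial_deriv i ?G (?G' x) x" for x
    proof (cases "x \<in> \<Omega>")
      case True
      then show ?thesis
        using has_partial_deriv_cong[OF D[OF True] assms(1) True] by simp
    next
      case False
      have "has_partial_deriv i ?G 0 x"
        by (rule has_partial_deriv_cong[OF has_partial_deriv_const[of i 0], where S = "- K"])
          (use False assms(4,5) F0 in \<open>auto simp: compact_imp_closed open_Compl\<close>)
      then show ?thesis using False by simp
    qed
  qed (use assms F0 F'0 in auto)
  finally show "(\<integral>x. F' x \<partial>lebesgue_on \<Omega>) = 0" .
qed

section \<open>Second-order data and Green's identity\<close>

text \<open>\<open>G i\<close> and \<open>H i\<close> are \<open>\<partial>\<^sub>i u\<close> and \<open>\<partial>\<^sub>i \<partial>\<^sub>i u\<close>. Mixed second derivatives play no role, so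
  differentiability is only required along the coordinate axes.\<close>

definition C2_data ::
  "(real ^ 'n::finite) set \<Rightarrow> (real ^ 'n \<Rightarrow> real) \<Rightarrow> ('n \<Rightarrow> real ^ 'n \<Rightarrow> real) \<Rightarrow>
     ('n \<Rightarrow> real ^ 'n \<Rightarrow> real) \<Rightarrow> bool" where
  "C2_data \<Omega> u G H \<longleftrightarrow> continuous_on \<Omega> u \<and>
     (\<forall>i. continuous_on \<Omega> (G i) \<and> continuous_on \<Omega> (H i) \<and>
        (\<forall>x\<in>\<Omega>. has_partial_deriv i u (G i x) x \<and> has_partial_deriv i (G i) (H i x) x))"

lemma C2_dataD:
  assumes "C2_data \<Omega> u G H"
  shows "continuous_on \<Omega> u" "continuous_on \<Omega> (G i)" "continuous_on \<Omega> (H i)"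
    and "x \<in> \<Omega> \<Longrightarrow> has_partial_deriv i u (G i x) x"
    and "x \<in> \<Omega> \<Longrightarrow> has_partial_deriv i (G i) (H i x) x"
  using assms by (auto simp: C2_data_def)

lemma C2_data_Ck_on:
  assumes "Ck_on 2 u \<Omega>"
  shows "C2_data \<Omega> u (\<lambda>i. partial_deriv i u) (\<lambda>i. partial_deriv i (partial_deriv i u))"
  using assms
  by (auto simp: C2_data_def numeral_2_eq_2 has_partial_deriv_differentiable
      intro!: continuous_at_imp_continuous_on differentiable_imp_continuous_within)

lemma C2_data_const: "C2_data \<Omega> (\<lambda>_. c) (\<lambda>_ _. 0) (\<lambda>_ _. 0)"
  by (simp add: C2_data_def has_partial_deriv_const)

lemma C2_data_add:
  "C2_data \<Omega> u G H \<Longrightarrow> C2_data \<Omega> v G' H' \<Longrightarrow>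
   C2_data \<Omega> (\<lambda>x. u x + v x) (\<lambda>i x. G i x + G' i x) (\<lambda>i x. H i x + H' i x)"
  by (auto simp: C2_data_def has_partial_deriv_add intro!: continuous_intros)

lemma C2_data_diff:
  "C2_data \<Omega> u G H \<Longrightarrow> C2_data \<Omega> v G' H' \<Longrightarrow>
   C2_data \<Omega> (\<lambda>x. u x - v x) (\<lambda>i x. G i x - G' i x) (\<lambda>i x. H i x - H' i x)"
  by (auto simp: C2_data_def has_partial_deriv_diff intro!: continuous_intros)

lemma C2_data_cmult:
  "C2_data \<Omega> u G H \<Longrightarrow> C2_data \<Omega> (\<lambda>x. c * u x) (\<lambda>i x. c * G i x) (\<lambda>i x. c * H i x)"
  by (auto simp: C2_data_def has_partial_deriv_cmult intro!: continuous_intros)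

lemma C2_data_sum:
  "(\<And>k. C2_data \<Omega> (u k) (G k) (H k)) \<Longrightarrow>
   C2_data \<Omega> (\<lambda>x. \<Sum>k<N::nat. u k x) (\<lambda>i x. \<Sum>k<N. G k i x) (\<lambda>i x. \<Sum>k<N. H k i x)"
proof (induction N)
  case 0
  then show ?case by (simp add: C2_data_const)
next
  case (Suc N)
  then show ?case by (simp add: C2_data_add)
qed

lemma C2_data_compose:
  assumes u: "C2_data \<Omega> u G H"
    and p: "\<And>t. (p has_real_derivative p' t) (at t)" "\<And>t. (p' has_real_derivative p'' t) (at t)"
      "continuous_on UNIV p''"
  shows "C2_data \<Omega> (\<lambda>x. p (u x)) (\<lambda>i x. p' (u x) * G i x)
           (\<lambda>i x. p'' (u x) * (G i x)\<^sup>2 + p' (u x) * H i x)"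
proof -
  have "continuous_on UNIV p" "continuous_on UNIV p'"
    using p by (meson DERIV_atLeastAtMost_imp_continuous_on DERIV_continuous_on has_field_derivative_at_within)+
  then have c: "continuous_on \<Omega> (\<lambda>x. p (u x))" "continuous_on \<Omega> (\<lambda>x. p' (u x))" "continuous_on \<Omega> (\<lambda>x. p'' (u x))"
    using p(3) C2_dataD(1)[OF u] by (auto intro: continuous_on_compose2)
  have "has_partial_deriv i (\<lambda>x. p' (u x) * G i x) (p'' (u x) * (G i x)\<^sup>2 + p' (u x) * H i x) x"
    if "x \<in> \<Omega>" for i x
    using has_partial_deriv_mult[OF has_partial_deriv_compose[OF p(2)[of "u x"] C2_dataD(4)[OF u that]] C2_dataD(5)[OF u that]]
    by (simp add: power2_eq_square algebra_simps)
  moreover have "has_partial_deriv i (\<lambda>x. p (u x)) (p' (u x) * G i x) x" if "x \<in> \<Omega>" for i x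
    by (rule has_partial_deriv_compose[OF p(1) C2_dataD(4)[OF u that]])
  ultimately show ?thesis
    using c C2_dataD[OF u] unfolding C2_data_def by (auto intro!: continuous_intros)
qed

text \<open>The field with components \<open>u * G' i - b * G i\<close> has divergence
  \<open>u \<Delta> b - b \<Delta> u\<close> and compact support, so the divergence integrates to
  zero. The support condition falls on \<open>b\<close> alone, which leaves \<open>u\<close> free to
  be an eigenfunction or the solution.\<close>

lemma green_identity:
  assumes "open \<Omega>" and u: "C2_data \<Omega> u G H" and b: "C2_data \<Omega> b G' H'"
    and K: "compact K" "K \<subseteq> \<Omega>" "\<And>x. x \<in> \<Omega> - K \<Longrightarrow> b x = 0"
  shows "(\<integral>x. u x * (\<Sum>i\<in>UNIV. H' i x) \<partial>lebesgue_on \<Omega>) =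
         (\<integral>x. b x * (\<Sum>i\<in>UNIV. H i x) \<partial>lebesgue_on \<Omega>)"
proof -
  have G'0: "G' i x = 0" if "x \<in> \<Omega> - K" for i x
    by (rule has_partial_deriv_zero_outside[OF assms(1) K(1), of b])
      (use K C2_dataD(4)[OF b] that in auto)
  have H'0: "H' i x = 0" if "x \<in> \<Omega> - K" for i x
    by (rule has_partial_deriv_zero_outside[OF assms(1) K(1), of "G' i"])
      (use G'0 C2_dataD(5)[OF b] that in auto)
  let ?F = "\<lambda>i x. u x * G' i x - b x * G i x"
  let ?F' = "\<lambda>i x. u x * H' i x - b x * H i x"
  have F: "(\<integral>x. ?F' i x \<partial>lebesgue_on \<Omega>) = 0" "integrable (lebesgue_on \<Omega>) (?F' i)" for i
  proof -
    have D: "has_partial_deriv i (?F i) (?F' i x) x" if "x \<in> \<Omega>" for x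
      using has_partial_deriv_diff[OF has_partial_deriv_mult[OF C2_dataD(4)[OF u that] C2_dataD(5)[OF b that]]
          has_partial_deriv_mult[OF C2_dataD(4)[OF b that] C2_dataD(5)[OF u that]], of i]
      by (simp add: algebra_simps)
    have c: "continuous_on \<Omega> (?F i)" "continuous_on \<Omega> (?F' i)"
      by (intro continuous_intros C2_dataD[OF u] C2_dataD[OF b])+
    show "(\<integral>x. ?F' i x \<partial>lebesgue_on \<Omega>) = 0" "integrable (lebesgue_on \<Omega>) (?F' i)"
      using integral_partial_deriv[OF assms(1) c K(1,2) _ D] G'0 K(3) by simp_all
  qed
  have i: "integrable (lebesgue_on \<Omega>) (\<lambda>x. u x * (\<Sum>i\<in>UNIV. H' i x))"
    by (rule integrable_compact_support[OF assms(1) _ K(1,2)])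
      (use H'0 in \<open>auto intro!: continuous_intros C2_dataD[OF u] C2_dataD[OF b]\<close>)
  have j: "integrable (lebesgue_on \<Omega>) (\<lambda>x. b x * (\<Sum>i\<in>UNIV. H i x))"
    by (rule integrable_compact_support[OF assms(1) _ K(1,2)])
      (use K in \<open>auto intro!: continuous_intros C2_dataD[OF u] C2_dataD[OF b]\<close>)
  have "(\<integral>x. u x * (\<Sum>i\<in>UNIV. H' i x) - b x * (\<Sum>i\<in>UNIV. H i x) \<partial>lebesgue_on \<Omega>) =
     (\<integral>x. (\<Sum>i\<in>UNIV. ?F' i x) \<partial>lebesgue_on \<Omega>)"
    by (simp add: sum_distrib_left sum_subtractf)
  also have "\<dots> = 0"
    using F by (subst Bochner_Integration.integral_sum) auto
  finally show ?thesis
    using i j by simp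
qed

section \<open>Convex C2 smoothing of the positive part\<close>

lemma DERIV_glue_zero:
  fixes g :: "real \<Rightarrow> real"
  assumes D: "\<And>r. 0 \<le> r \<Longrightarrow> (g has_real_derivative g' r) (at r)" and "g 0 = 0" "g' 0 = 0"
  shows "((\<lambda>r. if r \<le> 0 then 0 else g r) has_real_derivative (if r \<le> 0 then 0 else g' r)) (at r)"
proof -
  let ?h = "\<lambda>r. if r \<le> 0 then 0 else g r"
  consider "r < 0" | "r > 0" | "r = 0" by linarith
  then show ?thesis
  proof cases
    case 1
    then have "((\<lambda>_. 0) has_real_derivative 0) (at r)" by simp
    then have "(?h has_real_derivative 0) (at r)"
      by (rule has_field_derivative_transform_within_open[where S = "{..<0}"]) (use 1 in auto)
    then show ?thesis using 1 by simp
  next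
    case 2
    then have "(g has_real_derivative g' r) (at r)" using D by simp
    then have "(?h has_real_derivative g' r) (at r)"
      by (rule has_field_derivative_transform_within_open[where S = "{0<..}"]) (use 2 in auto)
    then show ?thesis using 2 by simp
  next
    case 3
    \<comment> \<open>At the seam the quotient of the glued function is dominated by that of
      \<open>g\<close>, which tends to \<open>g' 0 = 0\<close>.\<close>
    have "((\<lambda>t. g t / t) \<longlongrightarrow> 0) (at 0)"
      using D[of 0] assms(2,3) by (simp add: DERIV_def)
    then have "((\<lambda>t. ?h t / t) \<longlongrightarrow> 0) (at 0)"
      by (rule Lim_null_comparison[rotated, OF tendsto_norm_zero])
        (auto intro!: always_eventually divide_nonneg_nonpos)
    then show ?thesis using 3 by (simp add: DERIV_def cong: if_cong)
  qed
qed

lemma continuous_on_glue_zero: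
  fixes g :: "real \<Rightarrow> real"
  assumes "continuous_on {0..} g" "g 0 = 0"
  shows "continuous_on UNIV (\<lambda>r. if r \<le> 0 then 0 else g r)"
proof -
  have "continuous_on ({..0} \<union> {0..}) (\<lambda>r. if r \<le> 0 then 0 else g r)"
    by (rule continuous_on_cases) (use assms in auto)
  moreover have "{..0} \<union> {0..} = (UNIV :: real set)" by auto
  ultimately show ?thesis by simp
qed

text \<open>A \<open>C\<^sup>2\<close> convex approximation of the positive part from below, within \<open>2 \<epsilon>\<close>.\<close>

definition ramp :: "real \<Rightarrow> real \<Rightarrow> real" where
  "ramp \<epsilon> r = (if r \<le> 0 then 0 else r ^ 3 / (r + \<epsilon>)\<^sup>2)"

text \<open>The numerator of \<open>ramp\<close> vanishes to third order at 0, so gluing with the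
  zero function keeps two continuous derivatives; dividing by a square leaves linear growth.\<close>

definition ramp' :: "real \<Rightarrow> real \<Rightarrow> real" where
  "ramp' \<epsilon> r = (if r \<le> 0 then 0 else r\<^sup>2 * (r + 3 * \<epsilon>) / (r + \<epsilon>) ^ 3)"

definition ramp'' :: "real \<Rightarrow> real \<Rightarrow> real" where
  "ramp'' \<epsilon> r = (if r \<le> 0 then 0 else 6 * r * \<epsilon>\<^sup>2 / (r + \<epsilon>) ^ 4)"

lemma ramp_deriv:
  assumes "\<epsilon> > 0"
  shows "(ramp \<epsilon> has_real_derivative ramp' \<epsilon> r) (at r)"
  unfolding ramp_def ramp'_def
proof (rule DERIV_glue_zero)
  fix r :: real assume "0 \<le> r"
  then have "r + \<epsilon> \<noteq> 0" using assms by auto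
  then have "((\<lambda>r. r ^ 3 / (r + \<epsilon>)\<^sup>2) has_real_derivative
      (3 * r\<^sup>2 * (r + \<epsilon>)\<^sup>2 - r ^ 3 * (2 * (r + \<epsilon>))) / ((r + \<epsilon>)\<^sup>2 * (r + \<epsilon>)\<^sup>2)) (at r)"
    by (auto intro!: derivative_eq_intros)
  moreover have "(3 * r\<^sup>2 * (r + \<epsilon>)\<^sup>2 - r ^ 3 * (2 * (r + \<epsilon>))) / ((r + \<epsilon>)\<^sup>2 * (r + \<epsilon>)\<^sup>2) =
     r\<^sup>2 * (r + 3 * \<epsilon>) / (r + \<epsilon>) ^ 3"
    using \<open>r + \<epsilon> \<noteq> 0\<close> by (simp add: divide_simps) algebra
  ultimately show "((\<lambda>r. r ^ 3 / (r + \<epsilon>)\<^sup>2) has_real_derivative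
      r\<^sup>2 * (r + 3 * \<epsilon>) / (r + \<epsilon>) ^ 3) (at r)"
    by simp
qed auto

lemma ramp'_deriv:
  assumes "\<epsilon> > 0"
  shows "(ramp' \<epsilon> has_real_derivative ramp'' \<epsilon> r) (at r)"
  unfolding ramp'_def ramp''_def
proof (rule DERIV_glue_zero)
  fix r :: real assume "0 \<le> r"
  then have "r + \<epsilon> \<noteq> 0" using assms by auto
  then have "((\<lambda>r. r\<^sup>2 * (r + 3 * \<epsilon>) / (r + \<epsilon>) ^ 3) has_real_derivative
      ((2 * r * (r + 3 * \<epsilon>) + r\<^sup>2) * (r + \<epsilon>) ^ 3 - r\<^sup>2 * (r + 3 * \<epsilon>) * (3 * (r + \<epsilon>)\<^sup>2)) /
      ((r + \<epsilon>) ^ 3 * (r + \<epsilon>) ^ 3)) (at r)"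
    by (auto intro!: derivative_eq_intros)
  moreover have "((2 * r * (r + 3 * \<epsilon>) + r\<^sup>2) * (r + \<epsilon>) ^ 3 - r\<^sup>2 * (r + 3 * \<epsilon>) * (3 * (r + \<epsilon>)\<^sup>2)) /
      ((r + \<epsilon>) ^ 3 * (r + \<epsilon>) ^ 3) = 6 * r * \<epsilon>\<^sup>2 / (r + \<epsilon>) ^ 4"
    using \<open>r + \<epsilon> \<noteq> 0\<close> by (simp add: divide_simps) algebra
  ultimately show "((\<lambda>r. r\<^sup>2 * (r + 3 * \<epsilon>) / (r + \<epsilon>) ^ 3) has_real_derivative
      6 * r * \<epsilon>\<^sup>2 / (r + \<epsilon>) ^ 4) (at r)"
    by simp
qed auto

lemma continuous_on_ramp': "\<epsilon> > 0 \<Longrightarrow> continuous_on UNIV (ramp' \<epsilon>)"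
  by (rule DERIV_continuous_on) (rule has_field_derivative_at_within[OF ramp'_deriv])

lemma continuous_on_ramp'': "\<epsilon> > 0 \<Longrightarrow> continuous_on UNIV (ramp'' \<epsilon>)"
  unfolding ramp''_def by (rule continuous_on_glue_zero) (auto intro!: continuous_intros)

lemma ramp_nonneg: "\<epsilon> > 0 \<Longrightarrow> 0 \<le> ramp \<epsilon> r"
  and ramp'_nonneg: "\<epsilon> > 0 \<Longrightarrow> 0 \<le> ramp' \<epsilon> r"
  and ramp''_nonneg: "\<epsilon> > 0 \<Longrightarrow> 0 \<le> ramp'' \<epsilon> r"
  by (auto simp: ramp_def ramp'_def ramp''_def)

lemma ramp'_le_1:
  assumes "\<epsilon> > 0"
  shows "ramp' \<epsilon> r \<le> 1"
proof (cases "r \<le> 0")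
  case False
  have "(r + \<epsilon>) ^ 3 = r\<^sup>2 * (r + 3 * \<epsilon>) + \<epsilon>\<^sup>2 * (3 * r + \<epsilon>)"
    by algebra
  then have "r\<^sup>2 * (r + 3 * \<epsilon>) \<le> (r + \<epsilon>) ^ 3"
    using False assms by simp
  then show ?thesis
    using False assms by (simp add: ramp'_def)
qed (simp add: ramp'_def)

lemma ramp_le:
  assumes "\<epsilon> > 0"
  shows "ramp \<epsilon> r \<le> max r 0"
proof (cases "r \<le> 0")
  case False
  have "r * (r + \<epsilon>)\<^sup>2 = r ^ 3 + r * \<epsilon> * (2 * r + \<epsilon>)"
    by algebra
  then show ?thesis
    using False assms by (simp add: ramp_def divide_simps)
qed (simp add: ramp_def)

text \<open>The gap \<open>r - ramp \<epsilon> r\<close> increases to \<open>2 * \<epsilon>\<close>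
  as \<open>r\<close> tends to infinity, which is the origin of the constant.\<close>

lemma ramp_ge:
  assumes "\<epsilon> > 0"
  shows "max r 0 - 2 * \<epsilon> \<le> ramp \<epsilon> r"
proof (cases "r \<le> 0")
  case False
  have "(r - 2 * \<epsilon>) * (r + \<epsilon>)\<^sup>2 = r ^ 3 - \<epsilon>\<^sup>2 * (3 * r + 2 * \<epsilon>)"
    by algebra
  then show ?thesis
    using False assms by (simp add: ramp_def divide_simps)
qed (use assms in \<open>simp add: ramp_def\<close>)

subsection \<open>Square integrable functions\<close>

lemma L2_on_mult_integrable:
  assumes "f \<in> L2_on \<Omega>" "g \<in> L2_on \<Omega>"
  shows "integrable (lebesgue_on \<Omega>) (\<lambda>x. f x * g x)"
proof (rule Bochner_Integration.integrable_bound)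
  show "integrable (lebesgue_on \<Omega>) (\<lambda>x. (f x)\<^sup>2 + (g x)\<^sup>2)"
    using assms by (simp add: L2_on_def)
  have "\<bar>a * b\<bar> \<le> a\<^sup>2 + b\<^sup>2" for a b :: real
    using sum_squares_bound[of "\<bar>a\<bar>" "\<bar>b\<bar>"] mult_nonneg_nonneg[of "\<bar>a\<bar>" "\<bar>b\<bar>"]
    unfolding abs_mult power2_abs by linarith
  then show "AE x in lebesgue_on \<Omega>. norm (f x * g x) \<le> norm ((f x)\<^sup>2 + (g x)\<^sup>2)"
    by (auto intro!: AE_I2)
qed (use assms in \<open>auto simp: L2_on_def\<close>)

lemma L2_on_cmult: "f \<in> L2_on \<Omega> \<Longrightarrow> (\<lambda>x. c * f x) \<in> L2_on \<Omega>"
  by (auto simp: L2_on_def power_mult_distrib)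

lemma L2_on_add:
  assumes "f \<in> L2_on \<Omega>" "g \<in> L2_on \<Omega>"
  shows "(\<lambda>x. f x + g x) \<in> L2_on \<Omega>"
  using assms L2_on_mult_integrable[OF assms]
  by (auto simp: L2_on_def power2_sum mult.assoc)

lemma L2_on_diff:
  assumes "f \<in> L2_on \<Omega>" "g \<in> L2_on \<Omega>"
  shows "(\<lambda>x. f x - g x) \<in> L2_on \<Omega>"
  using L2_on_add[OF assms(1) L2_on_cmult[OF assms(2), of "-1"]] by simp

lemma L2_on_sum:
  "(\<And>k. f k \<in> L2_on \<Omega>) \<Longrightarrow> (\<lambda>x. \<Sum>k<N::nat. f k x) \<in> L2_on \<Omega>"
proof (induction N)
  case 0
  then show ?case by (simp add: L2_on_def)
next
  case (Suc N)
  then show ?case by (simp add: L2_on_add)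
qed

lemma L2_on_bound:
  assumes "f \<in> L2_on \<Omega>" "g \<in> borel_measurable (lebesgue_on \<Omega>)"
    "\<And>x. x \<in> \<Omega> \<Longrightarrow> \<bar>g x\<bar> \<le> \<bar>f x\<bar>"
  shows "g \<in> L2_on \<Omega>"
proof -
  have "integrable (lebesgue_on \<Omega>) (\<lambda>x. (g x)\<^sup>2)"
  proof (rule Bochner_Integration.integrable_bound)
    show "integrable (lebesgue_on \<Omega>) (\<lambda>x. (f x)\<^sup>2)"
      using assms(1) by (simp add: L2_on_def)
    show "AE x in lebesgue_on \<Omega>. norm ((g x)\<^sup>2) \<le> norm ((f x)\<^sup>2)"
      using assms(3) by (auto intro!: AE_I2 simp: abs_le_square_iff)
  qed (use assms in auto)
  then show ?thesis using assms(2) by (simp add: L2_on_def)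
qed

lemma borel_measurable_open_continuous:
  fixes f :: "real ^ 'n::finite \<Rightarrow> real"
  shows "open \<Omega> \<Longrightarrow> continuous_on \<Omega> f \<Longrightarrow> f \<in> borel_measurable (lebesgue_on \<Omega>)"
  by (intro continuous_imp_measurable_on_sets_lebesgue) (auto simp: borel_open)

lemma L2_on_const:
  fixes \<Omega> :: "(real ^ 'n::finite) set"
  assumes "open \<Omega>" "bounded \<Omega>"
  shows "(\<lambda>_. c) \<in> L2_on \<Omega>"
proof -
  have "\<Omega> \<in> lmeasurable"
    using assms by (simp add: lmeasurable_open)
  then show ?thesis
    by (simp add: L2_on_def finite_measure.integrable_const
        finite_measure_lebesgue_on)
qed

lemma L2_on_bounded_continuous:
  fixes \<Omega> :: "(real ^ 'n::finite) set"
  assumes "open \<Omega>" "bounded \<Omega>" "continuous_on \<Omega> f" "\<And>x. x \<in> \<Omega> \<Longrightarrow> \<bar>f x\<bar> \<le> B"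
  shows "f \<in> L2_on \<Omega>"
  by (rule L2_on_bound[OF L2_on_const[OF assms(1,2), of B]])
    (use assms(4) in \<open>auto intro!: borel_measurable_open_continuous assms order.trans[OF assms(4)]\<close>)

lemma L2_on_compact_support:
  fixes \<Omega> :: "(real ^ 'n::finite) set"
  assumes "open \<Omega>" "bounded \<Omega>" "continuous_on \<Omega> f" "compact K" "K \<subseteq> \<Omega>"
    "\<And>x. x \<in> \<Omega> - K \<Longrightarrow> f x = 0"
  shows "f \<in> L2_on \<Omega>"
proof -
  have "bounded (f ` K)"
    using assms by (intro compact_imp_bounded compact_continuous_image) (auto intro: continuous_on_subset)
  then obtain B where "B > 0" and B: "\<And>x. x \<in> K \<Longrightarrow> \<bar>f x\<bar> \<le> B"
    unfolding bounded_pos by auto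
  have "\<bar>f x\<bar> \<le> B" if "x \<in> \<Omega>" for x
    using B[of x] assms(6)[of x] \<open>B > 0\<close> that by (cases "x \<in> K") auto
  then show ?thesis
    using L2_on_bounded_continuous[OF assms(1-3)] by blast
qed

lemma L2_on_continuous_closure:
  fixes \<Omega> :: "(real ^ 'n::finite) set"
  assumes "open \<Omega>" "bounded \<Omega>" "continuous_on (closure \<Omega>) f"
  shows "f \<in> L2_on \<Omega>"
proof -
  have "bounded (f ` closure \<Omega>)"
    using assms by (intro compact_imp_bounded compact_continuous_image) auto
  then obtain B where B: "\<And>x. x \<in> closure \<Omega> \<Longrightarrow> \<bar>f x\<bar> \<le> B"
    unfolding bounded_iff by auto
  show ?thesis
  proof (rule L2_on_bounded_continuous[OF assms(1,2)])
    show "continuous_on \<Omega> f"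
      using assms(3) closure_subset continuous_on_subset by blast
    show "\<bar>f x\<bar> \<le> B" if "x \<in> \<Omega>" for x
      using B[of x] that closure_subset[of \<Omega>] by blast
  qed
qed

subsection \<open>An L2 comparison principle\<close>

text \<open>Test the inequality with a smoothed negative part of \<open>v\<close>, which has compact support in \<open>\<Omega>\<close>.\<close>

lemma L2_comparison:
  assumes \<Omega>: "open \<Omega>" "bounded \<Omega>" and v: "C2_data \<Omega> v G H" "continuous_on (closure \<Omega>) v"
    and bdry: "\<And>x. x \<in> frontier \<Omega> \<Longrightarrow> 0 \<le> v x" and "\<tau> > 0" and e: "e \<in> L2_on \<Omega>"
    and ineq: "\<And>x. x \<in> \<Omega> \<Longrightarrow> - e x \<le> \<tau> * v x - (\<Sum>i\<in>UNIV. H i x)"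
  shows "\<tau>\<^sup>2 * (\<integral>x. (min (v x) 0)\<^sup>2 \<partial>lebesgue_on \<Omega>) \<le> (\<integral>x. (e x)\<^sup>2 \<partial>lebesgue_on \<Omega>)"
proof -
  let ?M = "lebesgue_on \<Omega>"
  have vL2: "v \<in> L2_on \<Omega>"
    by (rule L2_on_continuous_closure[OF \<Omega> v(2)])
  have main: "\<tau>\<^sup>2 * (\<integral>x. (ramp \<epsilon> (- v x - \<epsilon>))\<^sup>2 \<partial>?M) \<le> (\<integral>x. (e x)\<^sup>2 \<partial>?M)" if "\<epsilon> > 0" for \<epsilon>
  proof -
    \<comment> \<open>The shift by \<open>\<epsilon>\<close> keeps the support inside
      \<open>\<Omega>\<close>: \<open>\<eta>\<close> lives where
      \<open>v \<le> - \<epsilon>\<close>, a compact set that cannot meet the frontier, where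
      \<open>0 \<le> v\<close>.\<close>
    define \<eta> where "\<eta> x = ramp \<epsilon> (- v x - \<epsilon>)" for x
    define \<zeta> where "\<zeta> x = ramp' \<epsilon> (- v x - \<epsilon>)" for x
    define K where "K = closure \<Omega> \<inter> v -` {..- \<epsilon>}"
    have K: "compact K"
      unfolding K_def compact_eq_bounded_closed
      using \<Omega>(2) continuous_closed_preimage[OF v(2) closed_closure closed_atMost]
      by (auto intro: bounded_subset[of "closure \<Omega>"])
    have K': "K \<subseteq> \<Omega>"
    proof
      fix x assume "x \<in> K"
      then have "x \<in> closure \<Omega>" "\<not> 0 \<le> v x" using that by (auto simp: K_def)
      then show "x \<in> \<Omega>"
        using bdry[of x] \<Omega>(1) by (auto simp: frontier_def interior_open)
    qed
    have K0: "\<eta> x = 0" "\<zeta> x = 0" if "x \<in> \<Omega> - K" for x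
      using that closure_subset by (auto simp: \<eta>_def \<zeta>_def ramp_def ramp'_def K_def)
    have m: "C2_data \<Omega> (\<lambda>x. - v x - \<epsilon>) (\<lambda>i x. - G i x) (\<lambda>i x. - H i x)"
      using C2_data_diff[OF C2_data_cmult[OF v(1), of "-1"] C2_data_const[of _ \<epsilon>]] by simp
    note \<eta>2 = C2_data_compose[OF m ramp_deriv[OF that] ramp'_deriv[OF that] continuous_on_ramp''[OF that], folded \<eta>_def \<zeta>_def]
    have c: "continuous_on \<Omega> \<eta>"
      using C2_dataD(1)[OF \<eta>2] .
    have c': "continuous_on \<Omega> \<zeta>"
      unfolding \<zeta>_def
      by (rule continuous_on_compose2[OF continuous_on_ramp'[OF that] C2_dataD(1)[OF m]]) simp
    \<comment> \<open>This is the \<open>i\<close>-th derivative of \<open>\<eta> * G i\<close>,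
      because that of \<open>\<eta>\<close> is \<open>- \<zeta> * G i\<close>. Its integral
      vanishes, so pairing \<open>\<eta>\<close> with \<open>H i\<close> gives the nonnegative
      energy of \<open>\<zeta> * (G i)\<^sup>2\<close>.\<close>
    let ?F' = "\<lambda>i x. \<eta> x * H i x - \<zeta> x * (G i x)\<^sup>2"
    have D: "has_partial_deriv i (\<lambda>x. \<eta> x * G i x) (?F' i x) x" if "x \<in> \<Omega>" for i x
      using has_partial_deriv_mult[OF C2_dataD(4)[OF \<eta>2 that] C2_dataD(5)[OF v(1) that], of i]
      by (simp add: power2_eq_square algebra_simps)
    have cF: "continuous_on \<Omega> (\<lambda>x. \<eta> x * G i x)" for i
      by (intro continuous_intros c C2_dataD[OF v(1)])
    have F': "integrable ?M (?F' i)" "(\<integral>x. ?F' i x \<partial>?M) = 0" for i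
      by (rule integral_partial_deriv[OF \<Omega>(1) cF _ K K' _ D],
          intro continuous_intros c c' C2_dataD[OF v(1)], simp add: K0, assumption)+
    have i1: "integrable ?M (\<lambda>x. \<eta> x * H i x)" "integrable ?M (\<lambda>x. \<zeta> x * (G i x)\<^sup>2)" for i
      by (rule integrable_compact_support[OF \<Omega>(1) _ K K'],
          intro continuous_intros c c' C2_dataD[OF v(1)], simp add: K0)+
    have "(\<integral>x. \<eta> x * H i x \<partial>?M) = (\<integral>x. \<zeta> x * (G i x)\<^sup>2 \<partial>?M)" for i
      using F'(2)[of i] i1[of i] by simp
    moreover have "0 \<le> (\<integral>x. \<zeta> x * (G i x)\<^sup>2 \<partial>?M)" for i
      by (rule Bochner_Integration.integral_nonneg) (simp add: \<zeta>_def ramp'_nonneg[OF that])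
    ultimately have pos: "0 \<le> (\<integral>x. (\<Sum>i\<in>UNIV. \<eta> x * H i x) \<partial>?M)"
      using i1 by (subst Bochner_Integration.integral_sum) (auto intro!: sum_nonneg)
    have \<eta>L2: "\<eta> \<in> L2_on \<Omega>"
      by (rule L2_on_compact_support[OF \<Omega> c K K']) (use K0 in auto)
    have iS: "integrable ?M (\<lambda>x. \<Sum>i\<in>UNIV. \<eta> x * H i x)"
      using i1 by auto
    have sq: "integrable ?M (\<lambda>x. (\<eta> x)\<^sup>2)" "integrable ?M (\<lambda>x. (e x)\<^sup>2)"
      using \<eta>L2 e by (auto simp: L2_on_def)
    \<comment> \<open>The differential inequality is multiplied by \<open>\<eta>\<close>, using
      \<open>\<eta> \<le> - v\<close> where \<open>\<eta> > 0\<close>. Young's inequality splits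
      \<open>\<eta> * e\<close> so that half of \<open>\<tau> * \<eta>\<^sup>2\<close> can be
      absorbed on the left after integration.\<close>
    have pw: "\<tau> * (\<eta> x)\<^sup>2 \<le> (\<tau> * (\<eta> x)\<^sup>2 + (e x)\<^sup>2 / \<tau>) / 2 - (\<Sum>i\<in>UNIV. \<eta> x * H i x)" if x: "x \<in> \<Omega>" for x
    proof -
      have \<eta>0: "0 \<le> \<eta> x"
        by (simp add: \<eta>_def ramp_nonneg[OF \<open>\<epsilon> > 0\<close>])
      have "\<eta> x * \<eta> x \<le> \<eta> x * (- v x)"
      proof (cases "\<eta> x = 0")
        case False
        then have "- v x - \<epsilon> > 0" by (auto simp: \<eta>_def ramp_def split: if_splits)
        then have "\<eta> x \<le> - v x"
          using ramp_le[OF \<open>\<epsilon> > 0\<close>, of "- v x - \<epsilon>"] \<open>\<epsilon> > 0\<close> by (simp add: \<eta>_def)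
        then show ?thesis using \<eta>0 by (rule mult_left_mono)
      qed simp
      then have "\<tau> * (\<eta> x)\<^sup>2 \<le> \<tau> * (\<eta> x * (- v x))"
        unfolding power2_eq_square by (rule mult_left_mono) (use \<open>\<tau> > 0\<close> in simp)
      also have "\<dots> = \<eta> x * (- (\<tau> * v x - (\<Sum>i\<in>UNIV. H i x))) - \<eta> x * (\<Sum>i\<in>UNIV. H i x)"
        by (simp add: algebra_simps)
      also have "\<dots> \<le> \<eta> x * e x - \<eta> x * (\<Sum>i\<in>UNIV. H i x)"
        using ineq[OF x] \<eta>0 by (intro diff_right_mono mult_left_mono) auto
      also have "\<eta> x * e x \<le> (\<tau> * (\<eta> x)\<^sup>2 + (e x)\<^sup>2 / \<tau>) / 2"
      proof -
        have "0 \<le> (\<tau> * \<eta> x - e x)\<^sup>2 / \<tau>" using \<open>\<tau> > 0\<close> by simp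
        also have "\<dots> = \<tau> * (\<eta> x)\<^sup>2 + (e x)\<^sup>2 / \<tau> - 2 * (\<eta> x * e x)"
          using \<open>\<tau> > 0\<close> by (simp add: field_simps power2_eq_square)
        finally show ?thesis by simp
      qed
      finally show ?thesis by (simp add: sum_distrib_left)
    qed
    have arith: "a \<le> b" if "a \<le> (a + b) / 2 - c" "0 \<le> c" for a b c :: real
      using that by (simp add: field_simps)
    have "(\<integral>x. \<tau> * (\<eta> x)\<^sup>2 \<partial>?M) \<le>
        (\<integral>x. (\<tau> * (\<eta> x)\<^sup>2 + (e x)\<^sup>2 / \<tau>) / 2 - (\<Sum>i\<in>UNIV. \<eta> x * H i x) \<partial>?M)"
      by (rule Bochner_Integration.integral_mono) (use sq iS pw in auto)
    also have "\<dots> = (\<tau> * (\<integral>x. (\<eta> x)\<^sup>2 \<partial>?M) + (\<integral>x. (e x)\<^sup>2 \<partial>?M) / \<tau>) / 2 - (\<integral>x. (\<Sum>i\<in>UNIV. \<eta> x * H i x) \<partial>?M)"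
      using sq iS by simp
    finally have "\<tau> * (\<integral>x. (\<eta> x)\<^sup>2 \<partial>?M) \<le> (\<integral>x. (e x)\<^sup>2 \<partial>?M) / \<tau>"
      using pos arith[of "\<tau> * (\<integral>x. (\<eta> x)\<^sup>2 \<partial>?M)"] by simp
    then show ?thesis
      using \<open>\<tau> > 0\<close> by (simp add: \<eta>_def field_simps power2_eq_square)
  qed
  define h where "h n = inverse (real (Suc n))" for n
  have h: "h n > 0" for n by (simp add: h_def)
  have h0: "h \<longlonglongrightarrow> 0"
    unfolding h_def by (rule LIMSEQ_inverse_real_of_nat)
  have lim: "(\<lambda>n. (ramp (h n) (- v x - h n))\<^sup>2) \<longlonglongrightarrow> (min (v x) 0)\<^sup>2" for x
  proof -
    \<comment> \<open>The lower bound loses \<open>3 * h n\<close>: one \<open>h n\<close> for the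
      shift and two for the gap of the ramp.\<close>
    have "(\<lambda>n. ramp (h n) (- v x - h n)) \<longlonglongrightarrow> max (- v x) 0"
    proof (rule real_tendsto_sandwich)
      show "\<forall>\<^sub>F n in sequentially. max (- v x) 0 - 3 * h n \<le> ramp (h n) (- v x - h n)"
        by (rule always_eventually) (use ramp_ge[OF h] h in \<open>smt (verit)\<close>)
      show "\<forall>\<^sub>F n in sequentially. ramp (h n) (- v x - h n) \<le> max (- v x) 0"
        by (rule always_eventually) (use ramp_le[OF h] h in \<open>smt (verit)\<close>)
      show "(\<lambda>n. max (- v x) 0 - 3 * h n) \<longlonglongrightarrow> max (- v x) 0"
        using tendsto_diff[OF tendsto_const tendsto_mult_left[OF h0, of 3]] by simp
    qed auto
    then have "(\<lambda>n. (ramp (h n) (- v x - h n))\<^sup>2) \<longlonglongrightarrow> (max (- v x) 0)\<^sup>2"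
      by (rule tendsto_power)
    moreover have "(max (- v x) 0)\<^sup>2 = (min (v x) 0)\<^sup>2"
      by (simp add: max_def min_def)
    ultimately show ?thesis by simp
  qed
  have "(\<lambda>n. \<integral>x. (ramp (h n) (- v x - h n))\<^sup>2 \<partial>?M) \<longlonglongrightarrow> (\<integral>x. (min (v x) 0)\<^sup>2 \<partial>?M)"
  proof (rule integral_dominated_convergence[where w = "\<lambda>x. (v x)\<^sup>2"])
    have [measurable]: "v \<in> borel_measurable ?M" using vL2 by (simp add: L2_on_def)
    show "integrable ?M (\<lambda>x. (v x)\<^sup>2)" using vL2 by (simp add: L2_on_def)
    show "(\<lambda>x. (min (v x) 0)\<^sup>2) \<in> borel_measurable ?M" by measurable
    show "(\<lambda>x. (ramp (h n) (- v x - h n))\<^sup>2) \<in> borel_measurable ?M" for n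
      unfolding ramp_def by measurable
    have "ramp (h n) (- v x - h n) \<le> \<bar>v x\<bar>" for n x
      using ramp_le[OF h, of n "- v x - h n"] h[of n] by auto
    then show "AE x in ?M. norm ((ramp (h n) (- v x - h n))\<^sup>2) \<le> (v x)\<^sup>2" for n
      using ramp_nonneg[OF h] by (auto intro!: AE_I2 simp: abs_le_square_iff[symmetric])
  qed (use lim in auto)
  then have "(\<lambda>n. \<tau>\<^sup>2 * (\<integral>x. (ramp (h n) (- v x - h n))\<^sup>2 \<partial>?M)) \<longlonglongrightarrow> \<tau>\<^sup>2 * (\<integral>x. (min (v x) 0)\<^sup>2 \<partial>?M)"
    by (rule tendsto_mult_left)
  then show ?thesis
    by (rule LIMSEQ_le_const2) (use main[OF h] in auto)
qed

subsection \<open>Expansions and positivity of the resolvent\<close>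

text \<open>The discriminant of a nonnegative quadratic in \<open>t\<close>; if
  \<open>B = 0\<close>, a nonzero slope would make the linear function negative somewhere. It yields
  Cauchy-Schwarz without square roots.\<close>

lemma square_le_mult_if_quadratic_nonneg:
  fixes A B X :: real
  assumes "\<And>t. 0 \<le> A + 2 * t * X + t\<^sup>2 * B" "0 \<le> B"
  shows "X\<^sup>2 \<le> A * B"
proof (cases "B = 0")
  case True
  have "X = 0"
  proof (rule ccontr)
    assume "X \<noteq> 0"
    then show False
      using assms(1)[of 0] assms(1)[of "- (A + 1) / X"] True by simp
  qed
  then show ?thesis using True by simp
next
  case False
  then have "B > 0" using assms(2) by simp
  then have "A + 2 * (- X / B) * X + (- X / B)\<^sup>2 * B = A - X\<^sup>2 / B"
    by (simp add: field_simps power2_eq_square)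
  then have "X\<^sup>2 / B \<le> A"
    using assms(1)[of "- X / B"] by linarith
  then show ?thesis
    using \<open>B > 0\<close> by (simp add: pos_divide_le_eq)
qed

lemma L2_on_cauchy_schwarz:
  assumes "f \<in> L2_on \<Omega>" "g \<in> L2_on \<Omega>"
  shows "(\<integral>x. f x * g x \<partial>lebesgue_on \<Omega>)\<^sup>2 \<le>
    (\<integral>x. (f x)\<^sup>2 \<partial>lebesgue_on \<Omega>) * (\<integral>x. (g x)\<^sup>2 \<partial>lebesgue_on \<Omega>)"
proof (rule square_le_mult_if_quadratic_nonneg)
  fix t :: real
  have i: "integrable (lebesgue_on \<Omega>) (\<lambda>x. (f x)\<^sup>2)" "integrable (lebesgue_on \<Omega>) (\<lambda>x. (g x)\<^sup>2)"
    "integrable (lebesgue_on \<Omega>) (\<lambda>x. f x * g x)"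
    using assms L2_on_mult_integrable by (auto simp: L2_on_def)
  have "(f x + t * g x)\<^sup>2 = (f x)\<^sup>2 + 2 * t * (f x * g x) + t\<^sup>2 * (g x)\<^sup>2" for x
    by (simp add: power2_eq_square algebra_simps)
  moreover have "0 \<le> (\<integral>x. (f x + t * g x)\<^sup>2 \<partial>lebesgue_on \<Omega>)"
    by simp
  ultimately show "0 \<le> (\<integral>x. (f x)\<^sup>2 \<partial>lebesgue_on \<Omega>) + 2 * t * (\<integral>x. f x * g x \<partial>lebesgue_on \<Omega>) +
      t\<^sup>2 * (\<integral>x. (g x)\<^sup>2 \<partial>lebesgue_on \<Omega>)"
    using i by simp
qed simp

lemma summable_mult_square:
  fixes a b :: "nat \<Rightarrow> real"
  assumes "summable (\<lambda>k. (a k)\<^sup>2)" "summable (\<lambda>k. (b k)\<^sup>2)"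
  shows "summable (\<lambda>k. \<bar>a k * b k\<bar>)" "summable (\<lambda>k. a k * b k)"
proof -
  have ab: "\<bar>x * y\<bar> \<le> x\<^sup>2 + y\<^sup>2" for x y :: real
    using sum_squares_bound[of "\<bar>x\<bar>" "\<bar>y\<bar>"] mult_nonneg_nonneg[of "\<bar>x\<bar>" "\<bar>y\<bar>"]
    unfolding abs_mult power2_abs by linarith
  show "summable (\<lambda>k. \<bar>a k * b k\<bar>)"
    by (rule summable_comparison_test'[OF summable_add[OF assms]]) (use ab in auto)
  then show "summable (\<lambda>k. a k * b k)"
    by (rule summable_rabs_cancel)
qed

lemma suminf_cauchy_schwarz:
  fixes a b :: "nat \<Rightarrow> real"
  assumes "summable (\<lambda>k. (a k)\<^sup>2)" "summable (\<lambda>k. (b k)\<^sup>2)"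
  shows "(\<Sum>k. a k * b k)\<^sup>2 \<le> (\<Sum>k. (a k)\<^sup>2) * (\<Sum>k. (b k)\<^sup>2)"
proof (rule LIMSEQ_le)
  show "(\<lambda>N. (\<Sum>k<N. a k * b k)\<^sup>2) \<longlonglongrightarrow> (\<Sum>k. a k * b k)\<^sup>2"
    by (intro tendsto_power summable_LIMSEQ summable_mult_square assms)
  show "(\<lambda>N. (\<Sum>k<N. (a k)\<^sup>2) * (\<Sum>k<N. (b k)\<^sup>2)) \<longlonglongrightarrow> (\<Sum>k. (a k)\<^sup>2) * (\<Sum>k. (b k)\<^sup>2)"
    by (intro tendsto_mult summable_LIMSEQ assms)
qed (use Cauchy_Schwarz_ineq_sum in blast)

text \<open>Cauchy-Schwarz is used in squared form; this turns a vanishing L2 norm of one factor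
  into a vanishing pairing.\<close>

lemma tendsto_zero_if_square_le:
  fixes X I :: "nat \<Rightarrow> real"
  assumes "\<And>n. (X n)\<^sup>2 \<le> I n * C" "I \<longlonglongrightarrow> 0"
  shows "X \<longlonglongrightarrow> 0"
proof -
  have "(\<lambda>n. I n * C) \<longlonglongrightarrow> 0"
    using tendsto_mult_right[OF assms(2), of C] by simp
  then have "(\<lambda>n. (X n)\<^sup>2) \<longlonglongrightarrow> 0"
    by (rule real_tendsto_sandwich[rotated 2, OF tendsto_const]) (use assms(1) in auto)
  then show ?thesis
    using tendsto_real_sqrt by (fastforce simp: tendsto_rabs_zero_iff)
qed

section \<open>Coefficients with respect to the eigenfunctions\<close>

locale dirichlet_domain =
  fixes \<Omega> :: "(real ^ 'n::finite) set" and \<mu> :: "nat \<Rightarrow> real" and \<phi> :: "nat \<Rightarrow> real ^ 'n \<Rightarrow> real"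
  assumes domain: "smooth_bounded_domain \<Omega>" and eigensystem: "dirichlet_eigensystem \<Omega> \<mu> \<phi>"
begin

abbreviation "M \<equiv> lebesgue_on \<Omega>"

definition coef :: "(real ^ 'n \<Rightarrow> real) \<Rightarrow> nat \<Rightarrow> real" where
  "coef f k = (\<integral>x. f x * \<phi> k x \<partial>M)"

lemma open_bounded: "open \<Omega>" "bounded \<Omega>"
  using domain by (auto simp: smooth_bounded_domain_def)

lemma \<mu>_pos: "\<mu> k > 0"
  using eigensystem incseqD[of \<mu> 0 k] by (force simp: dirichlet_eigensystem_def)

lemma \<phi>_eigenfunction: "dirichlet_eigenfunction \<Omega> (\<mu> k) (\<phi> k)"
  using eigensystem by (simp add: dirichlet_eigensystem_def)

lemma \<phi>_continuous: "continuous_on (closure \<Omega>) (\<phi> k)"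
  and \<phi>_frontier: "x \<in> frontier \<Omega> \<Longrightarrow> \<phi> k x = 0"
  using \<phi>_eigenfunction by (simp_all add: dirichlet_eigenfunction_def)

lemma \<phi>_C2: "C2_data \<Omega> (\<phi> k) (\<lambda>i. partial_deriv i (\<phi> k)) (\<lambda>i. partial_deriv i (partial_deriv i (\<phi> k)))"
  using \<phi>_eigenfunction by (simp add: dirichlet_eigenfunction_def C2_data_Ck_on)

lemma \<phi>_eq:
  assumes "x \<in> \<Omega>"
  shows "(\<Sum>i\<in>UNIV. partial_deriv i (partial_deriv i (\<phi> k)) x) = - \<mu> k * \<phi> k x"
proof -
  have "- laplacian (\<phi> k) x = \<mu> k * \<phi> k x"
    using \<phi>_eigenfunction assms by (simp add: dirichlet_eigenfunction_def)
  then show ?thesis by (simp add: laplacian_def)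
qed

lemma \<phi>_L2: "\<phi> k \<in> L2_on \<Omega>"
  by (rule L2_on_continuous_closure[OF open_bounded \<phi>_continuous])

lemma coef_\<phi>: "coef (\<phi> j) k = (if j = k then 1 else 0)"
  using eigensystem by (simp add: dirichlet_eigensystem_def coef_def)

lemma coef_add:
  "f \<in> L2_on \<Omega> \<Longrightarrow> g \<in> L2_on \<Omega> \<Longrightarrow> coef (\<lambda>x. f x + g x) k = coef f k + coef g k"
  using L2_on_mult_integrable[OF _ \<phi>_L2] by (simp add: coef_def algebra_simps)

lemma coef_diff:
  "f \<in> L2_on \<Omega> \<Longrightarrow> g \<in> L2_on \<Omega> \<Longrightarrow> coef (\<lambda>x. f x - g x) k = coef f k - coef g k"
  using L2_on_mult_integrable[OF _ \<phi>_L2] by (simp add: coef_def algebra_simps)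

lemma coef_cmult: "coef (\<lambda>x. c * f x) k = c * coef f k"
  by (simp add: coef_def mult.assoc)

lemma coef_sum:
  "(\<And>j. f j \<in> L2_on \<Omega>) \<Longrightarrow> coef (\<lambda>x. \<Sum>j<N::nat. f j x) k = (\<Sum>j<N. coef (f j) k)"
  using L2_on_mult_integrable[OF _ \<phi>_L2] by (simp add: coef_def sum_distrib_right)

lemma partial_sum_L2: "(\<lambda>x. \<Sum>k<N. a k * \<phi> k x) \<in> L2_on \<Omega>"
  by (intro L2_on_sum L2_on_cmult \<phi>_L2)

lemma integral_partial_sum:
  assumes "g \<in> L2_on \<Omega>"
  shows "(\<integral>x. (\<Sum>k<N. a k * \<phi> k x) * g x \<partial>M) = (\<Sum>k<N. a k * coef g k)"
proof -
  have "(\<integral>x. (\<Sum>k<N. a k * \<phi> k x) * g x \<partial>M) = (\<integral>x. (\<Sum>k<N. a k * (g x * \<phi> k x)) \<partial>M)"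
    by (simp add: sum_distrib_left mult_ac)
  also have "\<dots> = (\<Sum>k<N. a k * coef g k)"
    using L2_on_mult_integrable[OF assms \<phi>_L2] by (simp add: coef_def)
  finally show ?thesis .
qed

text \<open>Pairing with \<open>g\<close> is continuous in L2 by Cauchy-Schwarz, so it may be
  applied to the partial sums of the expansion.\<close>

lemma expansion_sums:
  assumes a: "L2_expansion \<Omega> \<phi> a f" and g: "g \<in> L2_on \<Omega>"
  shows "(\<lambda>k. a k * coef g k) sums (\<integral>x. f x * g x \<partial>M)"
proof -
  define D where "D N x = f x - (\<Sum>k<N. a k * \<phi> k x)" for N x
  have f: "f \<in> L2_on \<Omega>" and D0: "(\<lambda>N. \<integral>x. (D N x)\<^sup>2 \<partial>M) \<longlonglongrightarrow> 0"
    using a by (auto simp: L2_expansion_def D_def)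
  have D: "D N \<in> L2_on \<Omega>" for N
    unfolding D_def by (intro L2_on_diff f partial_sum_L2)
  have "(\<lambda>N. \<integral>x. D N x * g x \<partial>M) \<longlonglongrightarrow> 0"
    by (rule tendsto_zero_if_square_le[OF L2_on_cauchy_schwarz[OF D g] D0])
  moreover have "(\<integral>x. D N x * g x \<partial>M) = (\<integral>x. f x * g x \<partial>M) - (\<Sum>k<N. a k * coef g k)" for N
    using L2_on_mult_integrable[OF f g] L2_on_mult_integrable[OF partial_sum_L2 g, of a N]
    by (simp add: D_def left_diff_distrib integral_partial_sum[OF g])
  ultimately have "(\<lambda>N. (\<integral>x. f x * g x \<partial>M) - (\<Sum>k<N. a k * coef g k)) \<longlonglongrightarrow> 0"
    by simp
  from tendsto_diff[OF tendsto_const this, of "\<integral>x. f x * g x \<partial>M"] show ?thesis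
    by (simp add: sums_def)
qed

text \<open>Pairing with \<open>\<phi> k\<close> isolates one term by orthonormality. Uniqueness
  turns the existential definition of the fractional Laplacian into equations between
  coefficients.\<close>

lemma expansion_coef:
  assumes "L2_expansion \<Omega> \<phi> a f"
  shows "a = coef f"
proof
  fix k
  have "(\<lambda>j. if j = k then a j else 0) sums coef f k"
    using expansion_sums[OF assms \<phi>_L2[of k]]
    by (simp add: coef_def[symmetric] coef_\<phi> if_distrib eq_commute cong: if_cong)
  then show "a k = coef f k"
    using sums_single[of k a] sums_unique2 by blast
qed

lemma coef_expansion: "f \<in> L2_on \<Omega> \<Longrightarrow> L2_expansion \<Omega> \<phi> (coef f) f"
  using eigensystem expansion_coef by (metis dirichlet_eigensystem_def)

text \<open>Parseval's identity in polarised form, the bridge between integrals over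
  \<open>\<Omega>\<close> and series of coefficients.\<close>

lemma coef_sums:
  "f \<in> L2_on \<Omega> \<Longrightarrow> g \<in> L2_on \<Omega> \<Longrightarrow> (\<lambda>k. coef f k * coef g k) sums (\<integral>x. f x * g x \<partial>M)"
  using expansion_sums coef_expansion by blast

lemma coef_square_sums: "f \<in> L2_on \<Omega> \<Longrightarrow> (\<lambda>k. (coef f k)\<^sup>2) sums (\<integral>x. (f x)\<^sup>2 \<partial>M)"
  using coef_sums[of f f] by (simp add: power2_eq_square)

lemma coef_square_summable: "f \<in> L2_on \<Omega> \<Longrightarrow> summable (\<lambda>k. (coef f k)\<^sup>2)"
  using coef_square_sums sums_summable by blast

lemma summable_mult_coef:
  "summable (\<lambda>k. (c k)\<^sup>2) \<Longrightarrow> f \<in> L2_on \<Omega> \<Longrightarrow> summable (\<lambda>k. c k * coef f k)"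
  by (intro summable_mult_square coef_square_summable)

text \<open>A square summable sequence is nonnegative when it is nonnegative as a functional on \<open>L\<^sup>2\<close>;
  this way no function with the given coefficients has to be constructed.\<close>

definition nonneg_seq :: "(nat \<Rightarrow> real) \<Rightarrow> bool" where
  "nonneg_seq c \<longleftrightarrow> summable (\<lambda>k. (c k)\<^sup>2) \<and>
     (\<forall>\<psi>\<in>L2_on \<Omega>. (\<forall>x\<in>\<Omega>. 0 \<le> \<psi> x) \<longrightarrow> 0 \<le> (\<Sum>k. c k * coef \<psi> k))"

lemma nonneg_seq_summable: "nonneg_seq c \<Longrightarrow> summable (\<lambda>k. (c k)\<^sup>2)"
  by (simp add: nonneg_seq_def)

lemma nonneg_seqD:
  "nonneg_seq c \<Longrightarrow> \<psi> \<in> L2_on \<Omega> \<Longrightarrow> (\<And>x. x \<in> \<Omega> \<Longrightarrow> 0 \<le> \<psi> x) \<Longrightarrow> 0 \<le> (\<Sum>k. c k * coef \<psi> k)"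
  by (simp add: nonneg_seq_def)

lemma summable_square_add:
  fixes a b :: "nat \<Rightarrow> real"
  assumes "summable (\<lambda>k. (a k)\<^sup>2)" "summable (\<lambda>k. (b k)\<^sup>2)"
  shows "summable (\<lambda>k. (a k + b k)\<^sup>2)"
  using summable_add[OF summable_add[OF assms] summable_mult[OF summable_mult_square(2)[OF assms], of 2]]
  by (simp add: power2_sum mult.assoc)

lemma summable_square_cmult: "summable (\<lambda>k. (a k)\<^sup>2) \<Longrightarrow> summable (\<lambda>k. (t * a k :: real)\<^sup>2)"
  using summable_mult[of "\<lambda>k. (a k)\<^sup>2" "t\<^sup>2"] by (simp add: power_mult_distrib)

lemma nonneg_seq_add:
  assumes "nonneg_seq a" "nonneg_seq b"
  shows "nonneg_seq (\<lambda>k. a k + b k)"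
proof -
  have "(\<Sum>k. (a k + b k) * coef \<psi> k) = (\<Sum>k. a k * coef \<psi> k) + (\<Sum>k. b k * coef \<psi> k)"
    if "\<psi> \<in> L2_on \<Omega>" for \<psi>
    using suminf_add[OF summable_mult_coef[OF _ that] summable_mult_coef[OF _ that]] assms
    by (simp add: nonneg_seq_def distrib_right)
  then show ?thesis
    using assms by (auto simp: nonneg_seq_def summable_square_add)
qed

lemma nonneg_seq_cmult:
  assumes "nonneg_seq a" "0 \<le> t"
  shows "nonneg_seq (\<lambda>k. t * a k)"
proof -
  have "(\<Sum>k. (t * a k) * coef \<psi> k) = t * (\<Sum>k. a k * coef \<psi> k)" if "\<psi> \<in> L2_on \<Omega>" for \<psi>
    using suminf_mult[OF summable_mult_coef[OF _ that]] assms
    by (simp add: nonneg_seq_def mult.assoc)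
  then show ?thesis
    using assms by (auto simp: nonneg_seq_def summable_square_cmult)
qed

lemma nonneg_seq_coef:
  assumes "g \<in> L2_on \<Omega>" "\<And>x. x \<in> \<Omega> \<Longrightarrow> 0 \<le> g x"
  shows "nonneg_seq (coef g)"
  unfolding nonneg_seq_def
proof (intro conjI ballI impI)
  fix \<psi> assume \<psi>: "\<psi> \<in> L2_on \<Omega>" "\<forall>x\<in>\<Omega>. 0 \<le> \<psi> x"
  have "0 \<le> (\<integral>x. g x * \<psi> x \<partial>M)"
    by (rule Bochner_Integration.integral_nonneg_AE) (use assms \<psi> in \<open>auto intro!: AE_I2\<close>)
  then show "0 \<le> (\<Sum>k. coef g k * coef \<psi> k)"
    using coef_sums[OF assms(1) \<psi>(1)] by (simp add: sums_iff)
qed (rule coef_square_summable[OF assms(1)])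

lemma min_max_L2:
  assumes "f \<in> L2_on \<Omega>"
  shows "(\<lambda>x. min (f x) 0) \<in> L2_on \<Omega>" "(\<lambda>x. max (f x) 0) \<in> L2_on \<Omega>"
proof -
  have [measurable]: "f \<in> borel_measurable M" using assms by (simp add: L2_on_def)
  show "(\<lambda>x. min (f x) 0) \<in> L2_on \<Omega>" "(\<lambda>x. max (f x) 0) \<in> L2_on \<Omega>"
    by (rule L2_on_bound[OF assms]; auto)+
qed

text \<open>The functions \<open>w N\<close> are classical solutions of \<open>\<tau> w - \<Delta> w = g\<close> up to an \<open>L\<^sup>2\<close>-small error.\<close>

lemma resolvent_negative_part:
  assumes g: "g \<in> L2_on \<Omega>" and "\<tau> > 0"
    and b: "C2_data \<Omega> b G H" "continuous_on (closure \<Omega>) b"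
    and bdry: "\<And>x. x \<in> frontier \<Omega> \<Longrightarrow> b x \<le> 0"
    and ineq: "\<And>x. x \<in> \<Omega> \<Longrightarrow> \<tau> * b x - (\<Sum>i\<in>UNIV. H i x) \<le> g x"
  defines "w N x \<equiv> \<Sum>k<N. coef g k / (\<mu> k + \<tau>) * \<phi> k x"
  shows "(\<lambda>N. \<integral>x. (min (w N x - b x) 0)\<^sup>2 \<partial>M) \<longlonglongrightarrow> 0"
proof -
  let ?I = "\<lambda>N. \<integral>x. (min (w N x - b x) 0)\<^sup>2 \<partial>M"
  let ?E = "\<lambda>N. \<integral>x. (g x - (\<Sum>k<N. coef g k * \<phi> k x))\<^sup>2 \<partial>M"
  have E: "?E \<longlonglongrightarrow> 0"
    using coef_expansion[OF g] by (simp add: L2_expansion_def)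
  have le: "\<tau>\<^sup>2 * ?I N \<le> ?E N" for N
  \<comment> \<open>The error \<open>e\<close> of the comparison is the tail of the expansion of
    \<open>g\<close>: by the eigenvalue equation, \<open>\<tau> w - \<Delta> w\<close> for
    \<open>w = w N\<close> is exactly the \<open>N\<close>-th partial sum of that expansion.\<close>
  proof (rule L2_comparison[OF open_bounded _ _ _ \<open>\<tau> > 0\<close>])
    show "C2_data \<Omega> (\<lambda>x. w N x - b x)
       (\<lambda>i x. (\<Sum>k<N. coef g k / (\<mu> k + \<tau>) * partial_deriv i (\<phi> k) x) - G i x)
       (\<lambda>i x. (\<Sum>k<N. coef g k / (\<mu> k + \<tau>) * partial_deriv i (partial_deriv i (\<phi> k)) x) - H i x)"
      unfolding w_def by (intro C2_data_diff C2_data_sum C2_data_cmult \<phi>_C2 b)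
    show "continuous_on (closure \<Omega>) (\<lambda>x. w N x - b x)"
      unfolding w_def by (intro continuous_intros \<phi>_continuous b)
    show "0 \<le> w N x - b x" if "x \<in> frontier \<Omega>" for x
      using \<phi>_frontier[OF that] bdry[OF that] by (simp add: w_def)
    show "(\<lambda>x. g x - (\<Sum>k<N. coef g k * \<phi> k x)) \<in> L2_on \<Omega>"
      by (intro L2_on_diff g partial_sum_L2)
    fix x assume x: "x \<in> \<Omega>"
    have "(\<Sum>i\<in>UNIV. \<Sum>k<N. coef g k / (\<mu> k + \<tau>) * partial_deriv i (partial_deriv i (\<phi> k)) x) =
      (\<Sum>k<N. coef g k / (\<mu> k + \<tau>) * (- \<mu> k * \<phi> k x))"
      by (subst sum.swap, intro sum.cong refl) (simp only: sum_distrib_left[symmetric] \<phi>_eq[OF x])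
    moreover have "(\<Sum>k<N. coef g k * \<phi> k x) =
      \<tau> * w N x - (\<Sum>k<N. coef g k / (\<mu> k + \<tau>) * (- \<mu> k * \<phi> k x))"
    proof -
      have "coef g k * \<phi> k x = \<tau> * (coef g k / (\<mu> k + \<tau>) * \<phi> k x) - coef g k / (\<mu> k + \<tau>) * (- \<mu> k * \<phi> k x)" for k
      proof -
        have "\<mu> k + \<tau> \<noteq> 0" using \<mu>_pos[of k] \<open>\<tau> > 0\<close> by simp
        then have "coef g k = coef g k / (\<mu> k + \<tau>) * (\<mu> k + \<tau>)" by simp
        then show ?thesis by (simp only: algebra_simps) algebra
      qed
      then show ?thesis
        by (simp only: w_def sum_distrib_left sum_subtractf)
    qed
    ultimately show "- (g x - (\<Sum>k<N. coef g k * \<phi> k x)) \<le> \<tau> * (w N x - b x) -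
       (\<Sum>i\<in>UNIV. (\<Sum>k<N. coef g k / (\<mu> k + \<tau>) * partial_deriv i (partial_deriv i (\<phi> k)) x) - H i x)"
      using ineq[OF x] by (simp add: sum_subtractf right_diff_distrib)
  qed
  have "(\<lambda>N. \<tau>\<^sup>2 * ?I N) \<longlonglongrightarrow> 0"
    by (rule real_tendsto_sandwich[rotated 2, OF tendsto_const E]) (use le in auto)
  from tendsto_mult_left[OF this, of "1 / \<tau>\<^sup>2"] show ?thesis
    using \<open>\<tau> > 0\<close> by simp
qed

lemma summable_square_div:
  assumes "summable (\<lambda>k. (c k)\<^sup>2)" "\<tau> > 0"
  shows "summable (\<lambda>k. (c k / (\<mu> k + \<tau>))\<^sup>2)"
proof (rule summable_comparison_test')
  show "summable (\<lambda>k. (1 / \<tau> * c k)\<^sup>2)"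
    by (rule summable_square_cmult[OF assms(1)])
  have "\<bar>c k / (\<mu> k + \<tau>)\<bar> \<le> \<bar>1 / \<tau> * c k\<bar>" for k
    using \<mu>_pos[of k] assms(2) by (simp add: abs_mult divide_left_mono)
  then show "norm ((c k / (\<mu> k + \<tau>))\<^sup>2) \<le> (1 / \<tau> * c k)\<^sup>2" for k
    by (simp only: abs_le_square_iff real_norm_def abs_power2)
qed

text \<open>The negative part of \<open>w N - b\<close> tends to zero in L2, so pairings of
  \<open>w N - b\<close> with a nonnegative \<open>\<psi>\<close> are nonnegative in the limit. This
  is the maximum principle in the form used below: a subsolution \<open>b\<close> that is
  nonpositive on the frontier lies below \<open>(A + \<tau>)^-1 g\<close>.\<close>

lemma nonneg_seq_resolvent_diff:
  assumes g: "g \<in> L2_on \<Omega>" and "\<tau> > 0"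
    and b: "C2_data \<Omega> b G H" "continuous_on (closure \<Omega>) b"
    and bdry: "\<And>x. x \<in> frontier \<Omega> \<Longrightarrow> b x \<le> 0"
    and ineq: "\<And>x. x \<in> \<Omega> \<Longrightarrow> \<tau> * b x - (\<Sum>i\<in>UNIV. H i x) \<le> g x"
  shows "nonneg_seq (\<lambda>k. coef g k / (\<mu> k + \<tau>) - coef b k)"
  unfolding nonneg_seq_def
proof (intro conjI ballI impI)
  have bL2: "b \<in> L2_on \<Omega>"
    by (rule L2_on_continuous_closure[OF open_bounded b(2)])
  have sg: "summable (\<lambda>k. (coef g k / (\<mu> k + \<tau>))\<^sup>2)"
    by (rule summable_square_div[OF coef_square_summable[OF g] \<open>\<tau> > 0\<close>])
  show "summable (\<lambda>k. (coef g k / (\<mu> k + \<tau>) - coef b k)\<^sup>2)"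
    using summable_square_add[OF sg summable_square_cmult[OF coef_square_summable[OF bL2], of "-1"]]
    by simp
  fix \<psi> assume \<psi>: "\<psi> \<in> L2_on \<Omega>" "\<forall>x\<in>\<Omega>. 0 \<le> \<psi> x"
  define w where "w N x = (\<Sum>k<N. coef g k / (\<mu> k + \<tau>) * \<phi> k x)" for N x
  have wb: "(\<lambda>x. w N x - b x) \<in> L2_on \<Omega>" for N
    unfolding w_def by (intro L2_on_diff bL2 partial_sum_L2)
  have "(\<lambda>N. \<integral>x. min (w N x - b x) 0 * \<psi> x \<partial>M) \<longlonglongrightarrow> 0"
    by (rule tendsto_zero_if_square_le[OF L2_on_cauchy_schwarz[OF min_max_L2(1)[OF wb] \<psi>(1)]])
      (unfold w_def, rule resolvent_negative_part[OF assms])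
  moreover have "(\<lambda>N. \<integral>x. (w N x - b x) * \<psi> x \<partial>M) \<longlonglongrightarrow>
     (\<Sum>k. coef g k / (\<mu> k + \<tau>) * coef \<psi> k) - (\<Sum>k. coef b k * coef \<psi> k)"
  proof -
    have "(\<integral>x. (w N x - b x) * \<psi> x \<partial>M) =
       (\<Sum>k<N. coef g k / (\<mu> k + \<tau>) * coef \<psi> k) - (\<Sum>k. coef b k * coef \<psi> k)" for N
      using L2_on_mult_integrable[OF bL2 \<psi>(1)] integral_partial_sum[OF \<psi>(1)]
        L2_on_mult_integrable[OF partial_sum_L2 \<psi>(1)] coef_sums[OF bL2 \<psi>(1)]
      by (simp add: w_def left_diff_distrib sums_iff del: times_divide_eq_left)
    then show ?thesis
      using summable_LIMSEQ[OF summable_mult_coef[OF sg \<psi>(1)]] by (auto intro!: tendsto_diff)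
  qed
  moreover have "(\<integral>x. min (w N x - b x) 0 * \<psi> x \<partial>M) \<le> (\<integral>x. (w N x - b x) * \<psi> x \<partial>M)" for N
    using \<psi> wb[of N]
    by (intro integral_mono L2_on_mult_integrable min_max_L2) (auto intro!: mult_right_mono)
  ultimately have "0 \<le> (\<Sum>k. coef g k / (\<mu> k + \<tau>) * coef \<psi> k) - (\<Sum>k. coef b k * coef \<psi> k)"
    by (intro LIMSEQ_le) auto
  also have "\<dots> = (\<Sum>k. (coef g k / (\<mu> k + \<tau>) - coef b k) * coef \<psi> k)"
    using suminf_diff[OF summable_mult_coef[OF sg \<psi>(1)] summable_mult_coef[OF coef_square_summable[OF bL2] \<psi>(1)]]
    by (simp add: left_diff_distrib)
  finally show "0 \<le> (\<Sum>k. (coef g k / (\<mu> k + \<tau>) - coef b k) * coef \<psi> k)" .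
qed

text \<open>The resolvent is self-adjoint, so it can be moved from \<open>c\<close>, for which no
  function is at hand, to the test function \<open>\<psi>\<close>. There the finite sums
  \<open>w N\<close> approximate it, and they are nonnegative up to an L2-small part.\<close>

lemma nonneg_seq_resolvent:
  assumes c: "nonneg_seq c" and "\<tau> > 0"
  shows "nonneg_seq (\<lambda>k. c k / (\<mu> k + \<tau>))"
  unfolding nonneg_seq_def
proof (intro conjI ballI impI)
  have sc: "summable (\<lambda>k. (c k)\<^sup>2)" using c by (rule nonneg_seq_summable)
  show s: "summable (\<lambda>k. (c k / (\<mu> k + \<tau>))\<^sup>2)"
    by (rule summable_square_div[OF sc \<open>\<tau> > 0\<close>])
  fix \<psi> assume \<psi>: "\<psi> \<in> L2_on \<Omega>" "\<forall>x\<in>\<Omega>. 0 \<le> \<psi> x"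
  define w where "w N x = (\<Sum>k<N. coef \<psi> k / (\<mu> k + \<tau>) * \<phi> k x)" for N x
  have w: "w N \<in> L2_on \<Omega>" for N
    unfolding w_def by (rule partial_sum_L2)
  have neg: "(\<lambda>N. \<integral>x. (min (w N x) 0)\<^sup>2 \<partial>M) \<longlonglongrightarrow> 0"
    using resolvent_negative_part[OF \<psi>(1) \<open>\<tau> > 0\<close> C2_data_const[of \<Omega> 0]] \<psi>(2)
    by (simp add: w_def)
  \<comment> \<open>The negative part of \<open>w N\<close> is not an admissible test function for
    \<open>c\<close>; its contribution \<open>L N\<close> vanishes in the limit by
    Cauchy-Schwarz.\<close>
  define L where "L N = (\<Sum>k. c k * coef (\<lambda>x. min (w N x) 0) k)" for N
  have "(L N)\<^sup>2 \<le> (\<integral>x. (min (w N x) 0)\<^sup>2 \<partial>M) * (\<Sum>k. (c k)\<^sup>2)" for N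
    using suminf_cauchy_schwarz[OF sc coef_square_summable[OF min_max_L2(1)[OF w]], of N]
      coef_square_sums[OF min_max_L2(1)[OF w], of N]
    by (simp add: L_def sums_iff mult.commute)
  then have "L \<longlonglongrightarrow> 0"
    using neg by (rule tendsto_zero_if_square_le)
  moreover have "(\<lambda>N. \<Sum>k<N. c k / (\<mu> k + \<tau>) * coef \<psi> k) \<longlonglongrightarrow> (\<Sum>k. c k / (\<mu> k + \<tau>) * coef \<psi> k)"
    by (rule summable_LIMSEQ[OF summable_mult_coef[OF s \<psi>(1)]])
  moreover have "L N \<le> (\<Sum>k<N. c k / (\<mu> k + \<tau>) * coef \<psi> k)" for N
  proof -
    have cw: "coef (w N) k = (if k < N then coef \<psi> k / (\<mu> k + \<tau>) else 0)" for k
      unfolding w_def[abs_def] coef_sum[OF L2_on_cmult[OF \<phi>_L2]] coef_cmult coef_\<phi>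
      by (simp add: if_distrib cong: if_cong)
    have "(\<Sum>k. c k * coef (w N) k) = (\<Sum>k<N. c k * coef (w N) k)"
      by (rule suminf_finite) (auto simp: cw)
    also have "\<dots> = (\<Sum>k<N. c k / (\<mu> k + \<tau>) * coef \<psi> k)"
      by (simp add: cw)
    finally have 1: "(\<Sum>k. c k * coef (w N) k) = (\<Sum>k<N. c k / (\<mu> k + \<tau>) * coef \<psi> k)" .
    have "w N = (\<lambda>x. max (w N x) 0 + min (w N x) 0)"
      by (auto simp: max_def min_def)
    then have "coef (w N) k = coef (\<lambda>x. max (w N x) 0) k + coef (\<lambda>x. min (w N x) 0) k" for k
      using coef_add[OF min_max_L2(2)[OF w] min_max_L2(1)[OF w], of N N k] by simp
    then have "(\<Sum>k. c k * coef (w N) k) = (\<Sum>k. c k * coef (\<lambda>x. max (w N x) 0) k) + L N"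
      using suminf_add[OF summable_mult_coef[OF sc min_max_L2(2)[OF w]] summable_mult_coef[OF sc min_max_L2(1)[OF w]], of N N]
      by (simp add: L_def distrib_left)
    moreover have "0 \<le> (\<Sum>k. c k * coef (\<lambda>x. max (w N x) 0) k)"
      by (rule nonneg_seqD[OF c min_max_L2(2)[OF w]]) simp
    ultimately show ?thesis using 1 by simp
  qed
  ultimately show "0 \<le> (\<Sum>k. c k / (\<mu> k + \<tau>) * coef \<psi> k)"
    by (intro LIMSEQ_le) auto
qed

end

subsection \<open>Lower bounds for the resolvent\<close>

definition pos_pow :: "nat \<Rightarrow> real \<Rightarrow> real" where
  "pos_pow p r = (if r \<le> 0 then 0 else r ^ p)"

lemma pos_pow_deriv:
  assumes "p \<ge> 2"
  shows "(pos_pow p has_real_derivative real p * pos_pow (p - 1) r) (at r)"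
proof -
  have "((\<lambda>r. if r \<le> 0 then 0 else r ^ p) has_real_derivative
      (if r \<le> 0 then 0 else real p * r ^ (p - 1))) (at r)"
    by (rule DERIV_glue_zero) (use assms in \<open>auto intro!: derivative_eq_intros\<close>)
  then show ?thesis
    by (simp add: pos_pow_def[abs_def] if_distrib cong: if_cong)
qed

lemma continuous_on_pos_pow: "p \<ge> 1 \<Longrightarrow> continuous_on UNIV (pos_pow p)"
  unfolding pos_pow_def[abs_def] by (rule continuous_on_glue_zero) (auto intro!: continuous_intros)

lemma C2_data_paraboloid:
  fixes y :: "real ^ 'n::finite"
  shows "C2_data S (\<lambda>x. R\<^sup>2 - (norm (x - y))\<^sup>2) (\<lambda>i x. - 2 * (x $ i - y $ i)) (\<lambda>i x. - 2)"
proof -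
  have 1: "has_partial_deriv i (\<lambda>x. R\<^sup>2 - (norm (x - y))\<^sup>2) (- 2 * (x $ i - y $ i)) x" for i and x :: "real ^ 'n"
  proof -
    have "(norm (x + t *\<^sub>R axis i 1 - y))\<^sup>2 = (norm (x - y))\<^sup>2 + 2 * t * (x $ i - y $ i) + t\<^sup>2" for t
    proof -
      have "(norm ((x - y) + t *\<^sub>R axis i 1))\<^sup>2 = (norm (x - y))\<^sup>2 + 2 * t * ((x - y) \<bullet> axis i 1) + t\<^sup>2"
        unfolding power2_norm_eq_inner
        by (simp add: inner_add_left inner_add_right inner_commute
            inner_axis_axis power2_eq_square)
      then show ?thesis by (simp add: inner_axis algebra_simps)
    qed
    then show ?thesis
      unfolding has_partial_deriv_def by (auto intro!: derivative_eq_intros)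
  qed
  have 2: "has_partial_deriv i (\<lambda>x. - 2 * (x $ i - y $ i)) (- 2) x" for i and x :: "real ^ 'n"
    unfolding has_partial_deriv_def by (auto intro!: derivative_eq_intros)
  show ?thesis
    unfolding C2_data_def using 1 2 by (auto intro!: continuous_intros)
qed

text \<open>Serves twice: with a large power as a barrier that carries positivity from a small ball
  to a larger one, and with \<open>p = 3\<close>, the least power allowed by
  \<open>C2_data_bump\<close>, as the test function near \<open>z\<close>.\<close>

definition bump :: "nat \<Rightarrow> real ^ 'n::finite \<Rightarrow> real \<Rightarrow> real ^ 'n \<Rightarrow> real" where
  "bump p y R x = pos_pow p (R\<^sup>2 - (norm (x - y))\<^sup>2)"

definition bump_G :: "nat \<Rightarrow> real ^ 'n::finite \<Rightarrow> real \<Rightarrow> 'n \<Rightarrow> real ^ 'n \<Rightarrow> real" where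
  "bump_G p y R i x = real p * pos_pow (p - 1) (R\<^sup>2 - (norm (x - y))\<^sup>2) * (- 2 * (x $ i - y $ i))"

definition bump_H :: "nat \<Rightarrow> real ^ 'n::finite \<Rightarrow> real \<Rightarrow> 'n \<Rightarrow> real ^ 'n \<Rightarrow> real" where
  "bump_H p y R i x =
     real p * (real (p - 1) * pos_pow (p - 2) (R\<^sup>2 - (norm (x - y))\<^sup>2)) * (- 2 * (x $ i - y $ i))\<^sup>2 +
     real p * pos_pow (p - 1) (R\<^sup>2 - (norm (x - y))\<^sup>2) * - 2"

lemma C2_data_bump:
  assumes "p \<ge> 3"
  shows "C2_data S (bump p y R) (bump_G p y R) (bump_H p y R)"
  unfolding bump_def[abs_def] bump_G_def[abs_def] bump_H_def[abs_def]
proof (rule C2_data_compose[OF C2_data_paraboloid])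
  show "(pos_pow p has_real_derivative real p * pos_pow (p - 1) t) (at t)" for t
    by (rule pos_pow_deriv) (use assms in simp)
  have "(pos_pow (p - 1) has_real_derivative real (p - 1) * pos_pow (p - 1 - 1) t) (at t)" for t
    by (rule pos_pow_deriv) (use assms in simp)
  then show "((\<lambda>t. real p * pos_pow (p - 1) t) has_real_derivative
      real p * (real (p - 1) * pos_pow (p - 2) t)) (at t)" for t
    by (intro DERIV_cmult) (simp add: numeral_2_eq_2)
  show "continuous_on UNIV (\<lambda>t. real p * (real (p - 1) * pos_pow (p - 2) t))"
    by (intro continuous_intros continuous_on_pos_pow) (use assms in simp)
qed

lemma laplacian_bump:
  fixes x y :: "real ^ 'n::finite"
  shows "(\<Sum>i\<in>UNIV. bump_H p y R i x) =
    4 * real p * real (p - 1) * pos_pow (p - 2) (R\<^sup>2 - (norm (x - y))\<^sup>2) * (norm (x - y))\<^sup>2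
      - 2 * real CARD('n) * real p * pos_pow (p - 1) (R\<^sup>2 - (norm (x - y))\<^sup>2)"
proof -
  have "(norm (x - y))\<^sup>2 = (\<Sum>i\<in>UNIV. (x $ i - y $ i)\<^sup>2)"
    unfolding power2_norm_eq_inner by (simp add: inner_vec_def power2_eq_square)
  then have "(\<Sum>i\<in>UNIV. (- 2 * (x $ i - y $ i))\<^sup>2) = 4 * (norm (x - y))\<^sup>2"
    by (simp only: power_mult_distrib sum_distrib_left) simp
  moreover have "(\<Sum>i\<in>UNIV. bump_H p y R i x) =
      real p * (real (p - 1) * pos_pow (p - 2) (R\<^sup>2 - (norm (x - y))\<^sup>2)) * (\<Sum>i\<in>UNIV. (- 2 * (x $ i - y $ i))\<^sup>2)
      + (\<Sum>i\<in>(UNIV :: 'n set). real p * pos_pow (p - 1) (R\<^sup>2 - (norm (x - y))\<^sup>2) * - 2)"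
    by (simp only: bump_H_def sum.distrib sum_distrib_left)
  ultimately show ?thesis by simp
qed

lemma bump_nonneg: "0 \<le> bump p y R x"
  by (simp add: bump_def pos_pow_def)

lemma bump_outside: "0 \<le> R \<Longrightarrow> x \<notin> ball y R \<Longrightarrow> bump p y R x = 0"
  by (auto simp: bump_def pos_pow_def dist_norm norm_minus_commute abs_le_square_iff[symmetric])

lemma bump_ge:
  assumes "0 \<le> \<rho>" "\<rho> < R" "x \<in> ball y \<rho>"
  shows "(R\<^sup>2 - \<rho>\<^sup>2) ^ p \<le> bump p y R x"
proof -
  have "norm (x - y) < \<rho>"
    using assms(3) by (simp add: dist_norm norm_minus_commute)
  then have "(norm (x - y))\<^sup>2 \<le> \<rho>\<^sup>2"
    by (intro power_mono) auto
  moreover have "\<rho>\<^sup>2 < R\<^sup>2"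
    using assms by (intro power_strict_mono) auto
  ultimately show ?thesis
    by (simp add: bump_def pos_pow_def power_mono)
qed

text \<open>A large power makes the bump a subsolution away from its centre.\<close>

lemma bump_subsolution:
  fixes y :: "real ^ 'n::finite"
  assumes "0 < r" "r < R"
  obtains p K where "p \<ge> 3" "K > 0"
    "\<And>x. 2 * bump p y R x - (\<Sum>i\<in>UNIV. bump_H p y R i x) \<le> K * indicator (ball y r) x"
proof -
  define n where "n = real CARD('n)"
  \<comment> \<open>With \<open>q = R\<^sup>2 - (norm (x - y))\<^sup>2\<close>, the term of the
    Laplacian with factor \<open>p * (p - 1)\<close> must beat those with \<open>q\<^sup>2\<close>
    and \<open>n * p * q\<close> outside \<open>ball y r\<close>. There
    \<open>(norm (x - y))\<^sup>2 \<ge> r\<^sup>2\<close> and \<open>q \<le> R\<^sup>2\<close>,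
    which leads to this threshold.\<close>
  obtain p0 :: nat where p0: "(n * R\<^sup>2 + R ^ 4) / r\<^sup>2 \<le> real p0"
    using real_arch_simple by blast
  define p where "p = p0 + 3"
  \<comment> \<open>Inside \<open>ball y r\<close> the favourable term is dropped and the others are
    bounded by their values at \<open>q = R\<^sup>2\<close>.\<close>
  define K where "K = 2 * (R\<^sup>2) ^ p + 2 * n * real p * (R\<^sup>2) ^ (p - 1)"
  have "n > 0" by (simp add: n_def)
  have "K > 0"
    using assms \<open>n > 0\<close> by (auto simp: K_def p_def intro!: add_pos_pos)
  have p1: "n * R\<^sup>2 + R ^ 4 \<le> real (p - 1) * r\<^sup>2"
  proof -
    have "n * R\<^sup>2 + R ^ 4 \<le> real p0 * r\<^sup>2"
      using p0 assms by (simp add: pos_divide_le_eq)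
    also have "\<dots> \<le> real (p - 1) * r\<^sup>2"
      by (intro mult_right_mono) (auto simp: p_def)
    finally show ?thesis .
  qed
  have "2 * bump p y R x - (\<Sum>i\<in>UNIV. bump_H p y R i x) \<le> K * indicator (ball y r) x" for x
  proof -
    define d where "d = (norm (x - y))\<^sup>2"
    define q where "q = R\<^sup>2 - d"
    have "d \<ge> 0" by (simp add: d_def)
    have lap: "2 * bump p y R x - (\<Sum>i\<in>UNIV. bump_H p y R i x) =
       2 * pos_pow p q + 2 * n * real p * pos_pow (p - 1) q - 4 * real p * real (p - 1) * pos_pow (p - 2) q * d"
      unfolding laplacian_bump by (simp add: bump_def d_def q_def n_def)
    show ?thesis
    proof (cases "q \<le> 0")
      case True
      then show ?thesis
        unfolding lap using \<open>K > 0\<close> by (simp add: pos_pow_def)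
    next
      case False
      then have q: "0 < q" "q \<le> R\<^sup>2" using \<open>d \<ge> 0\<close> by (auto simp: q_def)
      then have pp: "pos_pow j q = q ^ j" for j by (simp add: pos_pow_def)
      have pq: "q ^ p = q ^ (p - 2) * q\<^sup>2" "q ^ (p - 1) = q ^ (p - 2) * q"
        by (simp_all add: p_def numeral_3_eq_3 power2_eq_square)
      show ?thesis
      proof (cases "x \<in> ball y r")
        case True
        have "2 * q ^ p + 2 * n * real p * q ^ (p - 1) \<le> K"
          unfolding K_def using q \<open>n > 0\<close> by (intro add_mono mult_left_mono power_mono) auto
        moreover have "0 \<le> 4 * real p * real (p - 1) * q ^ (p - 2) * d"
          using q \<open>d \<ge> 0\<close> by simp
        moreover have ind: "indicator (ball y r) x = (1 :: real)"
          using True by simp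
        ultimately show ?thesis
          unfolding lap pp ind by linarith
      next
        case out: False
        then have "r \<le> norm (x - y)"
          by (simp add: dist_norm norm_minus_commute)
        then have "r\<^sup>2 \<le> d"
          unfolding d_def using assms by (intro power_mono) auto
        have "2 * q\<^sup>2 + 2 * n * real p * q \<le> 2 * (R\<^sup>2)\<^sup>2 + 2 * n * real p * R\<^sup>2"
          using q \<open>n > 0\<close> by (intro add_mono mult_left_mono power_mono) auto
        also have "\<dots> \<le> 2 * (real p * R ^ 4) + 2 * n * real p * R\<^sup>2"
          by (simp add: p_def) (simp add: algebra_simps)
        also have "\<dots> = 2 * real p * (n * R\<^sup>2 + R ^ 4)"
          by (simp add: algebra_simps)
        also have "\<dots> \<le> 2 * real p * (real (p - 1) * r\<^sup>2)"
          by (intro mult_left_mono p1) simp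
        also have "\<dots> \<le> 4 * real p * (real (p - 1) * d)"
          using \<open>r\<^sup>2 \<le> d\<close> by (intro mult_mono) auto
        finally have "q ^ (p - 2) * (2 * q\<^sup>2 + 2 * n * real p * q) \<le> q ^ (p - 2) * (4 * real p * (real (p - 1) * d))"
          using q by (intro mult_left_mono) auto
        then show ?thesis
          unfolding lap pp pq using out by (simp add: algebra_simps)
      qed
    qed
  qed
  then show ?thesis
    using that[of p K] \<open>K > 0\<close> by (simp add: p_def)
qed

section \<open>Spreading positivity through the domain\<close>

context dirichlet_domain
begin

lemma L2_indicator:
  assumes "open B"
  shows "indicator B \<in> L2_on \<Omega>"
proof (rule L2_on_bound[OF L2_on_const[OF open_bounded, of 1]])
  have "indicator B \<in> borel_measurable (borel :: (real ^ 'n) measure)"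
    using assms by (simp add: borel_open)
  then show "(indicator B :: _ \<Rightarrow> real) \<in> borel_measurable M"
    by (intro measurable_restrict_space1 measurable_completion) simp
qed (simp add: indicator_def)

lemma nonneg_seq_cong:
  assumes "nonneg_seq c" "\<And>k. c k = d k"
  shows "nonneg_seq d"
  using assms(1) by (simp add: nonneg_seq_def assms(2))

lemma nonneg_seq_coef_le:
  assumes "f \<in> L2_on \<Omega>" "g \<in> L2_on \<Omega>" "\<And>x. x \<in> \<Omega> \<Longrightarrow> f x \<le> g x"
  shows "nonneg_seq (\<lambda>k. coef g k - coef f k)"
  by (rule nonneg_seq_cong[OF nonneg_seq_coef[OF L2_on_diff[OF assms(2,1)]]])
    (simp_all add: assms coef_diff)

lemma bump_continuous: "p \<ge> 3 \<Longrightarrow> continuous_on S (bump p y R)"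
  using C2_dataD(1)[OF C2_data_bump] .

text \<open>The bump is a subsolution with right-hand side \<open>K\<close> times the indicator of
  \<open>ball y r\<close> and vanishes on the frontier, so it lies below \<open>K\<close> times the
  resolvent of that indicator; on \<open>ball y \<rho>\<close> it is at least
  \<open>(R\<^sup>2 - \<rho>\<^sup>2) ^ p\<close>. Since \<open>\<rho>\<close> may exceed
  \<open>r\<close>, positivity spreads.\<close>

lemma nonneg_seq_resolvent_ball:
  assumes "cball y R \<subseteq> \<Omega>" "0 < r" "r < R" "0 \<le> \<rho>" "\<rho> < R"
  obtains c where "c > 0"
    "\<And>z s. ball z s \<subseteq> ball y \<rho> \<Longrightarrow>
       nonneg_seq (\<lambda>k. coef (indicator (ball y r)) k / (\<mu> k + 2) - c * coef (indicator (ball z s)) k)"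
proof -
  obtain p K where p: "p \<ge> 3" "K > 0"
    "\<And>x. 2 * bump p y R x - (\<Sum>i\<in>UNIV. bump_H p y R i x) \<le> K * indicator (ball y r) x"
    using bump_subsolution[OF assms(2,3)] by metis
  define c where "c = (R\<^sup>2 - \<rho>\<^sup>2) ^ p"
  have "\<rho>\<^sup>2 < R\<^sup>2"
    using assms by (intro power_strict_mono) auto
  then have "c > 0" by (simp add: c_def)
  have cl: "continuous_on (closure \<Omega>) (bump p y R)"
    by (rule bump_continuous[OF p(1)])
  have A: "nonneg_seq (\<lambda>k. coef (\<lambda>x. K * indicator (ball y r) x) k / (\<mu> k + 2) - coef (bump p y R) k)"
  proof (rule nonneg_seq_resolvent_diff[OF _ _ C2_data_bump[OF p(1)] cl])
    show "(\<lambda>x. K * indicator (ball y r) x) \<in> L2_on \<Omega>"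
      by (intro L2_on_cmult L2_indicator) simp
    fix x assume "x \<in> frontier \<Omega>"
    then have "x \<notin> \<Omega>" using open_bounded by (simp add: frontier_def interior_open)
    then have "x \<notin> ball y R" using assms(1) ball_subset_cball by blast
    then show "bump p y R x \<le> 0" using assms by (simp add: bump_outside)
  qed (use p in auto)
  show ?thesis
  proof (rule that[of "c / K"])
    show "c / K > 0" using \<open>c > 0\<close> p by simp
    fix z s assume zs: "ball z s \<subseteq> ball y \<rho>"
    have "nonneg_seq (\<lambda>k. coef (bump p y R) k - coef (\<lambda>x. c * indicator (ball z s) x) k)"
    proof (rule nonneg_seq_coef_le)
      show "(\<lambda>x. c * indicator (ball z s) x) \<in> L2_on \<Omega>"
        by (intro L2_on_cmult L2_indicator) simp
      show "bump p y R \<in> L2_on \<Omega>"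
        by (rule L2_on_continuous_closure[OF open_bounded cl])
      show "c * indicator (ball z s) x \<le> bump p y R x" for x
        using bump_ge[OF assms(4,5), of x y p] zs bump_nonneg[of p y R x]
        by (auto simp: c_def indicator_def)
    qed
    then have "nonneg_seq (\<lambda>k. 1 / K * ((coef (\<lambda>x. K * indicator (ball y r) x) k / (\<mu> k + 2) - coef (bump p y R) k) +
        (coef (bump p y R) k - coef (\<lambda>x. c * indicator (ball z s) x) k)))"
      using p(2) by (intro nonneg_seq_cmult nonneg_seq_add A) auto
    then show "nonneg_seq (\<lambda>k. coef (indicator (ball y r)) k / (\<mu> k + 2) - c / K * coef (indicator (ball z s)) k)"
      by (rule nonneg_seq_cong) (use p(2) in \<open>simp add: coef_cmult right_diff_distrib\<close>)
  qed
qed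

text \<open>Read as \<open>(A + 2)^-m f \<ge> c\<close> near \<open>y\<close>. The power is left
  free because each passage to a neighbouring ball costs one resolvent.\<close>

definition resolvent_power_bound :: "(real ^ 'n \<Rightarrow> real) \<Rightarrow> nat \<Rightarrow> real ^ 'n \<Rightarrow> bool" where
  "resolvent_power_bound f m y \<longleftrightarrow> (\<exists>c>0. \<exists>r>0. ball y r \<subseteq> \<Omega> \<and>
     nonneg_seq (\<lambda>k. coef f k / (\<mu> k + 2) ^ m - c * coef (indicator (ball y r)) k))"

text \<open>The bound near \<open>y\<close> survives one more resolvent by positivity, and the
  resolvent of the indicator of a ball about \<open>y\<close> is bounded below on a ball about
  \<open>z\<close>.\<close>

lemma resolvent_power_bound_step:
  assumes "resolvent_power_bound f m y" "cball z (3 * e) \<subseteq> \<Omega>" "0 < e" "dist y z < e"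
  shows "resolvent_power_bound f (Suc m) z"
proof -
  obtain c r where c: "c > 0" "r > 0" "ball y r \<subseteq> \<Omega>"
    "nonneg_seq (\<lambda>k. coef f k / (\<mu> k + 2) ^ m - c * coef (indicator (ball y r)) k)"
    using assms(1) by (auto simp: resolvent_power_bound_def)
  \<comment> \<open>The ball is shrunk to stay inside the barrier of radius \<open>2 * e\<close>;
    the radii \<open>3 / 2 * e\<close> and \<open>e / 2\<close> fit because
    \<open>dist y z < e\<close>.\<close>
  define t where "t = min r e"
  have t: "0 < t" "t < 2 * e" "t \<le> r" using c assms by (auto simp: t_def)
  have "nonneg_seq (\<lambda>k. coef (indicator (ball y r)) k - coef (indicator (ball y t)) k)"
    by (rule nonneg_seq_coef_le) (use t in \<open>auto intro!: L2_indicator simp: indicator_def\<close>)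
  from nonneg_seq_add[OF c(4) nonneg_seq_cmult[OF this order.strict_implies_order[OF c(1)]]]
  have "nonneg_seq (\<lambda>k. coef f k / (\<mu> k + 2) ^ m - c * coef (indicator (ball y t)) k)"
    by (rule nonneg_seq_cong) (use c(1) in \<open>auto simp: algebra_simps\<close>)
  note 1 = nonneg_seq_resolvent[OF this zero_less_numeral[of "Num.Bit0 Num.One"]]
  have "cball y (2 * e) \<subseteq> cball z (3 * e)"
  proof
    fix x assume "x \<in> cball y (2 * e)"
    then show "x \<in> cball z (3 * e)"
      using dist_triangle[of z x y] assms(4) by (auto simp: dist_commute)
  qed
  then have "cball y (2 * e) \<subseteq> \<Omega>" using assms(2) by blast
  then obtain d where d: "d > 0"
    "\<And>z s. ball z s \<subseteq> ball y (3 / 2 * e) \<Longrightarrow>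
       nonneg_seq (\<lambda>k. coef (indicator (ball y t)) k / (\<mu> k + 2) - d * coef (indicator (ball z s)) k)"
    using nonneg_seq_resolvent_ball[of y "2 * e" t "3 / 2 * e"] t assms(3) by auto
  have "ball z (e / 2) \<subseteq> ball y (3 / 2 * e)"
  proof
    fix x assume "x \<in> ball z (e / 2)"
    then show "x \<in> ball y (3 / 2 * e)"
      using dist_triangle[of y x z] assms(4) by auto
  qed
  from nonneg_seq_add[OF 1 nonneg_seq_cmult[OF d(2)[OF this] order.strict_implies_order[OF c(1)]]]
  have "nonneg_seq (\<lambda>k. coef f k / (\<mu> k + 2) ^ Suc m - c * d * coef (indicator (ball z (e / 2))) k)"
    by (rule nonneg_seq_cong) (use c(1) in \<open>auto simp: diff_divide_distrib right_diff_distrib mult.commute\<close>)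
  moreover have "ball z (e / 2) \<subseteq> \<Omega>"
    using assms(2,3) by (auto simp: subset_iff)
  ultimately show ?thesis
    unfolding resolvent_power_bound_def using c(1) d(1) assms(3)
    by (intro exI[of _ "c * d"] exI[of _ "e / 2"] conjI) auto
qed

lemma resolvent_power_bound_init:
  assumes f: "f \<in> L2_on \<Omega>" "continuous_on \<Omega> f" "\<And>x. x \<in> \<Omega> \<Longrightarrow> 0 \<le> f x" and "y \<in> \<Omega>" "f y > 0"
  shows "resolvent_power_bound f 0 y"
proof -
  have "open {x \<in> \<Omega>. f y / 2 < f x}"
    using continuous_open_preimage[OF f(2) open_bounded(1) open_greaterThan[of "f y / 2"]]
    by (simp add: vimage_def Int_def)
  moreover have "y \<in> {x \<in> \<Omega>. f y / 2 < f x}" using assms by simp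
  ultimately obtain r where r: "r > 0" "ball y r \<subseteq> {x \<in> \<Omega>. f y / 2 < f x}"
    unfolding open_contains_ball by blast
  have "nonneg_seq (\<lambda>k. coef f k - coef (\<lambda>x. f y / 2 * indicator (ball y r) x) k)"
  proof (rule nonneg_seq_coef_le[OF _ f(1)])
    show "(\<lambda>x. f y / 2 * indicator (ball y r) x) \<in> L2_on \<Omega>"
      by (intro L2_on_cmult L2_indicator) simp
    show "f y / 2 * indicator (ball y r) x \<le> f x" if "x \<in> \<Omega>" for x
      using r(2) f(3)[OF that] by (cases "x \<in> ball y r") auto
  qed
  then have "nonneg_seq (\<lambda>k. coef f k / (\<mu> k + 2) ^ 0 - f y / 2 * coef (indicator (ball y r)) k)"
    unfolding coef_cmult by simp
  then show ?thesis
    unfolding resolvent_power_bound_def using r assms(5)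
    by (intro exI[of _ "f y / 2"] exI[of _ r] conjI) auto
qed

text \<open>Chains of balls: \<open>\<Omega>\<close> is connected.\<close>

lemma resolvent_power_bound_everywhere:
  assumes f: "f \<in> L2_on \<Omega>" "continuous_on \<Omega> f" "\<And>x. x \<in> \<Omega> \<Longrightarrow> 0 \<le> f x"
    and "y \<in> \<Omega>" "f y > 0" "z \<in> \<Omega>"
  obtains m where "resolvent_power_bound f (Suc m) z"
proof -
  have ball: "\<exists>e>0. cball x (4 * e) \<subseteq> \<Omega>" if x: "x \<in> \<Omega>" for x
  proof -
    obtain d where "d > 0" "cball x d \<subseteq> \<Omega>"
      using open_bounded(1) x open_contains_cball by blast
    then show ?thesis by (intro exI[of _ "d / 4"]) auto
  qed
  have "\<exists>m. resolvent_power_bound f m z"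
  proof (rule connected_induction_simple[where P = "\<lambda>x. \<exists>m. resolvent_power_bound f m x"])
    show "connected \<Omega>" using domain by (simp add: smooth_bounded_domain_def)
    show "\<exists>m. resolvent_power_bound f m y"
      using resolvent_power_bound_init[OF f assms(4,5)] by blast
    fix a assume "a \<in> \<Omega>"
    then obtain e where e: "e > 0" "cball a (4 * e) \<subseteq> \<Omega>" using ball by blast
    have "ball a (e / 2) \<subseteq> \<Omega>" using e by (auto simp: subset_iff)
    then have "openin (top_of_set \<Omega>) (ball a (e / 2))"
      by (simp add: openin_open_eq open_bounded(1))
    \<comment> \<open>Two points of \<open>ball a (e / 2)\<close> are less than \<open>e\<close>
      apart, and \<open>cball x' (3 * e)\<close> lies in \<open>cball a (4 * e)\<close>, so a single
      step joins them.\<close>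
    moreover have "\<exists>m. resolvent_power_bound f m x'"
      if "x \<in> ball a (e / 2)" "x' \<in> ball a (e / 2)" "\<exists>m. resolvent_power_bound f m x" for x x'
    proof -
      have "cball x' (3 * e) \<subseteq> cball a (4 * e)"
      proof
        fix w assume "w \<in> cball x' (3 * e)"
        then show "w \<in> cball a (4 * e)"
          using that(2) dist_triangle[of a w x'] e by auto
      qed
      moreover have "dist x x' < e"
        using that(1,2) dist_triangle[of x x' a] by (auto simp: dist_commute)
      ultimately have "resolvent_power_bound f (Suc m) x'" if "resolvent_power_bound f m x" for m
        using resolvent_power_bound_step[OF that _ e(1)] e(2) by blast
      then show ?thesis
        using that(3) by blast
    qed
    ultimately show "\<exists>T. openin (top_of_set \<Omega>) T \<and> a \<in> T \<and>
        (\<forall>x\<in>T. \<forall>y\<in>T. (\<exists>m. resolvent_power_bound f m x) \<longrightarrow> (\<exists>m. resolvent_power_bound f m y))"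
      using e(1) by (intro exI[of _ "ball a (e / 2)"] conjI ballI impI) (assumption | simp)+
  qed (rule assms(4,6))+
  \<comment> \<open>A last step from \<open>z\<close> to itself raises the exponent to a successor,
    as domination by a single resolvent is proved for powers \<open>Suc m\<close>.\<close>
  then obtain m where "resolvent_power_bound f m z" ..
  moreover obtain e where "e > 0" "cball z (4 * e) \<subseteq> \<Omega>" using ball[OF \<open>z \<in> \<Omega>\<close>] by blast
  moreover from this have "cball z (3 * e) \<subseteq> \<Omega>" by (auto simp: subset_iff)
  ultimately show ?thesis
    using resolvent_power_bound_step[of f m z z e] that by simp
qed

text \<open>For \<open>0 < \<tau> \<le> 1\<close> one resolvent dominates all powers of \<open>(A + 2)\<^sup>-\<^sup>1\<close>, since \<open>(A + 1)\<^sup>-\<^sup>1\<close> is their sum.\<close>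

lemma nonneg_seq_resolvent_power:
  assumes c: "nonneg_seq c" and \<tau>: "0 < \<tau>" "\<tau> \<le> 1"
  shows "nonneg_seq (\<lambda>k. c k / (\<mu> k + \<tau>) - c k / (\<mu> k + 2) ^ Suc m)"
proof (induction m)
  case 0
  \<comment> \<open>The resolvent identity for the parameters \<open>\<tau>\<close> and 2.\<close>
  have "(2 - \<tau>) * (c k / (\<mu> k + 2) / (\<mu> k + \<tau>)) = c k / (\<mu> k + \<tau>) - c k / (\<mu> k + 2) ^ Suc 0" for k
  proof -
    have "\<mu> k + 2 \<noteq> 0" "\<mu> k + \<tau> \<noteq> 0" using \<mu>_pos[of k] \<tau> by auto
    then show ?thesis by (simp add: divide_simps) algebra
  qed
  then show ?case
    using nonneg_seq_cmult[OF nonneg_seq_resolvent[OF nonneg_seq_resolvent[OF c, of 2] \<tau>(1)], of "2 - \<tau>"] \<tau>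
    by simp
next
  case (Suc m)
  \<comment> \<open>Multiplied out, the identity rests on
    \<open>\<mu> k + 2 = 1 + (\<mu> k + \<tau>) + (1 - \<tau>)\<close>; the sign of the last summand
    is where \<open>\<tau> \<le> 1\<close> enters.\<close>
  have eq: "(c k / (\<mu> k + \<tau>) - c k / (\<mu> k + 2) ^ Suc m) / (\<mu> k + 2) +
     (c k / (\<mu> k + 2) + (1 - \<tau>) * (c k / (\<mu> k + 2) / (\<mu> k + \<tau>))) =
     c k / (\<mu> k + \<tau>) - c k / (\<mu> k + 2) ^ Suc (Suc m)" for k
  proof -
    have nz: "\<mu> k + 2 \<noteq> 0" "\<mu> k + \<tau> \<noteq> 0" using \<mu>_pos[of k] \<tau> by auto
    have "c k / (\<mu> k + \<tau>) / (\<mu> k + 2) + (c k / (\<mu> k + 2) + (1 - \<tau>) * (c k / (\<mu> k + 2) / (\<mu> k + \<tau>))) =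
      c k / (\<mu> k + \<tau>)"
      using nz by (simp add: divide_simps) algebra
    moreover have "c k / (\<mu> k + 2) ^ Suc m / (\<mu> k + 2) = c k / (\<mu> k + 2) ^ Suc (Suc m)"
      by simp
    ultimately show ?thesis
      unfolding diff_divide_distrib by linarith
  qed
  have "nonneg_seq (\<lambda>k. (1 - \<tau>) * (c k / (\<mu> k + 2) / (\<mu> k + \<tau>)))"
    using \<tau> by (intro nonneg_seq_cmult nonneg_seq_resolvent c) auto
  then have "nonneg_seq (\<lambda>k. (c k / (\<mu> k + \<tau>) - c k / (\<mu> k + 2) ^ Suc m) / (\<mu> k + 2) +
     (c k / (\<mu> k + 2) + (1 - \<tau>) * (c k / (\<mu> k + 2) / (\<mu> k + \<tau>))))"
    using Suc by (intro nonneg_seq_add nonneg_seq_resolvent c) auto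
  then show ?case
    by (simp only: eq)
qed

text \<open>Uniformity in \<open>\<tau>\<close> is the point: \<open>c\<close> and \<open>r\<close>
  come from one fixed power of \<open>(A + 2)^-1\<close>, which every \<open>(A + \<tau>)^-1\<close>
  with \<open>\<tau> \<le> 1\<close> dominates on nonnegative functions.\<close>

lemma resolvent_lower_bound:
  assumes f: "f \<in> L2_on \<Omega>" "continuous_on \<Omega> f" "\<And>x. x \<in> \<Omega> \<Longrightarrow> 0 \<le> f x"
    and "y \<in> \<Omega>" "f y > 0" "z \<in> \<Omega>"
  obtains c r where "c > 0" "r > 0" "ball z r \<subseteq> \<Omega>"
    "\<And>\<tau>. 0 < \<tau> \<Longrightarrow> \<tau> \<le> 1 \<Longrightarrow>
       nonneg_seq (\<lambda>k. coef f k / (\<mu> k + \<tau>) - c * coef (indicator (ball z r)) k)"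
proof -
  obtain m where "resolvent_power_bound f (Suc m) z"
    using resolvent_power_bound_everywhere[OF assms] .
  then obtain c r where c: "c > 0" "r > 0" "ball z r \<subseteq> \<Omega>"
    "nonneg_seq (\<lambda>k. coef f k / (\<mu> k + 2) ^ Suc m - c * coef (indicator (ball z r)) k)"
    unfolding resolvent_power_bound_def by blast
  show ?thesis
  proof (rule that[OF c(1-3)])
    fix \<tau> :: real assume "0 < \<tau>" "\<tau> \<le> 1"
    moreover have "nonneg_seq (coef f)"
      by (rule nonneg_seq_coef[OF f(1)]) (rule f(3))
    ultimately have "nonneg_seq (\<lambda>k. coef f k / (\<mu> k + \<tau>) - coef f k / (\<mu> k + 2) ^ Suc m)"
      using nonneg_seq_resolvent_power by blast
    from nonneg_seq_add[OF this c(4)]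
    show "nonneg_seq (\<lambda>k. coef f k / (\<mu> k + \<tau>) - c * coef (indicator (ball z r)) k)"
      by (rule nonneg_seq_cong) auto
  qed
qed

end

subsection \<open>Fractional powers as integrals of resolvents\<close>

lemma has_bochner_integral_nonneg_has_integral:
  fixes f :: "real \<Rightarrow> real"
  assumes "(f has_integral I) S" "S \<in> sets borel" "f \<in> borel_measurable borel"
    "\<And>x. x \<in> S \<Longrightarrow> 0 \<le> f x"
  shows "has_bochner_integral lborel (\<lambda>x. indicator S x * f x) I"
proof -
  have "f absolutely_integrable_on S"
    using assms(1,4) by (intro nonnegative_absolutely_integrable_1) (auto simp: has_integral_integrable)
  then have "integrable lebesgue (\<lambda>x. indicator S x * f x)"
    "(\<integral>x. indicator S x * f x \<partial>lebesgue) = I"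
    using set_lebesgue_integral_eq_integral(2)[of S f] assms(1)
    by (auto simp: set_integrable_def set_lebesgue_integral_def integral_unique)
  moreover have "(\<lambda>x. indicator S x * f x) \<in> borel_measurable lborel"
    using assms(2,3) by measurable
  ultimately show ?thesis
    by (simp add: has_bochner_integral_iff integrable_completion integral_completion)
qed

lemma has_bochner_integral_powr_from_0:
  fixes a T :: real
  assumes "a > -1" "T \<ge> 0"
  shows "has_bochner_integral lborel (\<lambda>t. indicator {0..T} t * t powr a) (T powr (a + 1) / (a + 1))"
  by (rule has_bochner_integral_nonneg_has_integral[OF has_integral_powr_from_0[OF assms]]) auto

lemma has_bochner_integral_powr_to_inf:
  fixes a T :: real
  assumes "a < -1" "T > 0"
  shows "has_bochner_integral lborel (\<lambda>t. indicator {T..} t * t powr a) (- (T powr (a + 1)) / (a + 1))"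
  by (rule has_bochner_integral_nonneg_has_integral[OF has_integral_powr_to_inf[OF assms]]) auto

text \<open>The kernel of the representation
  \<open>C m\<^sup>\<sigma> = \<integral>\<^sub>0\<^sup>\<infinity> \<tau>\<^sup>\<sigma>\<^sup>-\<^sup>1 m / (m + \<tau>) d\<tau>\<close> of a fractional power by resolvents.\<close>

definition stieltjes :: "real \<Rightarrow> real \<Rightarrow> real \<Rightarrow> real" where
  "stieltjes \<sigma> m t = indicator {0<..} t * (t powr (\<sigma> - 1) * (m / (m + t)))"

text \<open>For \<open>0 < \<sigma> < 1\<close> this is \<open>pi / sin (pi * \<sigma>)\<close>; the
  argument relies on its positivity, not on its value.\<close>

definition stieltjes_const :: "real \<Rightarrow> real" where
  "stieltjes_const \<sigma> = (\<integral>t. stieltjes \<sigma> 1 t \<partial>lborel)"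

lemma stieltjes_nonneg: "0 < m \<Longrightarrow> 0 \<le> stieltjes \<sigma> m t"
  by (simp add: stieltjes_def indicator_def)

lemma stieltjes_measurable [measurable]: "stieltjes \<sigma> m \<in> borel_measurable borel"
  unfolding stieltjes_def by measurable

lemma stieltjes_one:
  assumes "0 < \<sigma>" "\<sigma> < 1"
  shows "integrable lborel (stieltjes \<sigma> 1)" "stieltjes_const \<sigma> > 0"
proof -
  let ?g = "\<lambda>t. indicator {0..1} t * t powr (\<sigma> - 1) + indicator {1..} t * t powr (\<sigma> - 2)"
  have g: "integrable lborel ?g"
    using has_bochner_integral_powr_from_0[of "\<sigma> - 1" 1] has_bochner_integral_powr_to_inf[of "\<sigma> - 2" 1] assms
    by (auto simp: has_bochner_integral_iff)
  have le: "stieltjes \<sigma> 1 t \<le> ?g t" for t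
  proof -
    consider "t \<le> 0" | "0 < t" "t \<le> 1" | "1 < t" by linarith
    then show ?thesis
    proof cases
      case 2
      then have "t powr (\<sigma> - 1) * (1 / (1 + t)) \<le> t powr (\<sigma> - 1) * 1"
        by (intro mult_left_mono) auto
      then show ?thesis using 2 by (auto simp: stieltjes_def indicator_def)
    next
      case 3
      have "t powr (\<sigma> - 1) * (1 / (1 + t)) \<le> t powr (\<sigma> - 1) * (1 / t)"
        using 3 by (intro mult_left_mono) (auto simp: field_simps)
      also have "\<dots> = t powr (\<sigma> - 2)"
        using 3 powr_diff[of t "\<sigma> - 1" 1] by simp
      finally show ?thesis using 3 by (auto simp: stieltjes_def indicator_def)
    qed (auto simp: stieltjes_def indicator_def)
  qed
  show int: "integrable lborel (stieltjes \<sigma> 1)"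
    by (rule Bochner_Integration.integrable_bound[OF g])
      (use le stieltjes_nonneg[of 1 \<sigma>] in \<open>auto intro!: AE_I2 order.trans[OF le abs_ge_self]\<close>)
  have "0 \<le> stieltjes_const \<sigma>"
    unfolding stieltjes_const_def by (intro Bochner_Integration.integral_nonneg stieltjes_nonneg) simp
  moreover have "stieltjes_const \<sigma> \<noteq> 0"
  proof
    assume "stieltjes_const \<sigma> = 0"
    then have "AE t in lborel. stieltjes \<sigma> 1 t = 0"
      using integral_nonneg_eq_0_iff_AE[OF int] stieltjes_nonneg[of 1 \<sigma>]
      by (simp add: stieltjes_const_def)
    then have "AE t in lborel. t \<notin> {0<..<1::real}"
      by (rule AE_mp) (auto intro!: AE_I2 simp: stieltjes_def)
    then have "{0<..<1::real} \<in> null_sets lborel"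
      by (subst AE_iff_null_sets) auto
    then show False by (simp add: null_sets_def)
  qed
  ultimately show "stieltjes_const \<sigma> > 0" by simp
qed

text \<open>The substitution \<open>t = m * r\<close> reduces the claim to
  \<open>m = 1\<close>.\<close>

lemma stieltjes_integral:
  assumes "0 < \<sigma>" "\<sigma> < 1" "m > 0"
  shows "has_bochner_integral lborel (stieltjes \<sigma> m) (stieltjes_const \<sigma> * m powr \<sigma>)"
proof -
  have scale: "stieltjes \<sigma> m t = m powr (\<sigma> - 1) * stieltjes \<sigma> 1 (0 + (1 / m) * t)" for t
  proof (cases "t > 0")
    case True
    have "m powr (\<sigma> - 1) * (1 / m * t) powr (\<sigma> - 1) = t powr (\<sigma> - 1)"
      using assms True by (simp add: powr_mult[symmetric])
    moreover have "m / (m + t) = 1 / (1 + 1 / m * t)"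
      using assms True by (simp add: field_simps)
    ultimately show ?thesis
      using True assms by (simp add: stieltjes_def)
  next
    case False
    then show ?thesis using assms by (simp add: stieltjes_def zero_less_divide_iff)
  qed
  have int: "integrable lborel (\<lambda>t. stieltjes \<sigma> 1 (0 + (1 / m) * t))"
    by (rule lborel_integrable_real_affine[OF stieltjes_one(1)[OF assms(1,2)]]) (use assms in simp)
  have "stieltjes_const \<sigma> = \<bar>1 / m\<bar> *\<^sub>R (\<integral>t. stieltjes \<sigma> 1 (0 + (1 / m) * t) \<partial>lborel)"
    unfolding stieltjes_const_def by (rule lborel_integral_real_affine) (use assms in simp)
  then have "(\<integral>t. stieltjes \<sigma> 1 (0 + (1 / m) * t) \<partial>lborel) = m * stieltjes_const \<sigma>"
    using assms by (simp add: field_simps)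
  moreover have "m powr (\<sigma> - 1) * m = m powr \<sigma>"
    using assms powr_add[of m "\<sigma> - 1" 1] by simp
  ultimately show ?thesis
    unfolding has_bochner_integral_iff scale[abs_def]
    using int by (simp add: mult_ac)
qed

text \<open>Sum and integral are exchanged by absolute convergence: term \<open>k\<close> has L1
  norm \<open>stieltjes_const \<sigma> * \<mu> k powr \<sigma> * \<bar>d k\<bar>\<close>, summable
  by the second hypothesis on \<open>d\<close>, while the first gives convergence at each fixed
  \<open>t\<close>.\<close>

lemma stieltjes_sum:
  fixes \<mu> d :: "nat \<Rightarrow> real"
  assumes \<sigma>: "0 < \<sigma>" "\<sigma> < 1" and \<mu>: "\<And>k. \<mu> k > 0"
    and d: "summable (\<lambda>k. \<bar>d k\<bar>)" "summable (\<lambda>k. \<mu> k powr \<sigma> * \<bar>d k\<bar>)"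
  shows "has_bochner_integral lborel
    (\<lambda>t. indicator {0<..} t * (t powr (\<sigma> - 1) * (\<Sum>k. \<mu> k / (\<mu> k + t) * d k)))
    (stieltjes_const \<sigma> * (\<Sum>k. \<mu> k powr \<sigma> * d k))"
proof -
  define F where "F k t = stieltjes \<sigma> (\<mu> k) t * d k" for k t
  have F: "has_bochner_integral lborel (F k) (stieltjes_const \<sigma> * \<mu> k powr \<sigma> * d k)" for k
    unfolding F_def[abs_def] by (intro has_bochner_integral_mult_left stieltjes_integral \<sigma> \<mu>)
  have nF: "has_bochner_integral lborel (\<lambda>t. norm (F k t)) (stieltjes_const \<sigma> * \<mu> k powr \<sigma> * \<bar>d k\<bar>)" for k
  proof -
    have "(\<lambda>t. norm (F k t)) = (\<lambda>t. stieltjes \<sigma> (\<mu> k) t * \<bar>d k\<bar>)"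
      using stieltjes_nonneg[OF \<mu>] by (auto simp: F_def abs_mult)
    then show ?thesis
      using has_bochner_integral_mult_left[OF stieltjes_integral[OF \<sigma> \<mu>[of k]], of "\<bar>d k\<bar>"] by simp
  qed
  have sd: "summable (\<lambda>k. \<bar>\<mu> k / (\<mu> k + t) * d k\<bar>)" if "t > 0" for t
  proof (rule summable_comparison_test'[OF d(1)])
    have "\<bar>\<mu> k / (\<mu> k + t)\<bar> \<le> 1" for k
      using \<mu>[of k] that by simp
    then show "norm \<bar>\<mu> k / (\<mu> k + t) * d k\<bar> \<le> \<bar>d k\<bar>" for k
      using mult_right_mono[of _ 1 "\<bar>d k\<bar>"] by (simp only: real_norm_def abs_abs abs_mult mult_1 abs_ge_zero)
  qed
  have Feq: "F k t = indicator {0<..} t * (t powr (\<sigma> - 1) * (\<mu> k / (\<mu> k + t) * d k))" for k t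
    by (simp add: F_def stieltjes_def)
  have s1: "summable (\<lambda>k. norm (F k t))" for t
    using summable_mult[OF sd, of t "t powr (\<sigma> - 1)"]
    by (cases "t > 0") (simp_all add: Feq abs_mult mult.assoc)
  have s2: "summable (\<lambda>k. \<integral>t. norm (F k t) \<partial>lborel)"
    using nF summable_mult[OF d(2), of "stieltjes_const \<sigma>"]
    by (simp add: has_bochner_integral_iff mult.assoc)
  have iF: "integrable lborel (F k)" for k
    using F by (simp add: has_bochner_integral_iff)
  have "(\<integral>t. (\<Sum>k. F k t) \<partial>lborel) = (\<Sum>k. \<integral>t. F k t \<partial>lborel)"
    by (rule integral_suminf[OF iF], rule AE_I2, rule s1, rule s2)
  also have "\<dots> = (\<Sum>k. stieltjes_const \<sigma> * (\<mu> k powr \<sigma> * d k))"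
    using F by (simp add: has_bochner_integral_iff mult.assoc)
  also have "\<dots> = stieltjes_const \<sigma> * (\<Sum>k. \<mu> k powr \<sigma> * d k)"
  proof (rule suminf_mult)
    show "summable (\<lambda>k. \<mu> k powr \<sigma> * d k)"
      by (rule summable_rabs_cancel) (use d(2) in \<open>simp add: abs_mult\<close>)
  qed
  finally have 1: "(\<integral>t. (\<Sum>k. F k t) \<partial>lborel) = stieltjes_const \<sigma> * (\<Sum>k. \<mu> k powr \<sigma> * d k)" .
  have 2: "integrable lborel (\<lambda>t. \<Sum>k. F k t)"
    by (rule integrable_suminf[OF iF], rule AE_I2, rule s1, rule s2)
  have 3: "(\<Sum>k. F k t) = indicator {0<..} t * (t powr (\<sigma> - 1) * (\<Sum>k. \<mu> k / (\<mu> k + t) * d k))" for t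
  proof (cases "t > 0")
    case True
    then show ?thesis
      using suminf_mult[OF summable_rabs_cancel[OF sd[OF True]], of "t powr (\<sigma> - 1)"]
      by (simp add: Feq)
  qed (simp add: Feq)
  show ?thesis
    using 1 2 unfolding 3 has_bochner_integral_iff by simp
qed

text \<open>The integral over \<open>\<tau>\<close> is split at \<open>1\<close> and \<open>T\<close>.\<close>

lemma stieltjes_sum_upper_bound:
  fixes \<mu> d :: "nat \<Rightarrow> real"
  assumes \<sigma>: "0 < \<sigma>" "\<sigma> < 1" and \<mu>: "\<And>k. \<mu> k > 0"
    and d: "summable (\<lambda>k. \<bar>d k\<bar>)" "summable (\<lambda>k. \<mu> k powr \<sigma> * \<bar>d k\<bar>)"
    and h: "\<And>t. 0 < t \<Longrightarrow> (\<Sum>k. \<mu> k / (\<mu> k + t) * d k) \<le> \<epsilon>"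
      "\<And>t. 0 < t \<Longrightarrow> t \<le> 1 \<Longrightarrow> (\<Sum>k. \<mu> k / (\<mu> k + t) * d k) \<le> \<epsilon> - \<kappa> * t"
      "\<And>t. 0 < t \<Longrightarrow> (\<Sum>k. \<mu> k / (\<mu> k + t) * d k) \<le> B / t"
    and "0 \<le> \<epsilon>" "0 \<le> B" "1 \<le> T"
  shows "stieltjes_const \<sigma> * (\<Sum>k. \<mu> k powr \<sigma> * d k) \<le>
    \<epsilon> * (T powr \<sigma> / \<sigma>) - \<kappa> / (\<sigma> + 1) + B * (T powr (\<sigma> - 1) / (1 - \<sigma>))"
proof -
  let ?h = "\<lambda>t. \<Sum>k. \<mu> k / (\<mu> k + t) * d k"
  let ?L = "\<lambda>t. indicator {0<..} t * (t powr (\<sigma> - 1) * ?h t)"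
  \<comment> \<open>Up to \<open>T\<close> the bound \<open>\<epsilon>\<close> is used, improved by
    \<open>\<kappa> * t\<close> up to 1; beyond \<open>T\<close> it is \<open>B / t\<close>. At
    \<open>t = T\<close> two terms overlap, harmlessly since both are nonnegative.\<close>
  let ?R = "\<lambda>t. \<epsilon> * (indicator {0..T} t * t powr (\<sigma> - 1)) - \<kappa> * (indicator {0..1} t * t powr \<sigma>)
     + B * (indicator {T..} t * t powr (\<sigma> - 2))"
  have R: "has_bochner_integral lborel ?R (\<epsilon> * (T powr (\<sigma> - 1 + 1) / (\<sigma> - 1 + 1)) -
      \<kappa> * (1 powr (\<sigma> + 1) / (\<sigma> + 1)) + B * (- (T powr (\<sigma> - 2 + 1)) / (\<sigma> - 2 + 1)))"
    by (intro has_bochner_integral_add has_bochner_integral_diff has_bochner_integral_mult_right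
        has_bochner_integral_powr_from_0 has_bochner_integral_powr_to_inf) (use assms in auto)
  have L: "has_bochner_integral lborel ?L (stieltjes_const \<sigma> * (\<Sum>k. \<mu> k powr \<sigma> * d k))"
    by (rule stieltjes_sum[OF \<sigma> \<mu> d])
  have le: "?L t \<le> ?R t" for t
  proof -
    define z where "z = ?h t"
    have hz: "0 < t \<Longrightarrow> z \<le> \<epsilon>" "0 < t \<Longrightarrow> t \<le> 1 \<Longrightarrow> z \<le> \<epsilon> - \<kappa> * t" "0 < t \<Longrightarrow> z \<le> B / t"
      unfolding z_def by (fact h)+
    have nn: "0 \<le> \<epsilon> * (indicator {0..T} t * t powr (\<sigma> - 1))" "0 \<le> B * (indicator {T..} t * t powr (\<sigma> - 2))"
      using assms by auto
    consider "t \<le> 0" | "0 < t" "t \<le> 1" | "1 < t" "t \<le> T" | "T < t" by linarith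
    then have "indicator {0<..} t * (t powr (\<sigma> - 1) * z) \<le> ?R t"
    proof cases
      case 1
      \<comment> \<open>At \<open>t = 0\<close> every power is zero, because
        \<open>0 powr a = 0\<close>.\<close>
      then show ?thesis using nn \<sigma> by (cases "t = 0") auto
    next
      case 2
      have "t powr (\<sigma> - 1) * z \<le> t powr (\<sigma> - 1) * (\<epsilon> - \<kappa> * t)"
        using 2 hz(2) by (intro mult_left_mono) auto
      also have "\<dots> = \<epsilon> * t powr (\<sigma> - 1) - \<kappa> * t powr \<sigma>"
        using 2 powr_add[of t "\<sigma> - 1" 1] by (simp add: algebra_simps)
      finally show ?thesis using 2 nn \<open>1 \<le> T\<close> by simp
    next
      case 3
      have "t powr (\<sigma> - 1) * z \<le> t powr (\<sigma> - 1) * \<epsilon>"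
        using 3 hz(1) by (intro mult_left_mono) auto
      also have "\<dots> = \<epsilon> * t powr (\<sigma> - 1)"
        by simp
      finally have A: "t powr (\<sigma> - 1) * z \<le> \<epsilon> * t powr (\<sigma> - 1)" .
      have ind: "indicator {0<..} t = (1 :: real)" "indicator {0..T} t = (1 :: real)" "indicator {0..1} t = (0 :: real)"
        using 3 by auto
      show ?thesis unfolding ind using A nn(2) by linarith
    next
      case 4
      have "t powr (\<sigma> - 1) * z \<le> t powr (\<sigma> - 1) * (B / t)"
        using 4 hz(3) \<open>1 \<le> T\<close> by (intro mult_left_mono) auto
      also have "\<dots> = B * t powr (\<sigma> - 2)"
        using 4 \<open>1 \<le> T\<close> powr_diff[of t "\<sigma> - 1" 1] by simp
      finally show ?thesis using 4 nn \<open>1 \<le> T\<close> by simp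
    qed
    then show ?thesis unfolding z_def .
  qed
  have "stieltjes_const \<sigma> * (\<Sum>k. \<mu> k powr \<sigma> * d k) \<le> \<epsilon> * (T powr (\<sigma> - 1 + 1) / (\<sigma> - 1 + 1)) -
      \<kappa> * (1 powr (\<sigma> + 1) / (\<sigma> + 1)) + B * (- (T powr (\<sigma> - 2 + 1)) / (\<sigma> - 2 + 1))"
    using integral_mono[of lborel ?L ?R] L R le by (simp only: has_bochner_integral_iff)
  moreover have e: "- (T powr (\<sigma> - 2 + 1)) / (\<sigma> - 2 + 1) = T powr (\<sigma> - 1) / (1 - \<sigma>)"
    using minus_divide_divide[of "T powr (\<sigma> - 1)" "1 - \<sigma>"] by (simp add: algebra_simps)
  ultimately show ?thesis
    unfolding e by simp
qed

subsection \<open>The sign of the Laplacian\<close>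

context dirichlet_domain
begin

text \<open>Green's identity against \<open>\<phi> k\<close>: the compact support of
  \<open>b\<close> excludes boundary terms, so on coefficients \<open>- \<Delta> b\<close> agrees
  with \<open>A b\<close>.\<close>

lemma coef_laplacian:
  assumes b: "C2_data \<Omega> b G H" and K: "compact K" "K \<subseteq> \<Omega>" "\<And>x. x \<in> \<Omega> - K \<Longrightarrow> b x = 0"
  shows "coef (\<lambda>x. \<Sum>i\<in>UNIV. H i x) k = - \<mu> k * coef b k"
proof -
  have "coef (\<lambda>x. \<Sum>i\<in>UNIV. H i x) k = (\<integral>x. \<phi> k x * (\<Sum>i\<in>UNIV. H i x) \<partial>M)"
    by (simp add: coef_def mult.commute)
  also have "\<dots> = (\<integral>x. b x * (\<Sum>i\<in>UNIV. partial_deriv i (partial_deriv i (\<phi> k)) x) \<partial>M)"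
    by (rule green_identity[OF open_bounded(1) \<phi>_C2 b K])
  also have "\<dots> = (\<integral>x. - \<mu> k * (b x * \<phi> k x) \<partial>M)"
    by (rule Bochner_Integration.integral_cong) (simp_all add: \<phi>_eq)
  also have "\<dots> = - \<mu> k * coef b k"
    unfolding coef_def by (rule Bochner_Integration.integral_mult_right_zero)
  finally show ?thesis .
qed

lemma compact_superlevel:
  fixes u :: "real ^ 'n \<Rightarrow> real"
  assumes u: "continuous_on (closure \<Omega>) u" "\<And>x. x \<in> frontier \<Omega> \<Longrightarrow> u x < \<gamma>"
  shows "compact (closure \<Omega> \<inter> u -` {\<gamma>..})" "closure \<Omega> \<inter> u -` {\<gamma>..} \<subseteq> \<Omega>"
proof -
  have "closed (closure \<Omega> \<inter> u -` {\<gamma>..})"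
    using continuous_closed_preimage[OF u(1) closed_closure closed_atLeast] .
  then show "compact (closure \<Omega> \<inter> u -` {\<gamma>..})"
    unfolding compact_eq_bounded_closed
    using open_bounded(2) by (auto intro: bounded_subset[of "closure \<Omega>"])
  show "closure \<Omega> \<inter> u -` {\<gamma>..} \<subseteq> \<Omega>"
  proof
    fix x assume x: "x \<in> closure \<Omega> \<inter> u -` {\<gamma>..}"
    then have "x \<notin> frontier \<Omega>" using u(2)[of x] by auto
    then show "x \<in> \<Omega>"
      using x open_bounded(1) by (auto simp: frontier_def interior_open)
  qed
qed

text \<open>By convexity, \<open>- \<Delta> (u - \<gamma>)\<^sub>+\<close> is bounded above by a constant, and the maximum principle
  transfers this bound to \<open>A (A + \<tau>)\<^sup>-\<^sup>1 (u - \<gamma>)\<^sub>+\<close>.\<close>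

lemma resolvent_upper_bound:
  assumes u: "C2_data \<Omega> u G H" "continuous_on (closure \<Omega>) u" "\<And>x. x \<in> frontier \<Omega> \<Longrightarrow> u x = 0"
    and "\<gamma> > 0" "lam > 0"
  defines "f \<equiv> \<lambda>x. lam * max (u x - \<gamma>) 0"
  obtains B where "B \<ge> 0"
    "\<And>\<tau>. \<tau> > 0 \<Longrightarrow> nonneg_seq (\<lambda>k. coef (\<lambda>_. B / \<tau>) k - \<mu> k / (\<mu> k + \<tau>) * coef f k)"
proof -
  define K where "K = closure \<Omega> \<inter> u -` {\<gamma>..}"
  have K: "compact K" "K \<subseteq> \<Omega>"
    unfolding K_def using compact_superlevel[OF u(2), of \<gamma>] u(3) \<open>\<gamma> > 0\<close> by auto
  \<comment> \<open>No bound for \<open>\<Delta> u\<close> up to the frontier is at hand; its values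
    on the compact set \<open>K\<close> suffice, since
    \<open>ramp' \<epsilon> (u x - \<gamma>)\<close> vanishes where
    \<open>u x \<le> \<gamma>\<close>.\<close>
  have "continuous_on K (\<lambda>x. \<Sum>i\<in>UNIV. H i x)"
    by (intro continuous_intros continuous_on_subset[OF C2_dataD(3)[OF u(1)] K(2)])
  then have "bounded ((\<lambda>x. \<Sum>i\<in>UNIV. H i x) ` K)"
    using K(1) by (intro compact_imp_bounded compact_continuous_image)
  then obtain B0 where B0: "B0 > 0" "\<And>x. x \<in> K \<Longrightarrow> \<bar>\<Sum>i\<in>UNIV. H i x\<bar> \<le> B0"
    unfolding bounded_pos by auto
  define B where "B = lam * B0"
  have B: "B > 0" using B0 \<open>lam > 0\<close> by (simp add: B_def)
  have fc: "continuous_on (closure \<Omega>) f"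
    unfolding f_def by (intro continuous_intros u)
  have fL2: "f \<in> L2_on \<Omega>"
    by (rule L2_on_continuous_closure[OF open_bounded fc])
  show ?thesis
  proof (rule that[of "B + 1"])
    fix \<tau> :: real assume "\<tau> > 0"
    \<comment> \<open>The width depends on \<open>\<tau>\<close> so that the smoothing error
      \<open>2 * lam * \<epsilon>\<close> equals \<open>1 / \<tau>\<close>, the order of the bound
      itself; it accounts for the 1 in \<open>B + 1\<close>.\<close>
    define \<epsilon> where "\<epsilon> = 1 / (2 * lam * \<tau>)"
    have \<epsilon>: "\<epsilon> > 0" "2 * lam * \<epsilon> = 1 / \<tau>"
      using \<open>\<tau> > 0\<close> \<open>lam > 0\<close> by (auto simp: \<epsilon>_def)
    define b where "b x = lam * ramp \<epsilon> (u x - \<gamma>)" for x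
    define Gb where "Gb i x = lam * (ramp' \<epsilon> (u x - \<gamma>) * (G i x - 0))" for i x
    define Hb where "Hb i x = lam * (ramp'' \<epsilon> (u x - \<gamma>) * (G i x - 0)\<^sup>2 + ramp' \<epsilon> (u x - \<gamma>) * (H i x - 0))" for i x
    have b2: "C2_data \<Omega> b Gb Hb"
      unfolding b_def[abs_def] Gb_def[abs_def] Hb_def[abs_def]
      by (intro C2_data_cmult C2_data_compose[OF C2_data_diff[OF u(1) C2_data_const]]
          ramp_deriv ramp'_deriv continuous_on_ramp'' \<epsilon>)
    have bc: "continuous_on (closure \<Omega>) b"
      unfolding b_def[abs_def]
      by (intro continuous_on_mult_left continuous_on_compose2[OF DERIV_continuous_on[OF has_field_derivative_at_within[OF ramp_deriv[OF \<epsilon>(1)]], of UNIV]]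
          continuous_intros u) simp
    have bL2: "b \<in> L2_on \<Omega>"
      by (rule L2_on_continuous_closure[OF open_bounded bc])
    have lap: "- (\<Sum>i\<in>UNIV. Hb i x) \<le> B" if "x \<in> \<Omega>" for x
    proof -
      have "(\<Sum>i\<in>UNIV. Hb i x) = lam * (\<Sum>i\<in>UNIV. ramp'' \<epsilon> (u x - \<gamma>) * (G i x)\<^sup>2)
          + lam * (ramp' \<epsilon> (u x - \<gamma>) * (\<Sum>i\<in>UNIV. H i x))"
        by (simp add: Hb_def sum.distrib sum_distrib_left distrib_left)
      moreover have "0 \<le> lam * (\<Sum>i\<in>UNIV. ramp'' \<epsilon> (u x - \<gamma>) * (G i x)\<^sup>2)"
        using \<open>lam > 0\<close> ramp''_nonneg[OF \<epsilon>(1)] by (intro mult_nonneg_nonneg sum_nonneg) auto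
      moreover have "lam * (- B0) \<le> lam * (ramp' \<epsilon> (u x - \<gamma>) * (\<Sum>i\<in>UNIV. H i x))"
      proof (intro mult_left_mono)
        show "- B0 \<le> ramp' \<epsilon> (u x - \<gamma>) * (\<Sum>i\<in>UNIV. H i x)"
        proof (cases "x \<in> K")
          case True
          have "\<bar>ramp' \<epsilon> (u x - \<gamma>) * (\<Sum>i\<in>UNIV. H i x)\<bar> \<le> 1 * B0"
            unfolding abs_mult using B0(2)[OF True] ramp'_nonneg[OF \<epsilon>(1)] ramp'_le_1[OF \<epsilon>(1)]
            by (intro mult_mono) auto
          then show ?thesis by linarith
        next
          case False
          then have "u x - \<gamma> \<le> 0" using that closure_subset by (auto simp: K_def)
          then show ?thesis using B0 by (simp add: ramp'_def)
        qed
      qed (use \<open>lam > 0\<close> in simp)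
      ultimately show ?thesis by (simp add: B_def)
    qed
    \<comment> \<open>Because \<open>- \<Delta> b \<le> B\<close>, the function
      \<open>b / \<tau> - B / \<tau>\<^sup>2\<close> is a subsolution for the right-hand side
      \<open>b\<close>. Multiplied by \<open>\<tau>\<close>, the comparison says
      \<open>A (A + \<tau>)^-1 b \<le> B / \<tau>\<close>.\<close>
    have r: "nonneg_seq (\<lambda>k. coef b k / (\<mu> k + \<tau>) - coef (\<lambda>x. 1 / \<tau> * b x - B / \<tau>\<^sup>2) k)"
    proof (rule nonneg_seq_resolvent_diff[OF bL2 \<open>\<tau> > 0\<close>])
      show "C2_data \<Omega> (\<lambda>x. 1 / \<tau> * b x - B / \<tau>\<^sup>2) (\<lambda>i x. 1 / \<tau> * Gb i x - 0) (\<lambda>i x. 1 / \<tau> * Hb i x - 0)"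
        by (intro C2_data_diff C2_data_cmult b2 C2_data_const)
      show "continuous_on (closure \<Omega>) (\<lambda>x. 1 / \<tau> * b x - B / \<tau>\<^sup>2)"
        by (intro continuous_intros bc)
      show "1 / \<tau> * b x - B / \<tau>\<^sup>2 \<le> 0" if "x \<in> frontier \<Omega>" for x
        using u(3)[OF that] \<open>\<gamma> > 0\<close> B by (simp add: b_def ramp_def)
      fix x assume x: "x \<in> \<Omega>"
      have "\<tau> * (1 / \<tau> * b x - B / \<tau>\<^sup>2) - (\<Sum>i\<in>UNIV. 1 / \<tau> * Hb i x - 0) =
        b x - (B - (- (\<Sum>i\<in>UNIV. Hb i x))) / \<tau>"
        using \<open>\<tau> > 0\<close> by (simp add: sum_divide_distrib[symmetric] field_simps power2_eq_square)
      also have "\<dots> \<le> b x"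
        using lap[OF x] \<open>\<tau> > 0\<close> by simp
      finally show "\<tau> * (1 / \<tau> * b x - B / \<tau>\<^sup>2) - (\<Sum>i\<in>UNIV. 1 / \<tau> * Hb i x - 0) \<le> b x" .
    qed
    have fb: "b x \<le> f x" "f x \<le> b x + 1 / \<tau>" for x
    proof -
      show "b x \<le> f x"
        unfolding b_def f_def using \<open>lam > 0\<close> ramp_le[OF \<epsilon>(1)] by simp
      have "f x \<le> lam * (ramp \<epsilon> (u x - \<gamma>) + 2 * \<epsilon>)"
        unfolding f_def using \<open>lam > 0\<close> ramp_ge[OF \<epsilon>(1), of "u x - \<gamma>"] by (intro mult_left_mono) auto
      then show "f x \<le> b x + 1 / \<tau>"
        using \<epsilon>(2) by (simp add: b_def distrib_left mult_ac)
    qed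
    have c1: "(\<lambda>_. c) \<in> L2_on \<Omega>" for c :: real
      by (rule L2_on_const[OF open_bounded])
    \<comment> \<open>Passage from \<open>b\<close> to \<open>f\<close> in
      \<open>f - \<tau> (A + \<tau>)^-1 f\<close>: the first term exceeds \<open>b\<close> by at
      most \<open>1 / \<tau>\<close>, and the subtracted resolvent only grows because
      \<open>b \<le> f\<close>.\<close>
    have n1: "nonneg_seq (\<lambda>k. coef (\<lambda>x. b x + 1 / \<tau>) k - coef f k)"
      by (rule nonneg_seq_coef_le) (use fb L2_on_add[OF bL2 c1] fL2 in auto)
    have n2: "nonneg_seq (\<lambda>k. \<tau> * ((coef f k - coef b k) / (\<mu> k + \<tau>)))"
      by (intro nonneg_seq_cmult nonneg_seq_resolvent nonneg_seq_coef_le)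
        (use fb bL2 fL2 \<open>\<tau> > 0\<close> in auto)
    have "nonneg_seq (\<lambda>k. \<tau> * (coef b k / (\<mu> k + \<tau>) - coef (\<lambda>x. 1 / \<tau> * b x - B / \<tau>\<^sup>2) k) +
       ((coef (\<lambda>x. b x + 1 / \<tau>) k - coef f k) + \<tau> * ((coef f k - coef b k) / (\<mu> k + \<tau>))))"
      using \<open>\<tau> > 0\<close> by (intro nonneg_seq_add nonneg_seq_cmult r n1 n2) auto
    then show "nonneg_seq (\<lambda>k. coef (\<lambda>_. (B + 1) / \<tau>) k - \<mu> k / (\<mu> k + \<tau>) * coef f k)"
    proof (rule nonneg_seq_cong)
      fix k
      have one: "coef (\<lambda>_. c) k = c * coef (\<lambda>_. 1) k" for c
        using coef_cmult[of c "\<lambda>_. 1" k] by simp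
      have e1: "coef (\<lambda>x. 1 / \<tau> * b x - B / \<tau>\<^sup>2) k = 1 / \<tau> * coef b k - B / \<tau>\<^sup>2 * coef (\<lambda>_. 1) k"
        unfolding coef_diff[OF L2_on_cmult[OF bL2] c1] coef_cmult one[of "B / \<tau>\<^sup>2"] ..
      have e2: "coef (\<lambda>x. b x + 1 / \<tau>) k = coef b k + 1 / \<tau> * coef (\<lambda>_. 1) k"
        unfolding coef_add[OF bL2 c1] one[of "1 / \<tau>"] ..
      have nz: "\<mu> k + \<tau> \<noteq> 0" using \<mu>_pos[of k] \<open>\<tau> > 0\<close> by simp
      show "\<tau> * (coef b k / (\<mu> k + \<tau>) - coef (\<lambda>x. 1 / \<tau> * b x - B / \<tau>\<^sup>2) k) +
         ((coef (\<lambda>x. b x + 1 / \<tau>) k - coef f k) + \<tau> * ((coef f k - coef b k) / (\<mu> k + \<tau>))) =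
         coef (\<lambda>_. (B + 1) / \<tau>) k - \<mu> k / (\<mu> k + \<tau>) * coef f k"
        unfolding e1 e2 one[of "(B + 1) / \<tau>"] using nz \<open>\<tau> > 0\<close>
        by (simp add: divide_simps power2_eq_square) algebra
    qed
  qed (use B in simp)
qed

section \<open>Pairing with a bump\<close>

lemma resolvent_pairing_le:
  assumes n: "nonneg_seq (\<lambda>k. coef g k - \<mu> k / (\<mu> k + \<tau>) * coef f k)" and "\<tau> > 0"
    and L2: "g \<in> L2_on \<Omega>" "f \<in> L2_on \<Omega>" "\<psi> \<in> L2_on \<Omega>" and \<psi>: "\<And>x. x \<in> \<Omega> \<Longrightarrow> 0 \<le> \<psi> x"
  shows "(\<Sum>k. \<mu> k / (\<mu> k + \<tau>) * (coef f k * coef \<psi> k)) \<le> (\<integral>x. g x * \<psi> x \<partial>M)"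
proof -
  have s: "summable (\<lambda>k. (\<mu> k / (\<mu> k + \<tau>) * coef f k)\<^sup>2)"
    using summable_square_add[OF coef_square_summable[OF L2(1)]
        summable_square_cmult[OF nonneg_seq_summable[OF n], of "-1"]] by simp
  have "0 \<le> (\<Sum>k. (coef g k - \<mu> k / (\<mu> k + \<tau>) * coef f k) * coef \<psi> k)"
    by (rule nonneg_seqD[OF n L2(3) \<psi>])
  also have "\<dots> = (\<Sum>k. coef g k * coef \<psi> k) - (\<Sum>k. \<mu> k / (\<mu> k + \<tau>) * coef f k * coef \<psi> k)"
    using suminf_diff[OF summable_mult_coef[OF coef_square_summable[OF L2(1)] L2(3)] summable_mult_coef[OF s L2(3)]]
    by (simp add: left_diff_distrib)
  finally show ?thesis
    using coef_sums[OF L2(1,3)] by (simp add: sums_iff mult.assoc)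
qed

lemma bump_integral_pos:
  assumes "cball y R \<subseteq> \<Omega>" "R > 0" "p \<ge> 3"
  shows "0 < (\<integral>x. bump p y R x \<partial>M)"
proof -
  let ?c = "(R\<^sup>2 - (R / 2)\<^sup>2) ^ p"
  have c: "?c > 0" using assms(2) by (simp add: power2_eq_square)
  have B: "ball y (R / 2) \<subseteq> \<Omega>"
    using assms(1,2) by (auto simp: subset_iff)
  have iB: "integrable M (\<lambda>x. ?c * indicator (ball y (R / 2)) x)"
    by (rule L2_on_mult_integrable[OF L2_on_const[OF open_bounded] L2_indicator]) simp
  have mB: "measure M (ball y (R / 2)) = measure lebesgue (ball y (R / 2))"
    by (rule measure_restrict_space) (use B open_bounded(1) in \<open>auto simp: borel_open\<close>)
  have "ball y (R / 2) \<inter> \<Omega> = ball y (R / 2)"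
    using B by blast
  then have eB: "(\<integral>x. ?c * indicator (ball y (R / 2)) x \<partial>M) = ?c * measure lebesgue (ball y (R / 2))"
    by (simp add: mB)
  have ib: "integrable M (bump p y R)"
    by (rule integrable_compact_support[OF open_bounded(1) bump_continuous[OF assms(3)] compact_cball assms(1)])
      (use assms(2) in \<open>auto intro!: bump_outside\<close>)
  have "0 < ?c * measure lebesgue (ball y (R / 2))"
    using c assms(2) content_ball_pos[of "R / 2" y] by simp
  also have "\<dots> \<le> (\<integral>x. bump p y R x \<partial>M)"
    unfolding eB[symmetric]
  proof (rule integral_mono[OF iB ib])
    show "?c * indicator (ball y (R / 2)) x \<le> bump p y R x" for x
      using bump_ge[of "R / 2" R x y p] bump_nonneg[of p y R x] assms(2) by (auto simp: indicator_def)
  qed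
  finally show ?thesis .
qed

lemma bump_integral_mult:
  assumes "cball y R \<subseteq> \<Omega>" "R > 0" "p \<ge> 3" "continuous_on \<Omega> g"
  shows "integrable M (\<lambda>x. g x * bump p y R x)"
    and "(\<And>x. x \<in> ball y R \<Longrightarrow> g x \<le> \<delta>) \<Longrightarrow>
      (\<integral>x. g x * bump p y R x \<partial>M) \<le> \<delta> * (\<integral>x. bump p y R x \<partial>M)"
proof -
  have b0: "x \<notin> ball y R \<Longrightarrow> bump p y R x = 0" for x
    using assms(2) by (intro bump_outside) auto
  have i: "integrable M (\<lambda>x. h x * bump p y R x)" if "continuous_on \<Omega> h" for h
    by (rule integrable_compact_support[OF open_bounded(1) _ compact_cball assms(1)])
      (use b0 in \<open>auto intro!: continuous_intros that bump_continuous[OF assms(3)]\<close>)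
  show ig: "integrable M (\<lambda>x. g x * bump p y R x)"
    by (rule i[OF assms(4)])
  assume le: "\<And>x. x \<in> ball y R \<Longrightarrow> g x \<le> \<delta>"
  have "(\<integral>x. g x * bump p y R x \<partial>M) \<le> (\<integral>x. \<delta> * bump p y R x \<partial>M)"
  proof (rule integral_mono[OF ig i])
    show "g x * bump p y R x \<le> \<delta> * bump p y R x" for x
      using b0[of x] le[of x] bump_nonneg[of p y R x]
      by (cases "x \<in> ball y R") (auto intro: mult_right_mono)
  qed simp
  then show "(\<integral>x. g x * bump p y R x \<partial>M) \<le> \<delta> * (\<integral>x. bump p y R x \<partial>M)"
    by simp
qed

text \<open>Paired with a bump, \<open>\<Delta> u\<close> gives
  \<open>- (\<Sum>k. \<mu> k powr \<sigma> * d k)\<close>, which is at least a fixed positive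
  multiple of the mass of the bump. If \<open>\<Delta> u z \<le> 0\<close>, continuity would bound
  the same pairing by an arbitrarily small multiple.\<close>

lemma laplacian_pos_at_level:
  assumes s: "0 < s" "s < 1" and "lam > 0" "\<gamma> > 0"
    and frac: "has_spectral_frac_laplacian \<Omega> \<mu> \<phi> s u (\<lambda>x. lam * max (u x - \<gamma>) 0)"
    and u: "C2_data \<Omega> u G H" "continuous_on (closure \<Omega>) u" "\<And>x. x \<in> frontier \<Omega> \<Longrightarrow> u x = 0"
    and z: "z \<in> \<Omega>" "u z = \<gamma>"
  shows "0 < (\<Sum>i\<in>UNIV. H i z)"
proof (rule ccontr)
  assume neg: "\<not> 0 < (\<Sum>i\<in>UNIV. H i z)"
  define \<sigma> where "\<sigma> = 1 - s"
  have \<sigma>: "0 < \<sigma>" "\<sigma> < 1" using s by (auto simp: \<sigma>_def)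
  define f where "f = (\<lambda>x. lam * max (u x - \<gamma>) 0)"
  obtain a where a: "L2_expansion \<Omega> \<phi> a u" "L2_expansion \<Omega> \<phi> (\<lambda>k. \<mu> k powr s * a k) f"
    using frac unfolding has_spectral_frac_laplacian_def f_def by blast
  then have L2: "u \<in> L2_on \<Omega>" "f \<in> L2_on \<Omega>" by (auto simp: L2_expansion_def)
  have cf: "coef f k = \<mu> k powr s * coef u k" for k
    using expansion_coef[OF a(1)] expansion_coef[OF a(2)] by metis
  have uc: "continuous_on \<Omega> u" using C2_dataD(1)[OF u(1)] .
  have fc: "continuous_on \<Omega> f" unfolding f_def by (intro continuous_intros uc)
  have f0: "0 \<le> f x" for x using \<open>lam > 0\<close> by (simp add: f_def)
  have lc: "continuous_on \<Omega> (\<lambda>x. \<Sum>i\<in>UNIV. H i x)"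
    by (intro continuous_intros C2_dataD(3)[OF u(1)])
  have near: "\<exists>r>0. ball z r \<subseteq> \<Omega> \<and> (\<forall>x\<in>ball z r. g x < \<delta>)"
    if "continuous_on \<Omega> g" "g z < \<delta>" for g :: "real ^ 'n \<Rightarrow> real" and \<delta>
  proof -
    have "open (\<Omega> \<inter> g -` {..<\<delta>})"
      by (rule continuous_open_preimage[OF that(1) open_bounded(1)]) simp
    moreover have "z \<in> \<Omega> \<inter> g -` {..<\<delta>}" using z that(2) by simp
    ultimately obtain r where "r > 0" "ball z r \<subseteq> \<Omega> \<inter> g -` {..<\<delta>}"
      unfolding open_contains_ball by blast
    then show ?thesis by (intro exI[of _ r]) auto
  qed
  have bumpL2: "bump 3 z R \<in> L2_on \<Omega>" for R
    by (rule L2_on_continuous_closure[OF open_bounded bump_continuous]) simp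
  \<comment> \<open>If \<open>f\<close> vanished, so would all coefficients of \<open>u\<close>,
    because \<open>\<mu> k powr s > 0\<close>. Then \<open>u\<close> would pair to zero with a bump
    around \<open>z\<close>, although \<open>u > \<gamma> / 2\<close> there.\<close>
  have "\<exists>y\<in>\<Omega>. f y > 0"
  proof (rule ccontr)
    assume "\<not> (\<exists>y\<in>\<Omega>. f y > 0)"
    then have "f x = 0" if "x \<in> \<Omega>" for x
      using f0[of x] that by force
    then have "coef f k = 0" for k
      unfolding coef_def by (intro Bochner_Integration.integral_eq_zero_AE AE_I2) simp
    then have cu: "coef u k = 0" for k
      using cf[of k] \<mu>_pos[of k] by simp
    obtain r where r: "r > 0" "ball z r \<subseteq> \<Omega>" "\<And>x. x \<in> ball z r \<Longrightarrow> - u x < - \<gamma> / 2"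
      using near[of "\<lambda>x. - u x" "- \<gamma> / 2"] z \<open>\<gamma> > 0\<close> continuous_on_minus[OF uc] by auto
    have c: "cball z (r / 2) \<subseteq> \<Omega>" using r by (auto simp: subset_iff)
    have "(\<integral>x. - u x * bump 3 z (r / 2) x \<partial>M) \<le> - \<gamma> / 2 * (\<integral>x. bump 3 z (r / 2) x \<partial>M)"
      by (rule bump_integral_mult(2)[OF c _ _ continuous_on_minus[OF uc]])
        (use r in \<open>auto intro!: less_imp_le\<close>)
    moreover have "(\<integral>x. u x * bump 3 z (r / 2) x \<partial>M) = 0"
      using coef_sums[OF L2(1) bumpL2, of "r / 2"] cu sums_unique2[OF sums_zero] by force
    moreover have "0 < (\<integral>x. bump 3 z (r / 2) x \<partial>M)"
      by (rule bump_integral_pos[OF c]) (use r in auto)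
    ultimately show False
      using \<open>\<gamma> > 0\<close> by (simp add: mult_le_0_iff zero_le_mult_iff)
  qed
  then obtain y where y: "y \<in> \<Omega>" "f y > 0" by blast
  obtain c r0 where c: "c > 0" "r0 > 0" "ball z r0 \<subseteq> \<Omega>"
    "\<And>\<tau>. 0 < \<tau> \<Longrightarrow> \<tau> \<le> 1 \<Longrightarrow> nonneg_seq (\<lambda>k. coef f k / (\<mu> k + \<tau>) - c * coef (indicator (ball z r0)) k)"
    using resolvent_lower_bound[OF L2(2) fc f0 y z(1)] by blast
  obtain B where B: "B \<ge> 0"
    "\<And>\<tau>. \<tau> > 0 \<Longrightarrow> nonneg_seq (\<lambda>k. coef (\<lambda>_. B / \<tau>) k - \<mu> k / (\<mu> k + \<tau>) * coef f k)"
    using resolvent_upper_bound[OF u \<open>\<gamma> > 0\<close> \<open>lam > 0\<close>] unfolding f_def by blast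
  define C where "C = stieltjes_const \<sigma>"
  have "C > 0" unfolding C_def by (rule stieltjes_one(2)[OF \<sigma>])
  \<comment> \<open>The gain from small \<open>\<tau>\<close>: the integral of
    \<open>c * \<tau> powr \<sigma>\<close> over \<open>{0..1}\<close>. The tail, the term with
    \<open>\<delta>\<close> and the term with \<open>\<theta>\<close> are each allotted a quarter of
    it.\<close>
  define \<kappa> where "\<kappa> = c / (\<sigma> + 1)"
  have "\<kappa> > 0" using c \<sigma> by (simp add: \<kappa>_def)
  have "((\<lambda>T. B * (T powr (\<sigma> - 1) / (1 - \<sigma>))) \<longlongrightarrow> B * (0 / (1 - \<sigma>))) at_top"
    by (intro tendsto_intros tendsto_neg_powr filterlim_ident) (use \<sigma> in auto)
  then have "\<forall>\<^sub>F T in at_top. B * (T powr (\<sigma> - 1) / (1 - \<sigma>)) < \<kappa> / 4"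
    by (rule order_tendstoD(2)) (use \<open>\<kappa> > 0\<close> in simp)
  then have "\<forall>\<^sub>F T in at_top. B * (T powr (\<sigma> - 1) / (1 - \<sigma>)) < \<kappa> / 4 \<and> 1 \<le> T"
    by (intro eventually_conj eventually_ge_at_top)
  then obtain T where T: "B * (T powr (\<sigma> - 1) / (1 - \<sigma>)) < \<kappa> / 4" "1 \<le> T"
    using eventually_happens'[OF trivial_limit_at_top_linorder] by blast
  define A where "A = T powr \<sigma> / \<sigma>"
  have "A > 0" using T \<sigma> by (simp add: A_def)
  define \<delta> where "\<delta> = \<kappa> / (4 * A)"
  have \<delta>: "\<delta> > 0" "\<delta> * A = \<kappa> / 4"
    using \<open>\<kappa> > 0\<close> \<open>A > 0\<close> by (auto simp: \<delta>_def)
  define \<theta> where "\<theta> = \<kappa> / (4 * C)"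
  have \<theta>: "\<theta> > 0" "C * \<theta> = \<kappa> / 4"
    using \<open>\<kappa> > 0\<close> \<open>C > 0\<close> by (auto simp: \<theta>_def)
  have "f z < \<delta>" using z(2) \<delta> by (simp add: f_def)
  then obtain r1 where r1: "r1 > 0" "\<And>x. x \<in> ball z r1 \<Longrightarrow> f x < \<delta>"
    using near[OF fc] by blast
  obtain r2 where r2: "r2 > 0" "\<And>x. x \<in> ball z r2 \<Longrightarrow> (\<Sum>i\<in>UNIV. H i x) < \<theta>"
    using near[OF lc, of \<theta>] neg \<theta> by force
  \<comment> \<open>All constants so far are independent of the bump; only now is its radius fixed.
    \<open>R < r0\<close> makes the indicator of \<open>ball z r0\<close> equal to 1 on the support
    of \<open>\<psi>\<close>.\<close>
  define R where "R = min (r0 / 2) (min r1 r2)"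
  have R: "R > 0" "R < r0" "R \<le> r1" "R \<le> r2"
    using c r1 r2 by (auto simp: R_def)
  have cR: "cball z R \<subseteq> \<Omega>" using c(3) R by (auto simp: subset_iff)
  define \<psi> where "\<psi> = bump 3 z R"
  define \<Psi> where "\<Psi> = (\<integral>x. \<psi> x \<partial>M)"
  define L where "L x = (\<Sum>i\<in>UNIV. bump_H 3 z R i x)" for x
  have \<psi>2: "C2_data \<Omega> \<psi> (bump_G 3 z R) (bump_H 3 z R)"
    unfolding \<psi>_def by (rule C2_data_bump) simp
  have \<psi>L2: "\<psi> \<in> L2_on \<Omega>" unfolding \<psi>_def by (rule bumpL2)
  have \<psi>0: "0 \<le> \<psi> x" for x unfolding \<psi>_def by (rule bump_nonneg)
  have \<psi>out: "x \<notin> ball z R \<Longrightarrow> \<psi> x = 0" for x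
    unfolding \<psi>_def using R by (intro bump_outside) auto
  then have \<psi>K: "x \<in> \<Omega> - cball z R \<Longrightarrow> \<psi> x = 0" for x by auto
  have "\<Psi> > 0"
    unfolding \<Psi>_def \<psi>_def by (rule bump_integral_pos[OF cR R(1)]) simp
  have int_le: "(\<integral>x. g x * \<psi> x \<partial>M) \<le> d * \<Psi>"
    if "continuous_on \<Omega> g" "\<And>x. x \<in> ball z R \<Longrightarrow> g x \<le> d" for g d
    unfolding \<Psi>_def \<psi>_def by (rule bump_integral_mult(2)[OF cR R(1) _ that]) simp_all
  have LL2: "L \<in> L2_on \<Omega>"
    unfolding L_def[abs_def]
    by (rule L2_on_continuous_closure[OF open_bounded]) (intro continuous_intros C2_dataD(3)[OF C2_data_bump], simp)
  have cL: "coef L k = - \<mu> k * coef \<psi> k" for k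
    unfolding L_def[abs_def] by (rule coef_laplacian[OF \<psi>2 compact_cball cR \<psi>K])
  define d where "d k = coef f k * coef \<psi> k" for k
  \<comment> \<open>Since \<open>\<sigma> + s = 1\<close>, the factor
    \<open>\<mu> k powr \<sigma>\<close> and the power \<open>s\<close> carried by
    \<open>coef f k\<close> combine to a full eigenvalue, which passes to \<open>\<psi>\<close> as
    \<open>- coef L k\<close>.\<close>
  have \<mu>d: "\<mu> k powr \<sigma> * d k = - (coef u k * coef L k)" for k
  proof -
    have "\<mu> k powr \<sigma> * \<mu> k powr s = \<mu> k"
      using \<mu>_pos[of k] by (simp add: powr_add[symmetric] \<sigma>_def)
    then show ?thesis
      by (simp add: d_def cf cL mult.assoc[symmetric])
  qed
  have d1: "summable (\<lambda>k. \<bar>d k\<bar>)"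
    unfolding d_def by (intro summable_mult_square coef_square_summable L2 \<psi>L2)
  \<comment> \<open>Since \<open>L\<close> is in L2, this is, up to signs, the absolutely convergent
    Parseval series of \<open>u\<close> and \<open>L\<close>.\<close>
  have d2: "summable (\<lambda>k. \<mu> k powr \<sigma> * \<bar>d k\<bar>)"
  proof -
    have "\<mu> k powr \<sigma> * \<bar>d k\<bar> = \<bar>coef u k * coef L k\<bar>" for k
      using arg_cong[OF \<mu>d, of abs k] by (simp add: abs_mult)
    then show ?thesis
      using summable_mult_square(1)[OF coef_square_summable[OF L2(1)] coef_square_summable[OF LL2]] by simp
  qed
  have "(\<integral>x. (\<Sum>i\<in>UNIV. H i x) * \<psi> x \<partial>M) = (\<integral>x. u x * L x \<partial>M)"
    unfolding L_def using green_identity[OF open_bounded(1) u(1) \<psi>2 compact_cball cR \<psi>K]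
    by (simp add: mult.commute)
  also have "\<dots> = (\<Sum>k. coef u k * coef L k)"
    using coef_sums[OF L2(1) LL2] by (simp add: sums_iff)
  also have "\<dots> = - (\<Sum>k. \<mu> k powr \<sigma> * d k)"
    using suminf_minus[OF sums_summable[OF coef_sums[OF L2(1) LL2]]] by (simp add: \<mu>d)
  finally have lower: "- (\<Sum>k. \<mu> k powr \<sigma> * d k) \<le> \<theta> * \<Psi>"
    using int_le[OF lc, of \<theta>] r2(2) R by (force intro: less_imp_le)
  have gen: "(\<Sum>k. \<mu> k / (\<mu> k + \<tau>) * d k) \<le> (\<integral>x. g x * \<psi> x \<partial>M)"
    if "nonneg_seq (\<lambda>k. coef g k - \<mu> k / (\<mu> k + \<tau>) * coef f k)" "\<tau> > 0" "g \<in> L2_on \<Omega>" for g \<tau>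
    unfolding d_def by (rule resolvent_pairing_le[OF that L2(2) \<psi>L2 \<psi>0])
  have resolvent_eq: "\<tau> * (coef f k / (\<mu> k + \<tau>)) = coef f k - \<mu> k / (\<mu> k + \<tau>) * coef f k" if "\<tau> > 0" for k \<tau>
  proof -
    have "\<mu> k + \<tau> \<noteq> 0" using \<mu>_pos[of k] that by simp
    then show ?thesis by (simp add: field_simps)
  qed
  have f\<psi>: "(\<integral>x. f x * \<psi> x \<partial>M) \<le> \<delta> * \<Psi>"
    by (rule int_le[OF fc]) (use r1(2) R in \<open>auto intro!: less_imp_le\<close>)
  have h1: "(\<Sum>k. \<mu> k / (\<mu> k + \<tau>) * d k) \<le> \<delta> * \<Psi>" if "\<tau> > 0" for \<tau>
  proof -
    have "nonneg_seq (\<lambda>k. \<tau> * (coef f k / (\<mu> k + \<tau>)))"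
      by (intro nonneg_seq_cmult nonneg_seq_resolvent nonneg_seq_coef L2 f0) (use that in auto)
    then have "nonneg_seq (\<lambda>k. coef f k - \<mu> k / (\<mu> k + \<tau>) * coef f k)"
      unfolding resolvent_eq[OF that] .
    then show ?thesis
      using gen[OF _ that L2(2)] f\<psi> by (meson order.trans)
  qed
  have h2: "(\<Sum>k. \<mu> k / (\<mu> k + \<tau>) * d k) \<le> \<delta> * \<Psi> - c * \<Psi> * \<tau>" if "\<tau> > 0" "\<tau> \<le> 1" for \<tau>
  proof -
    \<comment> \<open>The lower bound \<open>\<tau> (A + \<tau>)^-1 f \<ge> \<tau> * c\<close> on
      \<open>ball z r0\<close> makes \<open>g\<close> an upper bound for
      \<open>A (A + \<tau>)^-1 f\<close>.\<close>
    define g where "g x = f x - (\<tau> * c) * indicator (ball z r0) x" for x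
    have i: "(\<lambda>x. (\<tau> * c) * indicator (ball z r0) x) \<in> L2_on \<Omega>"
      by (intro L2_on_cmult L2_indicator) simp
    have g: "g \<in> L2_on \<Omega>"
      unfolding g_def[abs_def] by (rule L2_on_diff[OF L2(2) i])
    have cg: "coef g k = coef f k - \<tau> * c * coef (indicator (ball z r0)) k" for k
      unfolding g_def[abs_def] coef_diff[OF L2(2) i] coef_cmult ..
    have "nonneg_seq (\<lambda>k. \<tau> * (coef f k / (\<mu> k + \<tau>) - c * coef (indicator (ball z r0)) k))"
      by (intro nonneg_seq_cmult c(4)) (use that in auto)
    then have "nonneg_seq (\<lambda>k. coef g k - \<mu> k / (\<mu> k + \<tau>) * coef f k)"
      unfolding right_diff_distrib resolvent_eq[OF that(1)]
      by (rule nonneg_seq_cong) (simp add: cg)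
    then have "(\<Sum>k. \<mu> k / (\<mu> k + \<tau>) * d k) \<le> (\<integral>x. g x * \<psi> x \<partial>M)"
      by (rule gen) (use that g in auto)
    also have "\<dots> = (\<integral>x. f x * \<psi> x - (\<tau> * c) * \<psi> x \<partial>M)"
    proof (rule Bochner_Integration.integral_cong)
      show "g x * \<psi> x = f x * \<psi> x - \<tau> * c * \<psi> x" for x
        using \<psi>out[of x] R(2) by (cases "x \<in> ball z R") (auto simp: g_def left_diff_distrib)
    qed simp
    also have "\<dots> = (\<integral>x. f x * \<psi> x \<partial>M) - (\<tau> * c) * \<Psi>"
    proof -
      have "integrable M \<psi>"
        using bump_integral_mult(1)[OF cR R(1), of 3 "\<lambda>_. 1"] by (simp add: \<psi>_def)
      then show ?thesis
        using L2_on_mult_integrable[OF L2(2) \<psi>L2] by (simp add: \<Psi>_def)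
    qed
    finally show ?thesis using f\<psi> by (simp add: mult_ac)
  qed
  have h3: "(\<Sum>k. \<mu> k / (\<mu> k + \<tau>) * d k) \<le> B * \<Psi> / \<tau>" if "\<tau> > 0" for \<tau>
    using gen[OF B(2)[OF that] that L2_on_const[OF open_bounded]] by (simp add: \<Psi>_def)
  have "C * (\<Sum>k. \<mu> k powr \<sigma> * d k) \<le>
      \<delta> * \<Psi> * (T powr \<sigma> / \<sigma>) - c * \<Psi> / (\<sigma> + 1) + B * \<Psi> * (T powr (\<sigma> - 1) / (1 - \<sigma>))"
    unfolding C_def
    by (rule stieltjes_sum_upper_bound[OF \<sigma> \<mu>_pos d1 d2 h1 h2 h3 _ _ T(2)])
      (use \<delta> B \<open>\<Psi> > 0\<close> in auto)
  also have "\<dots> = \<Psi> * (\<delta> * A - \<kappa> + B * (T powr (\<sigma> - 1) / (1 - \<sigma>)))"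
    by (simp add: A_def \<kappa>_def algebra_simps)
  also have "\<dots> < \<Psi> * (- \<kappa> / 2)"
  proof (rule mult_strict_left_mono[OF _ \<open>\<Psi> > 0\<close>])
    show "\<delta> * A - \<kappa> + B * (T powr (\<sigma> - 1) / (1 - \<sigma>)) < - \<kappa> / 2"
      unfolding \<delta>(2) using T(1) by linarith
  qed
  finally have 1: "C * (\<Sum>k. \<mu> k powr \<sigma> * d k) < - (\<kappa> / 2) * \<Psi>"
    by (simp add: mult.commute)
  have "C * (- (\<Sum>k. \<mu> k powr \<sigma> * d k)) \<le> C * (\<theta> * \<Psi>)"
    by (rule mult_left_mono[OF lower]) (use \<open>C > 0\<close> in simp)
  then have "- (C * (\<Sum>k. \<mu> k powr \<sigma> * d k)) \<le> \<kappa> / 4 * \<Psi>"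
    by (simp add: mult.assoc[symmetric] \<theta>(2))
  then have "\<kappa> / 2 * \<Psi> < \<kappa> / 4 * \<Psi>"
    using 1 by linarith
  then show False
    using \<open>\<kappa> > 0\<close> \<open>\<Psi> > 0\<close> by simp
qed

end

theorem proposition5p2:
  fixes \<Omega> :: "(real ^ 'n::finite) set"
    and \<mu> :: "nat \<Rightarrow> real" and \<phi> :: "nat \<Rightarrow> real ^ 'n \<Rightarrow> real"
    and s lam \<gamma> :: real and u :: "real ^ 'n \<Rightarrow> real"
  assumes "smooth_bounded_domain \<Omega>"
    and "dirichlet_eigensystem \<Omega> \<mu> \<phi>"
    and "1/2 < s" and "s < 1"
    and "lam > 0" and "\<gamma> > 0"
    and "u \<in> energy_space \<Omega> \<mu> \<phi> s"
    and "has_spectral_frac_laplacian \<Omega> \<mu> \<phi> s u (\<lambda>x. lam * max (u x - \<gamma>) 0)"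
    and "continuous_on (closure \<Omega>) u"
    and "\<forall>x\<in>frontier \<Omega>. u x = 0"
    and "Ck_on 2 u \<Omega>"
  shows "\<exists>U. openin (top_of_set \<Omega>) U \<and> {x\<in>\<Omega>. u x = \<gamma>} \<subseteq> U \<and>
           (\<forall>x\<in>U. laplacian u x > 0)"
proof -
  interpret dirichlet_domain \<Omega> \<mu> \<phi>
    by unfold_locales (fact assms)+
  note u = C2_data_Ck_on[OF assms(11)]
  \<comment> \<open>By continuity the whole positivity set of the Laplacian is open in
    \<open>\<Omega>\<close> and serves as \<open>U\<close>, so only points of the level set need to
    be examined.\<close>
  have "continuous_on \<Omega> (laplacian u)"
    unfolding laplacian_def[abs_def] by (intro continuous_intros C2_dataD(3)[OF u])
  then have "openin (top_of_set \<Omega>) (\<Omega> \<inter> laplacian u -` {0<..})"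
    by (rule continuous_openin_preimage_gen) simp
  moreover have "{x \<in> \<Omega>. u x = \<gamma>} \<subseteq> \<Omega> \<inter> laplacian u -` {0<..}"
  proof
    fix x assume "x \<in> {x \<in> \<Omega>. u x = \<gamma>}"
    then show "x \<in> \<Omega> \<inter> laplacian u -` {0<..}"
      using laplacian_pos_at_level[OF _ assms(4,5,6,8) u assms(9), of x] assms(3,10)
      by (simp add: laplacian_def)
  qed
  ultimately show ?thesis
    by (intro exI[of _ "\<Omega> \<inter> laplacian u -` {0<..}"]) auto
qed

end
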